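(* Let $w_\ell<w_u$ be real numbers and let $\tilde q>0$, $k_0>0$ be such that $$\frac{\min\{k_0,1\}}{\sqrt2}\lambda>k_0^2\bigl(1+\tilde q\max\{-w_\ell,w_u\}\bigr).$$ Let $w\in W_{\mathrm{ad}}$, let $u\in H^1(\Omega,\mathbb{C})$ solve $$\int_\Omega\nabla u\cdot\nabla\overline v-k_0^2\int_\Omega(1+qw)u\overline v-ik_0\int_{\partial\Omega}u\overline v=k_0^2\int_\Omega qwu_0\overline v\quad\text{for all }v\in H^1(\Omega,\mathbb{C}),$$ and let $u_h\in H^1(\Omega,\mathbb{C})$ solve $$\int_\Omega\nabla u_h\cdot\nabla\overline v-k_0^2\int_\Omega u_h\overline v-k_0^2\int_\Omega q(P_hw)(P_hu_h)\overline v-ik_0\int_{\partial\Omega}u_h\overline v=k_0^2\int_\Omega qwu_0\overline v\quad\text{for all }v\in H^1(\Omega,\mathbb{C}).$$ Then $$\|u-u_h\|_{L^2(\Omega,\mathbb{C})}\le\tilde C_{3/2}^a(w)\,d_h^{3/2}+\tilde C_{3/2}^b\,d_h^2$$ with $$\tilde C_{3/2}^a(w)=k_0^2\,\alpha(\Omega)^{3/2}\,\tilde q\,\|u_0\|_{L^2(\Omega,\mathbb{C})}\,|w_u-w_\ell|^{1/2}\,\mathrm{TV}(w)^{1/2}\Bigl(c_2^p+\sqrt2\,c_3\bigl(C(\Omega)(1+|k_0|)+c_1c_2^p+c_2^p\bigr)\Bigr),$$ $$\tilde C_{3/2}^b=\alpha(\Omega)^2\,c_2\,c_2^p\,\bigl(1+\tilde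 q\max\{-w_\ell,w_u\}\bigr)\,\|u_0\|_{L^2(\Omega,\mathbb{C})}.$$
   Context: $\Omega\subset\mathbb{R}^2$ is an open square (so $n=2$). $W_{\mathrm{ad}}=\{w\in L^\infty(\Omega):w_\ell\le w\le w_u\text{ a.e.}\}$ (real-valued). $q=\tilde q\,1_{\tilde\Omega}$ for a subset $\tilde\Omega\subset\Omega$; $u_0(x)=\exp(ik_0\,d\cdot x)$ with fixed $d\in\mathbb{R}^2$. Boundary integrals use traces. $\mathrm{TV}(w)\in[0,\infty]$ is the total variation of $w$ on $\Omega$. $\{\mathcal{Q}_h\}_h$, $\mathcal{Q}_h=\{Q_h^1,\dots,Q_h^{N_h}\}$, are partitions of $\Omega$ with mesh sizes $h$ satisfying bounded eccentricity (there is $C>0$ such that each $Q_h^i$ lies in a closed ball $B_h^i$ with $\operatorname{meas}B_h^i\le C\operatorname{meas}Q_h^i$); $d_h$ is the maximal cell diameter; $P_hg=\sum_{i=1}^{N_h}1_{Q_h^i}\frac1{\operatorname{meas}Q_h^i}\int_{Q_h^i}g$ is local averaging. The partitions are compatible with $\tilde\Omega$: $\tilde\Omega=\bigcup_{i\in I}Q_h^i$ for some $I\subset\{1,\dots,N_h\}$. $\alpha(\Omega)>0$ is a constant such that for all $h$: $\|g-P_hg\|_{L^2(\Omega,\mathbb{C})}\le\alpha(\Omega)d_h\|\nabla g\|_{L^2(\Omega,\mathbb{C}^2)}$ for all $g\in H^1(\Omega,\mathbb{C})$, and $\|w-P_hw\|_{L^1(\Omega)}\le\alpha(\Omega)d_h\mathrm{TV}(w)$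 for all $w\in L^1(\Omega)$. $\|y\|_{H^1(\Omega,\mathbb{C})}^2=\|y\|_{L^2(\Omega,\mathbb{C})}^2+\|\nabla y\|_{L^2(\Omega,\mathbb{C}^2)}^2$, and $\lambda>0$ is a constant with $\sqrt\lambda\,\|y\|_{H^1(\Omega,\mathbb{C})}\le\sqrt{\|y\|_{L^2(\partial\Omega,\mathbb{C})}^2+\|\nabla y\|_{L^2(\Omega,\mathbb{C}^2)}^2}$ for all $y\in H^1(\Omega,\mathbb{C})$. $C(\Omega)>0$ denotes the constant, depending only on $\Omega$, of the known $H^2$-regularity estimate for the Helmholtz problem with Robin boundary conditions (Melenk): for every $k>0$ and $g\in L^2(\Omega,\mathbb{C})$, the weak solution $y$ of $-\Delta y-k^2y=g$ in $\Omega$, $\partial_n y=\pm iky$ on $\partial\Omega$ (either sign) satisfies $|y|_{H^2(\Omega,\mathbb{C})}\le C(\Omega)(1+|k|)\|g\|_{L^2(\Omega,\mathbb{C})}$, where $|y|_{H^2(\Omega,\mathbb{C})}=\bigl(\sum_{i,j}\|\partial_{x_i}\partial_{x_j}y\|_{L^2(\Omega,\mathbb{C})}^2\bigr)^{1/2}$. $c_3=c_3(\Omega)$ is the embedding constant of $H^2(\Omega,\mathbb{C})\hookrightarrow L^\infty(\Omega,\mathbb{C})$. Further, $c_1:=C(\Omega)(1+|k_0|)k_0^2\tilde q\max\{-w_\ell,w_u\}$; $c_2^p:=c^{-1}$ and $c_2:=c^{-1}k_0^2\tilde q\max\{-w_\ell,w_u\}$ with $c:=\lambda\min\{1,k_0\}/\sqrt2-k_0^2(1+\tilde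 q\max\{0,w_u\})$. *)

theory Defs
  imports "HOL-Analysis.Analysis"
begin

text \<open>The open square with corner \<open>a\<close>, edge direction \<open>e\<close> (a unit vector) and side length \<open>L\<close>.
  Arbitrary rotations are allowed.\<close>

definition perp :: "real^2 \<Rightarrow> real^2" where
  "perp e = vector [- (e $ 2), e $ 1]"

definition open_square :: "real^2 \<Rightarrow> real^2 \<Rightarrow> real \<Rightarrow> (real^2) set" where
  "open_square a e L = {a + s *\<^sub>R e + t *\<^sub>R perp e | s t. 0 < s \<and> s < L \<and> 0 < t \<and> t < L}"

text \<open>The edge with number \<open>k < 4\<close>, parametrised by arc length \<open>t \<in> {0..L}\<close>.\<close>

definition square_edge :: "real^2 \<Rightarrow> real^2 \<Rightarrow> real \<Rightarrow> nat \<Rightarrow> real \<Rightarrow> real^2" where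
  "square_edge a e L k t =
     (if k = 0 then a + t *\<^sub>R e
      else if k = 1 then a + L *\<^sub>R e + t *\<^sub>R perp e
      else if k = 2 then a + L *\<^sub>R perp e + t *\<^sub>R e
      else a + t *\<^sub>R perp e)"

text \<open>Arc length measure on the boundary of the square: the sum over the four edges of the
  image of one-dimensional Lebesgue measure on \<open>{0..L}\<close>. (The corners are null sets.)\<close>

definition square_boundary :: "real^2 \<Rightarrow> real^2 \<Rightarrow> real \<Rightarrow> (real^2) measure" where
  "square_boundary a e L =
     distr (count_space {..<4} \<Otimes>\<^sub>M restrict_space lborel {0..L}) borel
       (\<lambda>(k, t). square_edge a e L k t)"

definition L2 :: "'a measure \<Rightarrow> ('a \<Rightarrow> 'b::{banach,second_countable_topology}) set" where
  "L2 M = {f \<in> borel_measurable M. integrable M (\<lambda>x. (norm (f x))\<^sup>2)}"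

definition L2norm :: "'a measure \<Rightarrow> ('a \<Rightarrow> 'b::{banach,second_countable_topology}) \<Rightarrow> real" where
  "L2norm M f = sqrt (\<integral>x. (norm (f x))\<^sup>2 \<partial>M)"

definition L2inner :: "'a measure \<Rightarrow> ('a \<Rightarrow> complex) \<Rightarrow> ('a \<Rightarrow> complex) \<Rightarrow> complex" where
  "L2inner M f g = (\<integral>x. f x * cnj (g x) \<partial>M)"

definition partial_deriv :: "2 \<Rightarrow> (real^2 \<Rightarrow> 'b::real_normed_vector) \<Rightarrow> real^2 \<Rightarrow> 'b" where
  "partial_deriv i f x = frechet_derivative f (at x) (axis i 1)"

definition C1 :: "(real^2 \<Rightarrow> 'b::real_normed_vector) set" where
  "C1 = {f. (\<forall>x. f differentiable (at x)) \<and> (\<forall>i. continuous_on UNIV (partial_deriv i f))}"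

definition C1_compact :: "(real^2) set \<Rightarrow> (real^2 \<Rightarrow> 'b::real_normed_vector) set" where
  "C1_compact \<Omega> = {f \<in> C1. \<exists>K. compact K \<and> K \<subseteq> \<Omega> \<and> (\<forall>x. x \<notin> K \<longrightarrow> f x = 0)}"

text \<open>In the supremum, \<open>ennreal\<close> cuts off negative values; this is harmless since the
  test field \<open>0\<close> contributes the value \<open>0\<close>.\<close>

definition TV :: "(real^2) set \<Rightarrow> (real^2 \<Rightarrow> real) \<Rightarrow> ennreal" where
  "TV \<Omega> w =
     (SUP \<phi> \<in> {\<phi> \<in> C1_compact \<Omega>. \<forall>x. norm (\<phi> x :: real^2) \<le> 1}.
        ennreal (\<integral>x. w x * (\<Sum>i\<in>UNIV. partial_deriv i \<phi> x $ i) \<partial>lebesgue_on \<Omega>))"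

definition ennreal_sqrt :: "ennreal \<Rightarrow> ennreal" where
  "ennreal_sqrt x = (if x = \<infinity> then \<infinity> else ennreal (sqrt (enn2real x)))"

definition weak_gradient ::
    "(real^2) set \<Rightarrow> (real^2 \<Rightarrow> complex) \<Rightarrow> (real^2 \<Rightarrow> complex^2) \<Rightarrow> bool" where
  "weak_gradient \<Omega> y G \<longleftrightarrow>
     (\<forall>\<phi> \<in> C1_compact \<Omega>. \<forall>i.
        (\<integral>x. partial_deriv i \<phi> x *\<^sub>R y x \<partial>lebesgue_on \<Omega>)
        = - (\<integral>x. (\<phi> x :: real) *\<^sub>R (G x $ i) \<partial>lebesgue_on \<Omega>))"

definition H1 :: "(real^2) set \<Rightarrow> (real^2 \<Rightarrow> complex) set" where
  "H1 \<Omega> = {y \<in> L2 (lebesgue_on \<Omega>). \<exists>G \<in> L2 (lebesgue_on \<Omega>). weak_gradient \<Omega> y G}"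

text \<open>A representative of the gradient; it is determined up to null sets of \<open>\<Omega>\<close>.\<close>

definition wgrad :: "(real^2) set \<Rightarrow> (real^2 \<Rightarrow> complex) \<Rightarrow> real^2 \<Rightarrow> complex^2" where
  "wgrad \<Omega> y = (SOME G. G \<in> L2 (lebesgue_on \<Omega>) \<and> weak_gradient \<Omega> y G)"

definition H1norm :: "(real^2) set \<Rightarrow> (real^2 \<Rightarrow> complex) \<Rightarrow> real" where
  "H1norm \<Omega> y = sqrt ((L2norm (lebesgue_on \<Omega>) y)\<^sup>2 + (L2norm (lebesgue_on \<Omega>) (wgrad \<Omega> y))\<^sup>2)"

definition grad_inner :: "(real^2) set \<Rightarrow> (real^2 \<Rightarrow> complex) \<Rightarrow> (real^2 \<Rightarrow> complex) \<Rightarrow> complex" where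
  "grad_inner \<Omega> u v = (\<integral>x. (\<Sum>i\<in>UNIV. wgrad \<Omega> u x $ i * cnj (wgrad \<Omega> v x $ i)) \<partial>lebesgue_on \<Omega>)"

definition H2 :: "(real^2) set \<Rightarrow> (real^2 \<Rightarrow> complex) set" where
  "H2 \<Omega> = {y \<in> H1 \<Omega>. \<forall>i. (\<lambda>x. wgrad \<Omega> y x $ i) \<in> H1 \<Omega>}"

definition H2seminorm :: "(real^2) set \<Rightarrow> (real^2 \<Rightarrow> complex) \<Rightarrow> real" where
  "H2seminorm \<Omega> y =
     sqrt (\<Sum>i\<in>UNIV. \<Sum>j\<in>UNIV.
       (L2norm (lebesgue_on \<Omega>) (\<lambda>x. wgrad \<Omega> (\<lambda>z. wgrad \<Omega> y z $ i) x $ j))\<^sup>2)"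

definition H2norm :: "(real^2) set \<Rightarrow> (real^2 \<Rightarrow> complex) \<Rightarrow> real" where
  "H2norm \<Omega> y = sqrt ((H1norm \<Omega> y)\<^sup>2 + (H2seminorm \<Omega> y)\<^sup>2)"

text \<open>The trace on the boundary, with boundary measure \<open>\<Gamma>\<close>: the continuous extension to
  \<open>H1 \<Omega>\<close> of the restriction map on functions that are \<open>C1\<close> up to the boundary, that is,
  restrictions of \<open>C1\<close> functions on the plane.\<close>

definition is_bdry_trace ::
    "(real^2) set \<Rightarrow> (real^2) measure \<Rightarrow> (real^2 \<Rightarrow> complex) \<Rightarrow> (real^2 \<Rightarrow> complex) \<Rightarrow> bool" where
  "is_bdry_trace \<Omega> \<Gamma> y g \<longleftrightarrow>
     g \<in> L2 \<Gamma> \<and>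
     (\<exists>f :: nat \<Rightarrow> real^2 \<Rightarrow> complex.
        (\<forall>n. f n \<in> C1) \<and>
        (\<lambda>n. H1norm \<Omega> (\<lambda>x. f n x - y x)) \<longlonglongrightarrow> 0 \<and>
        (\<lambda>n. L2norm \<Gamma> (\<lambda>x. f n x - g x)) \<longlonglongrightarrow> 0)"

definition bdry_trace ::
    "(real^2) set \<Rightarrow> (real^2) measure \<Rightarrow> (real^2 \<Rightarrow> complex) \<Rightarrow> real^2 \<Rightarrow> complex" where
  "bdry_trace \<Omega> \<Gamma> y = (SOME g. is_bdry_trace \<Omega> \<Gamma> y g)"

definition bdry_inner ::
    "(real^2) set \<Rightarrow> (real^2) measure \<Rightarrow> (real^2 \<Rightarrow> complex) \<Rightarrow> (real^2 \<Rightarrow> complex) \<Rightarrow> complex" where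
  "bdry_inner \<Omega> \<Gamma> u v = L2inner \<Gamma> (bdry_trace \<Omega> \<Gamma> u) (bdry_trace \<Omega> \<Gamma> v)"

text \<open>Weak solutions of \<open>- \<Delta> y - k\<^sup>2 y = g\<close> in \<open>\<Omega>\<close>, \<open>\<partial>\<^sub>n y = \<i> \<kappa> y\<close> on the boundary.\<close>

definition robin_solution ::
    "(real^2) set \<Rightarrow> (real^2) measure \<Rightarrow> real \<Rightarrow> real \<Rightarrow> (real^2 \<Rightarrow> complex) \<Rightarrow>
      (real^2 \<Rightarrow> complex) \<Rightarrow> bool" where
  "robin_solution \<Omega> \<Gamma> k \<kappa> g y \<longleftrightarrow>
     y \<in> H1 \<Omega> \<and>
     (\<forall>v \<in> H1 \<Omega>.
        grad_inner \<Omega> y v - of_real (k\<^sup>2) * L2inner (lebesgue_on \<Omega>) y v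
          - \<i> * of_real \<kappa> * bdry_inner \<Omega> \<Gamma> y v
        = L2inner (lebesgue_on \<Omega>) g v)"

definition cell_partition :: "(real^2) set \<Rightarrow> nat \<Rightarrow> (nat \<Rightarrow> (real^2) set) \<Rightarrow> bool" where
  "cell_partition \<Omega> N Q \<longleftrightarrow>
     (\<forall>i\<in>{1..N}. Q i \<in> sets lebesgue) \<and>
     disjoint_family_on Q {1..N} \<and>
     (\<Union>i\<in>{1..N}. Q i) = \<Omega>"

text \<open>The enclosing balls have positive radius, so all cells have positive measure.\<close>

definition eccentricity_bound :: "real \<Rightarrow> nat \<Rightarrow> (nat \<Rightarrow> (real^2) set) \<Rightarrow> bool" where
  "eccentricity_bound C N Q \<longleftrightarrow>
     (\<forall>i\<in>{1..N}. \<exists>z r. 0 < r \<and> Q i \<subseteq> cball z r \<and>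
        measure lebesgue (cball z r) \<le> C * measure lebesgue (Q i))"

definition max_diameter :: "nat \<Rightarrow> (nat \<Rightarrow> (real^2) set) \<Rightarrow> real" where
  "max_diameter N Q = Max ((\<lambda>i. diameter (Q i)) ` {1..N})"

definition local_average ::
    "nat \<Rightarrow> (nat \<Rightarrow> (real^2) set) \<Rightarrow> (real^2 \<Rightarrow> 'b::{banach,second_countable_topology}) \<Rightarrow>
      real^2 \<Rightarrow> 'b" where
  "local_average N Q g x =
     (\<Sum>i\<in>{1..N}. (indicator (Q i) x / measure lebesgue (Q i)) *\<^sub>R
        (\<integral>z. g z \<partial>lebesgue_on (Q i)))"

end

theory Submission
  imports Defs
begin

text \<open>
  The error \<open>e = u - uh\<close> is tested against the dual solution \<open>p\<close>, \<open>a(v, p) = (v, e)\<close> for all \<open>v\<close>, which gives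
  \<open>\<parallel>e\<parallel>\<^sup>2 = k0\<^sup>2 (q (w uh - (P w)(P uh)), p)\<close>. Subtracting cell averages, which are orthogonal to cellwise
  constant functions, leaves only products of at least two of the oscillations \<open>w - P w\<close>, \<open>uh - P uh\<close>,
  \<open>p - P p\<close>. The first contributes half a power of \<open>dh\<close>, since its \<open>L\<^sup>2\<close> norm is at most
  \<open>(wu - wl)\<^bsup>1/2\<^esup>\<close> times the square root of its \<open>L\<^sup>1\<close> norm, the other two contribute a full power each; the
  remaining factors are bounded uniformly by \<open>H\<^sup>2\<close> regularity.

  That the bound is linear, not quadratic, in \<open>c2p\<close> rests on a second coercivity constant of \<open>a\<close>,
  \<open>\<surd>2 k0\<^sup>2 qt max(-wl, wu)\<close>. It yields \<open>\<surd>2 \<parallel>uh\<parallel> \<le> \<parallel>u0\<parallel>\<close> and \<open>\<surd>2 k0\<^sup>2 qt max(-wl, wu) \<parallel>p\<parallel> \<le> \<parallel>e\<parallel>\<close>, and it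
  holds because \<open>lam \<le> 1\<close>, as one sees by inserting functions that vanish near the boundary.

  The dual solution comes from the Lax-Milgram lemma. The trace is a well-defined bounded operator because
  \<open>C\<^sup>1\<close> functions are dense in \<open>H\<^sup>1\<close> (contract towards the centre of the square, then mollify) and their
  boundary values are controlled by integrating along lines normal to the edges.
\<close>

subsection \<open>Square integrable functions\<close>

text \<open>Coercivity is read off in the direction \<open>1 + \<i>\<close>: the imaginary part of
  the form is minus the weighted boundary term, so \<open>Re z - Im z\<close> adds gradient and
  trace, the combination that \<open>lam\<close> controls. Passing to \<open>norm z\<close> costs
  the \<open>sqrt 2\<close> in \<open>c\<close>. The sup bounds of \<open>uh\<close> and
  \<open>p\<close> obtained from regularity already carry \<open>c2p\<close>; multiplying them by
  \<open>H1\<close> bounds that carry it too would square it. The second constant has the size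
  \<open>k0^2 * qt * max (- wl) wu\<close> of the source, so this factor cancels. Up to a common
  factor, each of the two products containing \<open>w - P w\<close> then costs the norm of
  \<open>u0\<close> times that of \<open>e\<close>, divided by \<open>sqrt 2\<close>; their sum is
  the \<open>sqrt 2\<close> in front of \<open>c3\<close>. The regularity estimate concerns the
  equation without potential, so the terms with \<open>q\<close> are counted as sources;
  \<open>p\<close>, which solves the adjoint problem, calls for the opposite Robin sign. Gradients
  and traces are chosen by \<open>SOME\<close> and hence are linear only almost everywhere; their
  uniqueness is proved before any form is shown to be sesquilinear.\<close>

lemma borel_measurable_cnj [measurable]:
  "f \<in> borel_measurable M \<Longrightarrow> (\<lambda>x. cnj (f x)) \<in> borel_measurable M"
  by (rule measurable_compose[OF _ borel_measurable_continuous_onI]) (auto intro: continuous_intros)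

lemma L2D:
  assumes "f \<in> L2 M"
  shows "f \<in> borel_measurable M" "integrable M (\<lambda>x. (norm (f x))\<^sup>2)"
  using assms by (auto simp: L2_def)

lemma L2I:
  "f \<in> borel_measurable M \<Longrightarrow> integrable M (\<lambda>x. (norm (f x))\<^sup>2) \<Longrightarrow> f \<in> L2 M"
  by (auto simp: L2_def)

lemma L2norm_nonneg [simp]: "0 \<le> L2norm M f"
  by (simp add: L2norm_def)

lemma L2norm_sq: "(L2norm M f)\<^sup>2 = (\<integral>x. (norm (f x))\<^sup>2 \<partial>M)"
  by (simp add: L2norm_def)

lemma L2_dominated:
  assumes "f \<in> L2 M" "g \<in> borel_measurable M" "AE x in M. norm (g x) \<le> C * norm (f x)"
  shows "g \<in> L2 M"
proof (rule L2I[OF assms(2)])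
  have "integrable M (\<lambda>x. C\<^sup>2 * (norm (f x))\<^sup>2)"
    using L2D(2)[OF assms(1)] by simp
  then show "integrable M (\<lambda>x. (norm (g x))\<^sup>2)"
  proof (rule Bochner_Integration.integrable_bound)
    show "(\<lambda>x. (norm (g x))\<^sup>2) \<in> borel_measurable M" using assms(2) by measurable
    show "AE x in M. norm ((norm (g x))\<^sup>2) \<le> norm (C\<^sup>2 * (norm (f x))\<^sup>2)"
      using assms(3)
    proof eventually_elim
      case (elim x)
      then have "(norm (g x))\<^sup>2 \<le> (C * norm (f x))\<^sup>2" by (intro power_mono) auto
      then show ?case by (simp add: power_mult_distrib)
    qed
  qed
qed

lemma L2norm_le:
  assumes "f \<in> L2 M" "0 \<le> C" "AE x in M. norm (g x) \<le> C * norm (f x)"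
  shows "L2norm M g \<le> C * L2norm M f"
proof (cases "integrable M (\<lambda>x. (norm (g x))\<^sup>2)")
  case True
  have "(\<integral>x. (norm (g x))\<^sup>2 \<partial>M) \<le> (\<integral>x. C\<^sup>2 * (norm (f x))\<^sup>2 \<partial>M)"
  proof (rule integral_mono_AE)
    show "AE x in M. (norm (g x))\<^sup>2 \<le> C\<^sup>2 * (norm (f x))\<^sup>2"
      using assms(3)
    proof eventually_elim
      case (elim x)
      then have "(norm (g x))\<^sup>2 \<le> (C * norm (f x))\<^sup>2" by (intro power_mono) auto
      then show ?case by (simp add: power_mult_distrib)
    qed
  qed (use True L2D[OF assms(1)] in auto)
  also have "\<dots> = (C * L2norm M f)\<^sup>2" by (simp add: power_mult_distrib L2norm_sq)
  finally show ?thesis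
    using assms(2) by (metis L2norm_nonneg L2norm_sq mult_nonneg_nonneg power2_le_imp_le)
next
  case False
  \<comment> \<open>The Bochner integral of a non-integrable function is 0 by default, so the left
    side vanishes.\<close>
  then have "L2norm M g = 0" by (simp add: L2norm_def not_integrable_integral_eq)
  then show ?thesis using assms(2) by simp
qed

lemma L2_scaleC: "f \<in> L2 M \<Longrightarrow> (\<lambda>x. (c::complex) * f x) \<in> L2 M"
  by (rule L2_dominated[where C="norm c"]) (auto simp: norm_mult dest: L2D(1))

lemma L2_uminus: "f \<in> L2 M \<Longrightarrow> (\<lambda>x. - f x) \<in> L2 M"
  by (rule L2_dominated[where C=1]) (auto simp: L2D)

lemma L2_add:
  assumes "f \<in> L2 M" "g \<in> L2 M"
  shows "(\<lambda>x. f x + g x) \<in> L2 M"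
proof (rule L2I)
  show "(\<lambda>x. f x + g x) \<in> borel_measurable M" by (intro borel_measurable_add L2D(1) assms)
  have "integrable M (\<lambda>x. 2 * (norm (f x))\<^sup>2 + 2 * (norm (g x))\<^sup>2)"
    using assms by (auto simp: L2D)
  then show "integrable M (\<lambda>x. (norm (f x + g x))\<^sup>2)"
  proof (rule Bochner_Integration.integrable_bound)
    show "(\<lambda>x. (norm (f x + g x))\<^sup>2) \<in> borel_measurable M"
      using assms[THEN L2D(1)] by measurable
    have "(norm (f x + g x))\<^sup>2 \<le> 2 * (norm (f x))\<^sup>2 + 2 * (norm (g x))\<^sup>2" for x
    proof -
      have "(norm (f x + g x))\<^sup>2 \<le> (norm (f x) + norm (g x))\<^sup>2"
        by (intro power_mono norm_triangle_ineq) auto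
      also have "\<dots> \<le> 2 * (norm (f x))\<^sup>2 + 2 * (norm (g x))\<^sup>2"
        using sum_squares_bound[of "norm (f x)" "norm (g x)"] by (simp add: power2_sum)
      finally show ?thesis .
    qed
    then show "AE x in M. norm ((norm (f x + g x))\<^sup>2)
        \<le> norm (2 * (norm (f x))\<^sup>2 + 2 * (norm (g x))\<^sup>2)" by simp
  qed
qed

lemma L2_diff:
  assumes "f \<in> L2 M" "g \<in> L2 M"
  shows "(\<lambda>x. f x - g x) \<in> L2 M"
  using L2_add[OF assms(1) L2_uminus[OF assms(2)]] by simp

lemma L2_zero [simp]: "(\<lambda>x. 0) \<in> L2 M"
  by (simp add: L2_def)

lemma L2norm_uminus [simp]: "L2norm M (\<lambda>x. - f x) = L2norm M f"
  by (simp add: L2norm_def)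

lemma L2norm_minus_commute: "L2norm M (\<lambda>x. f x - g x) = L2norm M (\<lambda>x. g x - f x)"
  by (simp add: L2norm_def norm_minus_commute)

lemma L2norm_scaleC: "L2norm M (\<lambda>x. (c::complex) * f x) = norm c * L2norm M f"
  by (simp add: L2norm_def norm_mult power_mult_distrib real_sqrt_mult)

lemma nn_integral_L2:
  assumes "f \<in> L2 M"
  shows "(\<integral>\<^sup>+x. ennreal ((norm (f x))\<^sup>2) \<partial>M) = ennreal ((L2norm M f)\<^sup>2)"
  unfolding L2norm_sq using L2D[OF assms] by (intro nn_integral_eq_integral) auto

lemma L2_of_nn_integral:
  assumes "f \<in> borel_measurable M" "(\<integral>\<^sup>+x. ennreal ((norm (f x))\<^sup>2) \<partial>M) \<le> ennreal (C\<^sup>2)" "0 \<le> C"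
  shows "f \<in> L2 M" "L2norm M f \<le> C"
proof -
  have i: "integrable M (\<lambda>x. (norm (f x))\<^sup>2)"
  proof (rule integrableI_bounded)
    show "(\<integral>\<^sup>+x. ennreal (norm ((norm (f x))\<^sup>2)) \<partial>M) < \<infinity>"
      using assms(2) by (simp add: order.strict_trans1)
  qed (use assms in measurable)
  then show "f \<in> L2 M" using assms(1) by (auto simp: L2_def)
  from assms(2) have "(L2norm M f)\<^sup>2 \<le> C\<^sup>2"
    using nn_integral_L2[OF \<open>f \<in> L2 M\<close>] by simp
  then show "L2norm M f \<le> C" using assms(3) by (rule power2_le_imp_le)
qed

lemma
  assumes f: "f \<in> L2 M" and g: "g \<in> L2 M"
  shows L2_integrable_product: "integrable M (\<lambda>x. norm (f x) * norm (g x))"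
    and L2_Cauchy_Schwarz: "(\<integral>x. norm (f x) * norm (g x) \<partial>M) \<le> L2norm M f * L2norm M g"
proof -
  have le: "norm (f x) * norm (g x) \<le> ((norm (f x))\<^sup>2 + (norm (g x))\<^sup>2)/2" for x
    using sum_squares_bound[of "norm (f x)" "norm (g x)"] by simp
  have ii: "integrable M (\<lambda>x. ((norm (f x))\<^sup>2 + (norm (g x))\<^sup>2)/2)"
    using f g by (auto simp: L2D)
  show i: "integrable M (\<lambda>x. norm (f x) * norm (g x))"
    by (rule Bochner_Integration.integrable_bound[OF ii]) (use f[THEN L2D(1)] g[THEN L2D(1)] le in auto)
  \<comment> \<open>The square of \<open>norm (f x) - t * norm (g x)\<close> integrates to a
    nonnegative quadratic in \<open>t\<close>; its minimum yields the Cauchy-Schwarz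
    inequality.\<close>
  have q: "0 \<le> (L2norm M f)\<^sup>2 - 2 * t * (\<integral>x. norm (f x) * norm (g x) \<partial>M) + t\<^sup>2 * (L2norm M g)\<^sup>2" for t
  proof -
    have "0 \<le> (\<integral>x. (norm (f x) - t * norm (g x))\<^sup>2 \<partial>M)" by simp
    also have "(\<lambda>x. (norm (f x) - t * norm (g x))\<^sup>2) =
        (\<lambda>x. (norm (f x))\<^sup>2 - 2 * t * (norm (f x) * norm (g x)) + t\<^sup>2 * (norm (g x))\<^sup>2)"
      by (auto simp: power2_eq_square algebra_simps)
    also have "(\<integral>x. \<dots> x \<partial>M) = (L2norm M f)\<^sup>2 - 2 * t * (\<integral>x. norm (f x) * norm (g x) \<partial>M)
        + t\<^sup>2 * (L2norm M g)\<^sup>2"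
      using i f g by (simp add: L2norm_sq L2D)
    finally show ?thesis .
  qed
  let ?I = "\<integral>x. norm (f x) * norm (g x) \<partial>M"
  have "0 \<le> ?I" by simp
  show "?I \<le> L2norm M f * L2norm M g"
  proof (cases "L2norm M g = 0")
    case True
    have "?I = 0"
    proof (rule ccontr)
      \<comment> \<open>With \<open>L2norm M g = 0\<close> the quadratic is affine in
        \<open>t\<close>; a large \<open>t\<close> drives it below zero.\<close>
      assume "?I \<noteq> 0"
      with \<open>0 \<le> ?I\<close> q[of "((L2norm M f)\<^sup>2 + 1) / ?I"] True
      have "0 \<le> (L2norm M f)\<^sup>2 - 2 * ((L2norm M f)\<^sup>2 + 1)" by simp
      moreover have "N - 2 * (N + 1) < 0" if "0 \<le> N" for N :: real using that by simp
      ultimately show False by (meson not_less zero_le_power2)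
    qed
    then show ?thesis by simp
  next
    case False
    then have p: "0 < (L2norm M g)\<^sup>2" by simp
    have "(a::real) - 2 * (b / d) * b + (b / d)\<^sup>2 * d = a - b\<^sup>2 / d" if "0 < d" for a b d
      using that by (simp add: field_simps power2_eq_square)
    from q[of "?I / (L2norm M g)\<^sup>2", unfolded this[OF p]]
    have "?I\<^sup>2 \<le> (L2norm M f)\<^sup>2 * (L2norm M g)\<^sup>2"
      using p by (simp add: pos_divide_le_eq)
    then have "?I\<^sup>2 \<le> (L2norm M f * L2norm M g)\<^sup>2" by (simp add: power_mult_distrib)
    then show ?thesis by (rule power2_le_imp_le) simp
  qed
qed

lemma L2norm_triangle:
  assumes f: "f \<in> L2 M" and g: "g \<in> L2 M"
  shows "L2norm M (\<lambda>x. f x + g x) \<le> L2norm M f + L2norm M g"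
proof -
  have "(L2norm M (\<lambda>x. f x + g x))\<^sup>2 \<le>
      (\<integral>x. (norm (f x))\<^sup>2 + 2 * (norm (f x) * norm (g x)) + (norm (g x))\<^sup>2 \<partial>M)"
    unfolding L2norm_sq
  proof (rule integral_mono)
    show "integrable M (\<lambda>x. (norm (f x + g x))\<^sup>2)" using L2_add[OF f g] by (auto simp: L2D)
    show "integrable M (\<lambda>x. (norm (f x))\<^sup>2 + 2 * (norm (f x) * norm (g x)) + (norm (g x))\<^sup>2)"
      using f g L2_integrable_product[OF f g] by (auto simp: L2D)
    show "(norm (f x + g x))\<^sup>2 \<le> (norm (f x))\<^sup>2 + 2 * (norm (f x) * norm (g x)) + (norm (g x))\<^sup>2" for x
      using power_mono[OF norm_triangle_ineq[of "f x" "g x"], of 2]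
      by (simp add: power2_sum algebra_simps)
  qed
  also have "\<dots> = (L2norm M f)\<^sup>2 + 2 * (\<integral>x. norm (f x) * norm (g x) \<partial>M) + (L2norm M g)\<^sup>2"
    using f g L2_integrable_product[OF f g] by (simp add: L2norm_sq L2D)
  also have "\<dots> \<le> (L2norm M f + L2norm M g)\<^sup>2"
    using L2_Cauchy_Schwarz[OF f g] by (simp add: power2_sum)
  finally show ?thesis by (rule power2_le_imp_le) simp
qed

lemma L2norm_triangle_diff:
  assumes "f \<in> L2 M" "g \<in> L2 M"
  shows "L2norm M (\<lambda>x. f x - g x) \<le> L2norm M f + L2norm M g"
  using L2norm_triangle[OF assms(1) L2_uminus[OF assms(2)]] by simp

lemma L2norm_le_diff_add:
  assumes "f \<in> L2 M" "g \<in> L2 M"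
  shows "L2norm M f \<le> L2norm M (\<lambda>x. f x - g x) + L2norm M g"
  using L2norm_triangle[OF L2_diff[OF assms] assms(2)] by simp

lemma L2norm_cong_AE:
  assumes "f \<in> borel_measurable M" "g \<in> borel_measurable M" "AE x in M. f x = g x"
  shows "L2norm M f = L2norm M g"
  unfolding L2norm_def
  by (intro arg_cong[of _ _ sqrt] integral_cong_AE) (use assms in \<open>auto elim: eventually_mono\<close>)

lemma L2norm_eq_0_iff:
  assumes "f \<in> L2 M"
  shows "L2norm M f = 0 \<longleftrightarrow> (AE x in M. f x = 0)"
  using integral_nonneg_eq_0_iff_AE[OF L2D(2)[OF assms]] by (simp add: L2norm_def)

lemma L2inner_integrable:
  assumes "f \<in> L2 M" "g \<in> L2 M"
  shows "integrable M (\<lambda>x. f x * cnj (g x))"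
  by (rule Bochner_Integration.integrable_bound[OF L2_integrable_product[OF assms]])
     (auto simp: norm_mult intro!: borel_measurable_times borel_measurable_cnj assms[THEN L2D(1)])

lemma L2inner_bound:
  assumes "f \<in> L2 M" "g \<in> L2 M"
  shows "norm (L2inner M f g) \<le> L2norm M f * L2norm M g"
proof -
  have "norm (L2inner M f g) \<le> (\<integral>x. norm (f x * cnj (g x)) \<partial>M)"
    unfolding L2inner_def by (rule integral_norm_bound)
  also have "\<dots> = (\<integral>x. norm (f x) * norm (g x) \<partial>M)" by (simp add: norm_mult)
  also have "\<dots> \<le> L2norm M f * L2norm M g" by (rule L2_Cauchy_Schwarz[OF assms])
  finally show ?thesis .
qed

lemma L2inner_self: "L2inner M f f = of_real ((L2norm M f)\<^sup>2)"
proof -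
  have "(\<lambda>x. f x * cnj (f x)) = (\<lambda>x. complex_of_real ((norm (f x))\<^sup>2))"
    by (simp add: complex_norm_square del: of_real_power)
  then show ?thesis unfolding L2inner_def L2norm_sq by (simp only: integral_complex_of_real)
qed

lemma L2inner_commute: "L2inner M g f = cnj (L2inner M f g)"
  unfolding L2inner_def by (subst Bochner_Integration.integral_cnj[symmetric]) (simp add: mult.commute)

lemma L2inner_add_scale_left:
  assumes "f \<in> L2 M" "g \<in> L2 M" "h \<in> L2 M"
  shows "L2inner M (\<lambda>x. f x + c * g x) h = L2inner M f h + c * L2inner M g h"
  using L2inner_integrable[OF assms(1,3)] L2inner_integrable[OF assms(2,3)]
  by (simp add: L2inner_def ring_distribs mult.assoc)

lemma L2inner_cong_AE:
  assumes "f \<in> borel_measurable M" "f' \<in> borel_measurable M" "g \<in> borel_measurable M"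
    "g' \<in> borel_measurable M" "AE x in M. f x = f' x" "AE x in M. g x = g' x"
  shows "L2inner M f g = L2inner M f' g'"
  unfolding L2inner_def using assms(5,6) by (intro integral_cong_AE) (use assms in auto)

text \<open>With \<open>a\<^sub>n = \<bar>f\<^bsub>r (n+1)\<^esub> - f\<^bsub>r n\<^esub>\<bar>\<close> and \<open>\<parallel>a\<^sub>n\<parallel> \<le> 2\<^bsup>-n\<^esup>\<close>, almost everywhere finiteness of \<open>\<Sum> 2\<^sup>n a\<^sub>n\<^sup>2\<close>
  and \<open>a\<^sub>n \<le> 2\<^bsup>-n\<^esup> + 2\<^sup>n a\<^sub>n\<^sup>2\<close> yield pointwise convergence; Fatou's lemma upgrades it to
  convergence in norm.\<close>

lemma L2_complete:
  fixes f :: "nat \<Rightarrow> 'a \<Rightarrow> 'b::{banach,second_countable_topology}"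
  assumes f: "\<And>n. f n \<in> L2 M"
    and cauchy: "\<And>e. 0 < e \<Longrightarrow> \<exists>N. \<forall>m\<ge>N. \<forall>n\<ge>N. L2norm M (\<lambda>x. f m x - f n x) < e"
  obtains g where "g \<in> L2 M" "(\<lambda>n. L2norm M (\<lambda>x. f n x - g x)) \<longlonglongrightarrow> 0"
proof -
  have fm [measurable]: "f n \<in> borel_measurable M" for n using f by (rule L2D)
  \<comment> \<open>Strict growth of \<open>r\<close> puts \<open>r (Suc k)\<close> into the tail
    that starts at \<open>r k\<close>, so consecutive differences obey the geometric bound.\<close>
  have "\<exists>r. \<forall>k. (\<forall>m\<ge>r k. \<forall>n\<ge>r k. L2norm M (\<lambda>x. f m x - f n x) < (1/2)^k) \<and> r k < r (Suc k)"
  proof (intro dependent_nat_choice allI)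
    show "\<exists>x. \<forall>m\<ge>x. \<forall>n\<ge>x. L2norm M (\<lambda>xa. f m xa - f n xa) < (1/2)^0"
      using cauchy[of 1] by simp
    fix x k
    obtain N where N: "\<forall>m\<ge>N. \<forall>n\<ge>N. L2norm M (\<lambda>x. f m x - f n x) < (1/2)^Suc k"
      using cauchy[of "(1/2)^Suc k"] by auto
    then show "\<exists>y. (\<forall>m\<ge>y. \<forall>n\<ge>y. L2norm M (\<lambda>x. f m x - f n x) < (1/2)^Suc k) \<and> x < y"
      by (intro exI[of _ "max N (Suc x)"]) auto
  qed
  then obtain r where r: "\<And>k m n. m \<ge> r k \<Longrightarrow> n \<ge> r k \<Longrightarrow> L2norm M (\<lambda>x. f m x - f n x) < (1/2)^k"
    and r_mono: "\<And>k. r k < r (Suc k)" by metis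
  have sm: "strict_mono r" using r_mono by (simp add: strict_mono_Suc_iff)
  define a where "a k x = norm (f (r (Suc k)) x - f (r k) x)" for k x
  have [measurable]: "a k \<in> borel_measurable M" for k unfolding a_def by measurable
  have a2: "(\<integral>\<^sup>+x. ennreal ((a k x)\<^sup>2) \<partial>M) \<le> ennreal ((1/4)^k)" for k
  proof -
    have "(\<integral>\<^sup>+x. ennreal ((a k x)\<^sup>2) \<partial>M) = ennreal ((L2norm M (\<lambda>x. f (r (Suc k)) x - f (r k) x))\<^sup>2)"
      unfolding a_def by (rule nn_integral_L2[OF L2_diff[OF f f]])
    also have "\<dots> \<le> ennreal (((1/2)^k)\<^sup>2)"
      using r[of k "r (Suc k)" "r k"] r_mono[of k]
      by (intro ennreal_leI power_mono) (auto intro: less_imp_le)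
    also have "((1/2::real)^k)\<^sup>2 = (1/4)^k"
      by (simp add: power_even_eq[symmetric] power_mult mult.commute[of k] power2_eq_square power_mult_distrib[symmetric])
    finally show ?thesis .
  qed
  have "(\<integral>\<^sup>+x. (\<Sum>k. ennreal (2^k * (a k x)\<^sup>2)) \<partial>M) = (\<Sum>k. \<integral>\<^sup>+x. ennreal (2^k * (a k x)\<^sup>2) \<partial>M)"
    by (rule nn_integral_suminf) measurable
  also have "\<dots> \<le> (\<Sum>k. ennreal ((1/2)^k))"
  proof (rule suminf_le)
    fix k
    have "(\<integral>\<^sup>+x. ennreal (2^k * (a k x)\<^sup>2) \<partial>M) = ennreal (2^k) * (\<integral>\<^sup>+x. ennreal ((a k x)\<^sup>2) \<partial>M)"
      by (subst nn_integral_cmult[symmetric]) (auto simp: ennreal_mult)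
    also have "\<dots> \<le> ennreal (2^k) * ennreal ((1/4)^k)" by (intro mult_left_mono a2) auto
    also have "\<dots> = ennreal ((1/2)^k)"
      by (simp add: ennreal_mult[symmetric] power_mult_distrib[symmetric])
    finally show "(\<integral>\<^sup>+x. ennreal (2^k * (a k x)\<^sup>2) \<partial>M) \<le> ennreal ((1/2)^k)" .
  qed auto
  also have "\<dots> = ennreal (\<Sum>k. (1/2)^k)" by (intro suminf_ennreal2) auto
  finally have fin: "(\<integral>\<^sup>+x. (\<Sum>k. ennreal (2^k * (a k x)\<^sup>2)) \<partial>M) < \<infinity>"
    by (simp add: order.strict_trans1)
  have "AE x in M. (\<Sum>k. ennreal (2^k * (a k x)\<^sup>2)) \<noteq> \<infinity>"
    by (rule nn_integral_PInf_AE) (use fin in auto)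
  then have conv: "AE x in M. convergent (\<lambda>k. f (r k) x)"
  proof eventually_elim
    case (elim x)
    then have "summable (\<lambda>k. 2^k * (a k x)\<^sup>2)"
      by (intro summable_suminf_not_top) (auto simp: infinity_ennreal_def)
    then have s: "summable (\<lambda>k. (1/2)^k + 2^k * (a k x)\<^sup>2)"
      by (intro summable_add summable_geometric) auto
    have "a k x \<le> (1/2)^k + 2^k * (a k x)\<^sup>2" for k
    proof -
      have "0 \<le> (a k x - (1/2)^k)\<^sup>2 + (a k x)\<^sup>2 + ((1/2)^k)\<^sup>2" by simp
      then have "2 * (a k x * (1/2)^k) \<le> 2 * ((a k x)\<^sup>2 + ((1/2)^k)\<^sup>2)"
        by (simp add: power2_diff)
      then have "2^k * (a k x * (1/2)^k) \<le> 2^k * ((a k x)\<^sup>2 + ((1/2)^k)\<^sup>2)"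
        by (intro mult_left_mono) auto
      moreover
      have e: "(2::real)^k * (1/2)^k = 1" by (simp add: power_mult_distrib[symmetric])
      have "2^k * (a k x * (1/2)^k) = a k x * (2^k * (1/2)^k)"
        "2^k * ((a k x)\<^sup>2 + ((1/2)^k)\<^sup>2) = 2^k * (a k x)\<^sup>2 + (2^k * (1/2)^k) * (1/2)^k"
        by (simp_all only: power2_eq_square ring_distribs ac_simps)
      ultimately show ?thesis unfolding e by simp
    qed
    moreover have "0 \<le> a k x" for k by (simp add: a_def)
    ultimately have "summable (\<lambda>k. norm (f (r (Suc k)) x - f (r k) x))"
      unfolding a_def[symmetric] by (intro summable_comparison_test'[OF s, of 0]) auto
    then have "summable (\<lambda>k. f (r (Suc k)) x - f (r k) x)" by (rule summable_norm_cancel)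
    then show ?case
      using sum_lessThan_telescope[of "\<lambda>k. f (r k) x"]
      by (simp add: summable_iff_convergent convergent_diff_const_right_iff)
  qed
  define g where "g x = lim (\<lambda>k. f (r k) x)" for x
  have [measurable]: "g \<in> borel_measurable M" unfolding g_def by measurable
  have lim: "AE x in M. (\<lambda>k. f (r k) x) \<longlonglongrightarrow> g x"
    using conv by eventually_elim (simp add: g_def convergent_LIMSEQ_iff)
  \<comment> \<open>The bound covers every \<open>n\<close> in the tail, not only the subsequence:
    in \<open>f n - f (r k)\<close> only \<open>k\<close> tends to infinity.\<close>
  have key: "(\<integral>\<^sup>+x. ennreal ((norm (f n x - g x))\<^sup>2) \<partial>M) \<le> ennreal (((1/2)^j)\<^sup>2)" if "n \<ge> r j" for n j
  proof -
    have "(\<integral>\<^sup>+x. ennreal ((norm (f n x - g x))\<^sup>2) \<partial>M) =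
        (\<integral>\<^sup>+x. liminf (\<lambda>k. ennreal ((norm (f n x - f (r k) x))\<^sup>2)) \<partial>M)"
    proof (rule nn_integral_cong_AE)
      show "AE x in M. ennreal ((norm (f n x - g x))\<^sup>2) = liminf (\<lambda>k. ennreal ((norm (f n x - f (r k) x))\<^sup>2))"
        using lim
      proof eventually_elim
        case (elim x)
        then have "(\<lambda>k. ennreal ((norm (f n x - f (r k) x))\<^sup>2)) \<longlonglongrightarrow> ennreal ((norm (f n x - g x))\<^sup>2)"
          by (intro tendsto_intros)
        then show ?case using lim_imp_Liminf[of sequentially] by force
      qed
    qed
    also have "\<dots> \<le> liminf (\<lambda>k. \<integral>\<^sup>+x. ennreal ((norm (f n x - f (r k) x))\<^sup>2) \<partial>M)"
      by (rule nn_integral_liminf) measurable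
    also have "\<dots> \<le> ennreal (((1/2)^j)\<^sup>2)"
    proof (rule Liminf_le, simp)
      show "\<forall>\<^sub>F k in sequentially. (\<integral>\<^sup>+x. ennreal ((norm (f n x - f (r k) x))\<^sup>2) \<partial>M) \<le> ennreal (((1/2)^j)\<^sup>2)"
        using eventually_ge_at_top[of j]
      proof eventually_elim
        case (elim k)
        then have "L2norm M (\<lambda>x. f n x - f (r k) x) < (1/2)^j"
          using that sm by (intro r) (auto simp: strict_mono_less_eq)
        then show ?case
          unfolding nn_integral_L2[OF L2_diff[OF f f]] by (intro ennreal_leI power_mono) auto
      qed
    qed
    finally show ?thesis .
  qed
  have d: "(\<lambda>x. f n x - g x) \<in> L2 M" "L2norm M (\<lambda>x. f n x - g x) \<le> (1/2)^j" if "n \<ge> r j" for n j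
    using L2_of_nn_integral[OF _ key[OF that]] by auto
  have "(\<lambda>x. f (r 0) x - (f (r 0) x - g x)) \<in> L2 M" by (rule L2_diff[OF f d(1)[of 0]]) simp
  then have "g \<in> L2 M" by simp
  moreover have "(\<lambda>n. L2norm M (\<lambda>x. f n x - g x)) \<longlonglongrightarrow> 0"
  proof (rule LIMSEQ_I)
    fix e :: real assume "0 < e"
    obtain j where j: "(1/2)^j < e" using real_arch_pow_inv[OF \<open>0 < e\<close>, of "1/2"] by auto
    show "\<exists>no. \<forall>n\<ge>no. norm (L2norm M (\<lambda>x. f n x - g x) - 0) < e"
      using d(2) j by (intro exI[of _ "r j"]) (auto intro: le_less_trans)
  qed
  ultimately show ?thesis by (rule that)
qed

subsection \<open>The Lax-Milgram lemma\<close>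

text \<open>A vector space of functions with a positive semidefinite inner product: \<open>lc c u v\<close>
  stands for \<open>u + c v\<close>, so that no vector space type and no quotient by null vectors is needed.\<close>

locale semi_hilbert =
  fixes V :: "'v set" and lc :: "real \<Rightarrow> 'v \<Rightarrow> 'v \<Rightarrow> 'v" and ip :: "'v \<Rightarrow> 'v \<Rightarrow> real"
  assumes nonempty: "V \<noteq> {}"
    and closed: "u \<in> V \<Longrightarrow> v \<in> V \<Longrightarrow> lc t u v \<in> V"
    and sym: "u \<in> V \<Longrightarrow> v \<in> V \<Longrightarrow> ip u v = ip v u"
    and ip_left: "u \<in> V \<Longrightarrow> v \<in> V \<Longrightarrow> x \<in> V \<Longrightarrow> ip (lc t u v) x = ip u x + t * ip v x"
    and nonneg: "u \<in> V \<Longrightarrow> 0 \<le> ip u u"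
    and complete: "(\<And>n. X n \<in> V) \<Longrightarrow>
       (\<And>\<epsilon>. 0 < \<epsilon> \<Longrightarrow> \<exists>N. \<forall>m\<ge>N. \<forall>n\<ge>N. ip (lc (-1) (X m) (X n)) (lc (-1) (X m) (X n)) < \<epsilon>) \<Longrightarrow>
       \<exists>x\<in>V. (\<lambda>n. ip (lc (-1) (X n) x) (lc (-1) (X n) x)) \<longlonglongrightarrow> 0"
begin

lemma ip_right: "u \<in> V \<Longrightarrow> v \<in> V \<Longrightarrow> x \<in> V \<Longrightarrow> ip x (lc t u v) = ip x u + t * ip x v"
  using ip_left sym closed by metis

lemma ip_lc_self:
  "u \<in> V \<Longrightarrow> v \<in> V \<Longrightarrow> ip (lc t u v) (lc t u v) = ip u u + 2 * t * ip u v + t\<^sup>2 * ip v v"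
  using ip_left[of u v "lc t u v" t] ip_right[of u v u t] ip_right[of u v v t] closed[of u v t] sym[of u v]
  by (simp add: power2_eq_square algebra_simps)

text \<open>Discriminant of the quadratic \<open>ip (u + t v) (u + t v)\<close> in \<open>t\<close>.
  Null vectors may be present, so \<open>ip v v = 0\<close> is a separate case: an affine function
  bounded below has slope zero.\<close>

lemma ip_bound:
  assumes u: "u \<in> V" and v: "v \<in> V"
  shows "\<bar>ip u v\<bar> \<le> sqrt (ip u u) * sqrt (ip v v)"
proof -
  have q: "0 \<le> ip u u + 2 * t * ip u v + t\<^sup>2 * ip v v" for t
    using nonneg[OF closed[OF u v, of t]] ip_lc_self[OF u v] by simp
  have "(ip u v)\<^sup>2 \<le> ip u u * ip v v"
  proof (cases "ip v v = 0")
    case True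
    have "ip u v = 0"
    proof (rule ccontr)
      assume "ip u v \<noteq> 0"
      then have "2 * (- (ip u u + 1) / (2 * ip u v)) * ip u v = - (ip u u + 1)" by simp
      then show False using q[of "- (ip u u + 1) / (2 * ip u v)"] True by simp
    qed
    then show ?thesis using True by simp
  next
    case False
    then have p: "0 < ip v v" using nonneg[OF v] by simp
    have "(a::real) + 2 * (- b / d) * b + (- b / d)\<^sup>2 * d = a - b\<^sup>2 / d" if "0 < d" for a b d
      using that by (simp add: field_simps power2_eq_square)
    from q[of "- ip u v / ip v v", unfolded this[OF p]] show ?thesis
      using p by (simp add: pos_divide_le_eq)
  qed
  then have "sqrt ((ip u v)\<^sup>2) \<le> sqrt (ip u u * ip v v)" by (rule real_sqrt_le_mono)
  then show ?thesis by (simp add: real_sqrt_mult)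
qed

text \<open>The representing vector minimizes the energy \<open>J v = ip v v - 2 F v\<close>; minimizing sequences
  are Cauchy by the parallelogram law.\<close>

lemma Riesz:
  assumes F_lin: "\<And>u v t. u \<in> V \<Longrightarrow> v \<in> V \<Longrightarrow> F (lc t u v) = F u + t * F v"
    and F_bdd: "\<And>u. u \<in> V \<Longrightarrow> \<bar>F u\<bar> \<le> C * sqrt (ip u u)"
  obtains r where "r \<in> V" "\<And>v. v \<in> V \<Longrightarrow> F v = ip v r"
proof -
  define J where "J v = ip v v - 2 * F v" for v
  have lower: "- C\<^sup>2 \<le> J v" if "v \<in> V" for v
  proof -
    have "2 * F v \<le> 2 * (C * sqrt (ip v v))" using F_bdd[OF that] by linarith
    also have "\<dots> \<le> C\<^sup>2 + (sqrt (ip v v))\<^sup>2"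
      using sum_squares_bound[of C "sqrt (ip v v)"] by simp
    finally show ?thesis using nonneg[OF that] by (simp add: J_def)
  qed
  define m where "m = Inf (J ` V)"
  have bdd: "bdd_below (J ` V)" using lower by (auto intro!: bdd_belowI)
  have m_le: "m \<le> J v" if "v \<in> V" for v
    unfolding m_def using that bdd by (auto intro: cInf_lower)
  have "\<exists>v\<in>V. J v < m + 1 / Suc n" for n
    using cInf_lessD[of "J ` V" "m + 1 / Suc n"] nonempty by (auto simp: m_def)
  then obtain X where X: "\<And>n. X n \<in> V" "\<And>n. J (X n) < m + 1 / Suc n" by metis
  have par: "ip (lc (-1) u v) (lc (-1) u v) \<le> 2 * (J u - m) + 2 * (J v - m)" if u: "u \<in> V" and v: "v \<in> V" for u v
  proof -
    have w: "lc (-1) v u \<in> V" using u v closed by simp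
    \<comment> \<open>The midpoint of \<open>u\<close> and \<open>v\<close>, written as
      \<open>u + (v - u) / 2\<close>; its energy is at least \<open>m\<close>.\<close>
    let ?z = "lc (1/2) u (lc (-1) v u)"
    have "J ?z = ip u u + ip u (lc (-1) v u) + ip (lc (-1) v u) (lc (-1) v u) / 4 - 2 * F u - F (lc (-1) v u)"
      using ip_lc_self[OF u w, of "1/2"] F_lin[OF u w, of "1/2"] by (simp add: J_def power2_eq_square)
    also have "\<dots> = (J u + J v) / 2 - ip (lc (-1) u v) (lc (-1) u v) / 4"
      using ip_lc_self[OF v u, of "-1"] ip_lc_self[OF u v, of "-1"] F_lin[OF v u, of "-1"]
        ip_right[OF v u u, of "-1"] sym[OF u v]
      by (simp add: J_def field_simps)
    finally have "m \<le> (J u + J v) / 2 - ip (lc (-1) u v) (lc (-1) u v) / 4"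
      using m_le[OF closed[OF u w], of "1/2"] by simp
    then show ?thesis by (simp add: field_simps)
  qed
  have "\<exists>x\<in>V. (\<lambda>n. ip (lc (-1) (X n) x) (lc (-1) (X n) x)) \<longlonglongrightarrow> 0"
  proof (rule complete[OF X(1)])
    fix \<epsilon> :: real assume "0 < \<epsilon>"
    then obtain N where N: "1 / Suc N < \<epsilon> / 4" using nat_approx_posE[of "\<epsilon> / 4"] by auto
    show "\<exists>N. \<forall>m\<ge>N. \<forall>n\<ge>N. ip (lc (-1) (X m) (X n)) (lc (-1) (X m) (X n)) < \<epsilon>"
    proof (intro exI[of _ N] allI impI)
      fix i j assume ij: "N \<le> i" "N \<le> j"
      have J: "J (X i) - m < \<epsilon> / 4" if "N \<le> i" for i
      proof -
        have "1 / real (Suc i) \<le> 1 / Suc N" using that by (intro divide_left_mono) auto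
        then show ?thesis using X(2)[of i] N by linarith
      qed
      show "ip (lc (-1) (X i) (X j)) (lc (-1) (X i) (X j)) < \<epsilon>"
        using par[OF X(1) X(1), of i j] J[OF ij(1)] J[OF ij(2)]
        by (simp add: right_diff_distrib)
    qed
  qed
  then obtain r where r: "r \<in> V" and lim: "(\<lambda>n. ip (lc (-1) (X n) r) (lc (-1) (X n) r)) \<longlonglongrightarrow> 0" by auto
  have vd: "F v = ip v r" if v: "v \<in> V" for v
  proof -
    \<comment> \<open>Minimality is tested at \<open>X n + t v\<close>, and \<open>n\<close> tends
      to infinity: the energy has a nonnegative increment at \<open>r\<close> in every
      direction.\<close>
    have ineq: "0 \<le> 2 * t * (ip v r - F v) + t\<^sup>2 * ip v v" for t
    proof -
      have le: "- (1 / Suc n) \<le> 2 * t * (ip v (X n) - F v) + t\<^sup>2 * ip v v" for n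
        using m_le[OF closed[OF X(1) v], of t n] X(2)[of n] ip_lc_self[OF X(1) v, of t n]
          F_lin[OF X(1) v, of t n] sym[OF v X(1), of n]
        by (simp add: J_def algebra_simps)
      have "(\<lambda>n. ip v (X n) - ip v r) \<longlonglongrightarrow> 0"
      proof (rule Lim_null_comparison)
        show "\<forall>\<^sub>F n in sequentially. norm (ip v (X n) - ip v r)
            \<le> sqrt (ip v v) * sqrt (ip (lc (-1) (X n) r) (lc (-1) (X n) r))"
          using ip_bound[OF v closed[OF X(1) r]] ip_right[OF X(1) r v, of "-1", symmetric]
          by (intro always_eventually allI) simp
        show "(\<lambda>n. sqrt (ip v v) * sqrt (ip (lc (-1) (X n) r) (lc (-1) (X n) r))) \<longlonglongrightarrow> 0"
          using tendsto_mult[OF tendsto_const tendsto_real_sqrt[OF lim]] by simp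
      qed
      then have "(\<lambda>n. ip v (X n)) \<longlonglongrightarrow> ip v r" by (simp add: LIM_zero_iff)
      then have "(\<lambda>n. 2 * t * (ip v (X n) - F v) + t\<^sup>2 * ip v v) \<longlonglongrightarrow> 2 * t * (ip v r - F v) + t\<^sup>2 * ip v v"
        by (intro tendsto_intros)
      moreover have "(\<lambda>n. - (1 / Suc n)) \<longlonglongrightarrow> - 0"
        by (intro tendsto_minus) (use LIMSEQ_inverse_real_of_nat in \<open>simp add: inverse_eq_divide\<close>)
      ultimately show ?thesis
        using LIMSEQ_le[of "\<lambda>n. - (1 / Suc n)" "-0"] le by force
    qed
    \<comment> \<open>The choice \<open>t = - D / (N + 1)\<close> works also for
      \<open>N = 0\<close>.\<close>
    have "D = 0" if "\<And>t. 0 \<le> 2 * t * D + t\<^sup>2 * (N::real)" "0 \<le> N" for D N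
    proof -
      define M where "M = N + 1"
      have M: "0 < M" "N = M - 1" using that(2) by (auto simp: M_def)
      have "0 \<le> 2 * (- D / M) * D + (- D / M)\<^sup>2 * N" by (rule that)
      also have "\<dots> = - (D\<^sup>2 / M) - (D / M)\<^sup>2"
        unfolding M(2) using M(1) by (simp add: field_simps power2_eq_square)
      finally have "D\<^sup>2 / M + (D / M)\<^sup>2 \<le> 0" by simp
      moreover have "0 \<le> D\<^sup>2 / M" "0 \<le> (D / M)\<^sup>2" using M(1) by simp_all
      ultimately have "(D / M)\<^sup>2 = 0" by linarith
      then show ?thesis using M(1) by simp
    qed
    from this[OF ineq nonneg[OF v]] show ?thesis by simp
  qed
  from r vd show ?thesis by (rule that)
qed

text \<open>With \<open>A p\<close> representing \<open>b _ p\<close> and \<open>f\<close> representing \<open>F\<close>, apply the Riesz representation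
  a second time, in the equivalent inner product \<open>ip (A u) (A v)\<close>, to \<open>u \<mapsto> ip (A u) f\<close>: it gives
  \<open>p\<close> with \<open>f - A p\<close> orthogonal to the range of \<open>A\<close>, hence null by coercivity.\<close>

lemma Lax_Milgram:
  assumes b_left: "\<And>u v x t. u \<in> V \<Longrightarrow> v \<in> V \<Longrightarrow> x \<in> V \<Longrightarrow> b (lc t u v) x = b u x + t * b v x"
    and b_right: "\<And>u v x t. u \<in> V \<Longrightarrow> v \<in> V \<Longrightarrow> x \<in> V \<Longrightarrow> b x (lc t u v) = b x u + t * b x v"
    and b_bdd: "\<And>u v. u \<in> V \<Longrightarrow> v \<in> V \<Longrightarrow> \<bar>b u v\<bar> \<le> K * sqrt (ip u u) * sqrt (ip v v)"
    and b_coercive: "\<And>u. u \<in> V \<Longrightarrow> \<kappa> * ip u u \<le> b u u" and \<kappa>: "0 < \<kappa>"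
    and F_lin: "\<And>u v t. u \<in> V \<Longrightarrow> v \<in> V \<Longrightarrow> F (lc t u v) = F u + t * F v"
    and F_bdd: "\<And>u. u \<in> V \<Longrightarrow> \<bar>F u\<bar> \<le> C * sqrt (ip u u)"
  obtains p where "p \<in> V" "\<And>v. v \<in> V \<Longrightarrow> b v p = F v"
proof -
  have "\<exists>r\<in>V. \<forall>v\<in>V. b v p = ip v r" if p: "p \<in> V" for p
  proof -
    obtain r where "r \<in> V" "\<And>v. v \<in> V \<Longrightarrow> b v p = ip v r"
    proof (rule Riesz[of "\<lambda>v. b v p" "K * sqrt (ip p p)"], goal_cases)
      case (1 u v t)
      then show "b (lc t u v) p = b u p + t * b v p" 
        using b_left p by simp
    next
      case (2 u)
      then show "\<bar>b u p\<bar> \<le> K * sqrt (ip p p) * sqrt (ip u u)"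
        using b_bdd[of u p] p by (simp add: ac_simps)
    next
      case (3 r)
      then show thesis by blast
    qed
    then show ?thesis by blast
  qed
  then obtain A where A: "\<And>p. p \<in> V \<Longrightarrow> A p \<in> V" "\<And>p v. p \<in> V \<Longrightarrow> v \<in> V \<Longrightarrow> b v p = ip v (A p)"
    by metis
  obtain f where f: "f \<in> V" "\<And>v. v \<in> V \<Longrightarrow> F v = ip v f" by (rule Riesz[OF F_lin F_bdd]) blast+
  define ip' where "ip' u v = ip (A u) (A v)" for u v
  have ip_A: "ip x (A (lc t u v)) = ip x (A u) + t * ip x (A v)" if "u \<in> V" "v \<in> V" "x \<in> V" for x t u v
    using A that b_right closed by metis
  \<comment> \<open>Together with \<open>upper\<close> this makes \<open>ip\<close> and
    \<open>ip'\<close> equivalent, which transfers completeness to \<open>ip'\<close>.\<close>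
  have lower: "\<kappa> * sqrt (ip u u) \<le> sqrt (ip' u u)" if "u \<in> V" for u
  proof -
    have "\<kappa> * sqrt (ip u u) * sqrt (ip u u) = \<kappa> * ip u u" using nonneg[OF that] by simp
    also have "\<dots> \<le> \<bar>ip u (A u)\<bar>" using b_coercive[OF that] A(2)[OF that that] by simp
    also have "\<dots> \<le> sqrt (ip' u u) * sqrt (ip u u)"
      using ip_bound[OF that A(1)[OF that]] by (simp add: ip'_def mult.commute)
    finally have *: "\<kappa> * sqrt (ip u u) * sqrt (ip u u) \<le> sqrt (ip' u u) * sqrt (ip u u)" .
    then show ?thesis
    proof (cases "ip u u = 0")
      case True
      then show ?thesis using nonneg[OF A(1)[OF that]] by (simp add: ip'_def)
    next
      case False
      with nonneg[OF that] have "0 < sqrt (ip u u)" by simp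
      with * show ?thesis by (rule mult_right_le_imp_le)
    qed
  qed
  have upper: "sqrt (ip' u u) \<le> K * sqrt (ip u u)" if "u \<in> V" for u
  proof (cases "ip' u u = 0")
    case True
    \<comment> \<open>The sign of \<open>K\<close> is not given; comparing coercivity with the upper
      bound shows that \<open>K * sqrt (ip u u)\<close> is nonnegative.\<close>
    have "0 \<le> \<kappa> * ip u u" using nonneg[OF that] \<kappa> by simp
    then have "0 \<le> (K * sqrt (ip u u)) * sqrt (ip u u)"
      using b_coercive[OF that] b_bdd[OF that that] by linarith
    then show ?thesis using True nonneg[OF that]
      by (cases "ip u u = 0") (auto simp: zero_le_mult_iff)
  next
    case False
    have *: "sqrt (ip' u u) * sqrt (ip' u u) \<le> (K * sqrt (ip u u)) * sqrt (ip' u u)"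
      using b_bdd[OF A(1)[OF that] that] A(2)[OF that A(1)[OF that]] nonneg[OF A(1)[OF that]]
      by (simp add: ip'_def mult.assoc mult.commute mult.left_commute)
    have "0 < sqrt (ip' u u)" using False nonneg[OF A(1)[OF that]] by (simp add: ip'_def)
    with * show ?thesis by (rule mult_right_le_imp_le)
  qed
  interpret S': semi_hilbert V lc ip'
  proof
    show "V \<noteq> {}" "\<And>u v t. u \<in> V \<Longrightarrow> v \<in> V \<Longrightarrow> lc t u v \<in> V" using nonempty closed by auto
    show "\<And>u v. u \<in> V \<Longrightarrow> v \<in> V \<Longrightarrow> ip' u v = ip' v u" unfolding ip'_def using sym A by auto
    show "\<And>u v x t. u \<in> V \<Longrightarrow> v \<in> V \<Longrightarrow> x \<in> V \<Longrightarrow> ip' (lc t u v) x = ip' u x + t * ip' v x"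
      unfolding ip'_def using A sym closed ip_A by metis
    show "\<And>u. u \<in> V \<Longrightarrow> 0 \<le> ip' u u" unfolding ip'_def using A nonneg by auto
    fix X :: "nat \<Rightarrow> 'v" assume X: "\<And>n. X n \<in> V"
      and cau: "\<And>\<epsilon>. 0 < \<epsilon> \<Longrightarrow> \<exists>N. \<forall>m\<ge>N. \<forall>n\<ge>N. ip' (lc (-1) (X m) (X n)) (lc (-1) (X m) (X n)) < \<epsilon>"
    have "\<exists>x\<in>V. (\<lambda>n. ip (lc (-1) (X n) x) (lc (-1) (X n) x)) \<longlonglongrightarrow> 0"
    proof (rule complete[OF X])
      fix \<epsilon> :: real assume "0 < \<epsilon>"
      then obtain N where N: "\<forall>m\<ge>N. \<forall>n\<ge>N. ip' (lc (-1) (X m) (X n)) (lc (-1) (X m) (X n)) < \<kappa>\<^sup>2 * \<epsilon>"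
        using cau[of "\<kappa>\<^sup>2 * \<epsilon>"] \<kappa> by auto
      have "ip u u < \<epsilon>" if u: "u \<in> V" and "ip' u u < \<kappa>\<^sup>2 * \<epsilon>" for u
      proof -
        have "(\<kappa> * sqrt (ip u u))\<^sup>2 \<le> (sqrt (ip' u u))\<^sup>2"
          using lower[OF u] \<kappa> nonneg[OF u] by (intro power_mono) auto
        then have "\<kappa>\<^sup>2 * ip u u \<le> ip' u u"
          using nonneg[OF u] nonneg[OF A(1)[OF u]] by (simp add: power_mult_distrib ip'_def)
        with that(2) have "\<kappa>\<^sup>2 * ip u u < \<kappa>\<^sup>2 * \<epsilon>" by simp
        then show ?thesis using \<kappa> by simp
      qed
      then show "\<exists>N. \<forall>m\<ge>N. \<forall>n\<ge>N. ip (lc (-1) (X m) (X n)) (lc (-1) (X m) (X n)) < \<epsilon>"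
        using N closed X by blast
    qed
    then obtain x where x: "x \<in> V" and lim: "(\<lambda>n. ip (lc (-1) (X n) x) (lc (-1) (X n) x)) \<longlonglongrightarrow> 0" by auto
    have "(\<lambda>n. ip' (lc (-1) (X n) x) (lc (-1) (X n) x)) \<longlonglongrightarrow> 0"
    proof (rule Lim_null_comparison)
      show "(\<lambda>n. K\<^sup>2 * ip (lc (-1) (X n) x) (lc (-1) (X n) x)) \<longlonglongrightarrow> 0"
        using tendsto_mult_right_zero[OF lim] by simp
      show "\<forall>\<^sub>F n in sequentially. norm (ip' (lc (-1) (X n) x) (lc (-1) (X n) x))
          \<le> K\<^sup>2 * ip (lc (-1) (X n) x) (lc (-1) (X n) x)"
      proof (intro always_eventually allI)
        fix n
        have u: "lc (-1) (X n) x \<in> V" (is "?u \<in> V") using X x closed by simp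
        have "(sqrt (ip' ?u ?u))\<^sup>2 \<le> (K * sqrt (ip ?u ?u))\<^sup>2"
          using upper[OF u] nonneg[OF A(1)[OF u]] by (intro power_mono) (auto simp: ip'_def)
        then show "norm (ip' ?u ?u) \<le> K\<^sup>2 * ip ?u ?u"
          using nonneg[OF u] nonneg[OF A(1)[OF u]] by (simp add: power_mult_distrib ip'_def)
      qed
    qed
    then show "\<exists>x\<in>V. (\<lambda>n. ip' (lc (-1) (X n) x) (lc (-1) (X n) x)) \<longlonglongrightarrow> 0" using x by blast
  qed
  obtain p where p: "p \<in> V" "\<And>v. v \<in> V \<Longrightarrow> ip (A v) f = ip' v p"
  proof (rule S'.Riesz[of "\<lambda>u. ip (A u) f" "sqrt (ip f f)"])
    show "ip (A (lc t u v)) f = ip (A u) f + t * ip (A v) f" if "u \<in> V" "v \<in> V" for u v t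
      using ip_A[OF that f(1)] sym[OF f(1) A(1)] that closed by simp
    show "\<bar>ip (A u) f\<bar> \<le> sqrt (ip f f) * sqrt (ip' u u)" if "u \<in> V" for u
      using ip_bound[OF A(1)[OF that] f(1)] by (simp add: ip'_def mult.commute)
  qed blast
  define r where "r = lc (-1) f (A p)"
  have r: "r \<in> V" unfolding r_def using f p A closed by simp
  have "ip (A u) r = 0" if "u \<in> V" for u
    unfolding r_def using ip_right[OF f(1) A(1)[OF p(1)] A(1)[OF that], of "-1"] p(2)[OF that]
    by (simp add: ip'_def)
  \<comment> \<open>Take \<open>u = r\<close>: \<open>b r r\<close> is \<open>ip r (A r)\<close>,
    and \<open>r\<close> is orthogonal to the range of \<open>A\<close>.\<close>
  then have "b r r = 0" using r A sym by metis
  then have r0: "ip r r = 0" using b_coercive[OF r] \<kappa> nonneg[OF r]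
    by (simp add: mult_le_0_iff)
  have "b v p = F v" if v: "v \<in> V" for v
  proof -
    have "\<bar>ip v r\<bar> \<le> 0" using ip_bound[OF v r] r0 by simp
    then have "ip v f - ip v (A p) = 0"
      unfolding r_def using ip_right[OF f(1) A(1)[OF p(1)] v, of "-1"] by simp
    then show ?thesis using A(2)[OF p(1) v] f(2)[OF v] by simp
  qed
  with p(1) show ?thesis by (rule that)
qed

end

section \<open>Square integrable functions on finite measure spaces and density of continuous
  functions\<close>

lemma (in finite_measure) L2_bounded:
  assumes "f \<in> borel_measurable M" "AE x in M. norm (f x) \<le> B"
  shows "f \<in> L2 M"
proof (rule L2I[OF assms(1)])
  show "integrable M (\<lambda>x. (norm (f x))\<^sup>2)"
  proof (rule integrable_const_bound[of _ "B\<^sup>2"])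
    show "AE x in M. norm ((norm (f x))\<^sup>2) \<le> B\<^sup>2"
      using assms(2) by eventually_elim (simp add: power_mono)
  qed (use assms(1) in measurable)
qed

lemma (in finite_measure) L2norm_bounded:
  assumes "f \<in> borel_measurable M" "AE x in M. norm (f x) \<le> B" "0 \<le> B"
  shows "L2norm M f \<le> B * sqrt (measure M (space M))"
proof -
  have "(L2norm M f)\<^sup>2 \<le> (\<integral>x. B\<^sup>2 \<partial>M)" unfolding L2norm_sq
  proof (rule integral_mono_AE)
    show "AE x in M. (norm (f x))\<^sup>2 \<le> B\<^sup>2"
      using assms(2) by eventually_elim (simp add: power_mono)
  qed (use L2_bounded[OF assms(1,2)] in \<open>auto simp: L2D\<close>)
  also have "\<dots> = (B * sqrt (measure M (space M)))\<^sup>2" by (simp add: power_mult_distrib mult.commute)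
  finally show ?thesis by (rule power2_le_imp_le) (use assms(3) in simp)
qed

lemma (in finite_measure) L2_integrable:
  assumes "f \<in> L2 M"
  shows "integrable M f"
proof -
  have "integrable M (\<lambda>x. norm (f x) * norm (1::real))"
    by (rule L2_integrable_product[OF assms]) (rule L2_bounded[of _ 1], auto)
  then show ?thesis using L2D(1)[OF assms] by (simp add: integrable_norm_iff)
qed

text \<open>The radial retraction onto the closed disc of radius \<open>R\<close>, for positive
  \<open>R\<close>, written so that continuity is visible. It makes pointwise approximations
  uniformly bounded, as dominated convergence demands.\<close>

definition clip :: "real \<Rightarrow> complex \<Rightarrow> complex" where
  "clip R z = (1 / max 1 (norm z / R)) *\<^sub>R z"

lemma continuous_clip: "0 < R \<Longrightarrow> continuous_on A (clip R)"
  unfolding clip_def by (intro continuous_intros) (auto simp: max_def)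

lemma norm_clip: "0 < R \<Longrightarrow> norm (clip R z) \<le> R"
  by (auto simp: clip_def max_def field_simps)

lemma clip_eq: "0 < R \<Longrightarrow> norm z \<le> R \<Longrightarrow> clip R z = z"
  by (auto simp: clip_def max_def field_simps)

lemma norm_diff_clip: "0 < R \<Longrightarrow> norm (z - clip R z) \<le> norm z"
proof -
  assume R: "0 < R"
  have "z - clip R z = (1 - 1 / max 1 (norm z / R)) *\<^sub>R z" by (simp add: clip_def algebra_simps)
  moreover have "\<bar>1 - 1 / max 1 (norm z / R)\<bar> \<le> 1" by (auto simp: max_def field_simps)
  ultimately show ?thesis by (simp add: mult_left_le_one_le)
qed

lemma L2norm_tendsto_zero:
  fixes f :: "nat \<Rightarrow> 'a \<Rightarrow> 'b::{banach,second_countable_topology}"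
  assumes "\<And>n. f n \<in> borel_measurable M" "g \<in> L2 M"
    and "AE x in M. (\<lambda>n. f n x) \<longlonglongrightarrow> 0" "\<And>n. AE x in M. norm (f n x) \<le> norm (g x :: 'c::{banach,second_countable_topology})"
  shows "(\<lambda>n. L2norm M (f n)) \<longlonglongrightarrow> 0"
proof -
  have "(\<lambda>n. \<integral>x. (norm (f n x))\<^sup>2 \<partial>M) \<longlonglongrightarrow> (\<integral>x. 0 \<partial>M)"
  proof (rule integral_dominated_convergence[where w="\<lambda>x. (norm (g x))\<^sup>2"])
    show "AE x in M. (\<lambda>n. (norm (f n x))\<^sup>2) \<longlonglongrightarrow> 0"
      using assms(3) by eventually_elim (auto intro!: tendsto_eq_intros)
    show "AE x in M. norm ((norm (f n x))\<^sup>2) \<le> (norm (g x))\<^sup>2" for n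
      using assms(4)[of n] by eventually_elim (simp add: power_mono)
    show "(\<lambda>x. (norm (f n x))\<^sup>2) \<in> borel_measurable M" for n using assms(1) by measurable
  qed (use assms(2) in \<open>auto simp: L2D\<close>)
  then have "(\<lambda>n. sqrt (\<integral>x. (norm (f n x))\<^sup>2 \<partial>M)) \<longlonglongrightarrow> sqrt 0"
    by (intro tendsto_real_sqrt) simp
  then show ?thesis by (simp add: L2norm_def)
qed

lemma continuous_measurable_lebesgue_on:
  fixes g :: "'n::euclidean_space \<Rightarrow> 'b::topological_space"
  assumes "continuous_on UNIV g"
  shows "g \<in> borel_measurable (lebesgue_on S)"
proof -
  have "g \<in> borel_measurable lborel" using borel_measurable_continuous_onI[OF assms] by simp
  then show ?thesis by (intro measurable_restrict_space1 measurable_completion)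
qed

text \<open>Truncation by \<open>clip\<close> costs little in norm. A measurable function is the
  limit of continuous ones off a negligible set (this is \<open>measurable_on\<close>); clipping
  those as well gives a common bound, and \<open>S\<close> has finite measure.\<close>

lemma L2_continuous_dense:
  fixes f :: "'n::euclidean_space \<Rightarrow> complex"
  assumes f: "f \<in> L2 (lebesgue_on S)" and S: "S \<in> lmeasurable" and "0 < \<epsilon>"
  obtains g B where "continuous_on UNIV g" "\<And>x. norm (g x) \<le> B" "L2norm (lebesgue_on S) (\<lambda>x. f x - g x) < \<epsilon>"
proof -
  interpret finite_measure "lebesgue_on S" using S by (rule finite_measure_lebesgue_on)
  let ?M = "lebesgue_on S"
  have Sm: "S \<in> sets lebesgue" using S by auto
  have cm: "g \<in> borel_measurable ?M" if "continuous_on UNIV g" for g :: "'n \<Rightarrow> complex"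
    using that by (rule continuous_measurable_lebesgue_on)
  have fm: "f \<in> borel_measurable ?M" using f by (rule L2D)
  have clipm: "(\<lambda>x. clip R (h x)) \<in> borel_measurable N" if "h \<in> borel_measurable N" "0 < R" for R h and N :: "'n measure"
    using that by (intro measurable_compose[OF _ borel_measurable_continuous_onI[OF continuous_clip]])
  have "(\<lambda>n. L2norm ?M (\<lambda>x. f x - clip (Suc n) (f x))) \<longlonglongrightarrow> 0"
  proof (rule L2norm_tendsto_zero[OF _ f])
    show "(\<lambda>x. f x - clip (Suc n) (f x)) \<in> borel_measurable ?M" for n
      by (intro borel_measurable_diff fm clipm) auto
    show "AE x in ?M. (\<lambda>n. f x - clip (Suc n) (f x)) \<longlonglongrightarrow> 0"
    proof (rule AE_I2, rule tendsto_eventually)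
      fix x
      obtain N where "norm (f x) \<le> real N" using real_arch_simple by blast
      then show "\<forall>\<^sub>F n in sequentially. f x - clip (Suc n) (f x) = 0"
        by (intro eventually_sequentiallyI[of N]) (simp add: clip_eq)
    qed
    show "AE x in ?M. norm (f x - clip (Suc n) (f x)) \<le> norm (f x)" for n
      by (intro AE_I2 norm_diff_clip) simp
  qed
  then have "\<forall>\<^sub>F n in sequentially. L2norm ?M (\<lambda>x. f x - clip (Suc n) (f x)) < \<epsilon> / 2"
    by (rule order_tendstoD) (use \<open>0 < \<epsilon>\<close> in simp)
  then obtain N where "L2norm ?M (\<lambda>x. f x - clip (Suc N) (f x)) < \<epsilon> / 2"
    by (auto simp only: eventually_sequentially)
  then obtain R where R: "0 < R" "L2norm ?M (\<lambda>x. f x - clip R (f x)) < \<epsilon> / 2"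
    using that[of "Suc N"] by simp
  obtain N G where N: "negligible N" and G: "\<And>n. continuous_on UNIV (G n)"
    and lim: "\<And>x. x \<notin> N \<Longrightarrow> (\<lambda>n. G n x) \<longlonglongrightarrow> (if x \<in> S then f x else 0)"
    using fm measurable_on_iff_borel_measurable[OF Sm, of f] unfolding measurable_on_def by auto
  have cG: "continuous_on UNIV (\<lambda>x. clip R (G n x))" for n
    using continuous_on_compose2[OF continuous_clip[OF R(1)] G] by auto
  have N0: "N \<in> null_sets lebesgue" using N by (simp add: negligible_iff_null_sets)
  have AN: "AE x in ?M. x \<notin> N"
    using N0 Sm by (subst AE_restrict_space_iff) (auto intro: AE_not_in eventually_mono)
  have "(\<lambda>n. L2norm ?M (\<lambda>x. clip R (f x) - clip R (G n x))) \<longlonglongrightarrow> 0"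
  proof (rule L2norm_tendsto_zero)
    show "(\<lambda>x. clip R (f x) - clip R (G n x)) \<in> borel_measurable ?M" for n
      by (intro borel_measurable_diff clipm fm cm G R)
    show "(\<lambda>x. 2 * R) \<in> L2 ?M" by (rule L2_bounded) auto
    show "AE x in ?M. norm (clip R (f x) - clip R (G n x)) \<le> norm (2 * R)" for n
    proof (rule AE_I2)
      fix x show "norm (clip R (f x) - clip R (G n x)) \<le> norm (2 * R)"
        using norm_triangle_ineq4[of "clip R (f x)" "clip R (G n x)"] norm_clip[OF R(1), of "f x"]
          norm_clip[OF R(1), of "G n x"] by simp
    qed
    show "AE x in ?M. (\<lambda>n. clip R (f x) - clip R (G n x)) \<longlonglongrightarrow> 0"
      using AN AE_space
    proof eventually_elim
      case (elim x)
      then have "(\<lambda>n. G n x) \<longlonglongrightarrow> f x" using lim[of x] by simp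
      then have "(\<lambda>n. clip R (G n x)) \<longlonglongrightarrow> clip R (f x)"
        using continuous_clip[OF R(1), of UNIV]
        by (intro isCont_tendsto_compose[of _ "clip R"]) (auto simp: continuous_on_eq_continuous_at)
      then show ?case using tendsto_diff[OF tendsto_const[of "clip R (f x)"]] by fastforce
    qed
  qed
  then have "\<forall>\<^sub>F n in sequentially. L2norm ?M (\<lambda>x. clip R (f x) - clip R (G n x)) < \<epsilon> / 2"
    by (rule order_tendstoD) (use \<open>0 < \<epsilon>\<close> in simp)
  then obtain n where n: "L2norm ?M (\<lambda>x. clip R (f x) - clip R (G n x)) < \<epsilon> / 2"
    by (auto simp: eventually_sequentially)
  have cl2: "(\<lambda>x. clip R (h x)) \<in> L2 ?M" if "h \<in> borel_measurable ?M" for h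
    by (rule L2_bounded[OF clipm[OF that R(1)]]) (use norm_clip[OF R(1)] in auto)
  have "L2norm ?M (\<lambda>x. f x - clip R (G n x)) =
      L2norm ?M (\<lambda>x. (f x - clip R (f x)) + (clip R (f x) - clip R (G n x)))" by simp
  also have "\<dots> \<le> L2norm ?M (\<lambda>x. f x - clip R (f x)) + L2norm ?M (\<lambda>x. clip R (f x) - clip R (G n x))"
    by (intro L2norm_triangle L2_diff f cl2 fm cm G)
  also have "\<dots> < \<epsilon>" using R n by simp
  finally show ?thesis using that[OF cG[of n], of R] norm_clip[OF R(1)] by blast
qed

subsection \<open>A smooth bump\<close>

text \<open>Squaring the truncated parabola makes it continuously differentiable across the unit
  sphere, which is the regularity that test functions have here.\<close>

definition bump :: "'a::real_inner \<Rightarrow> real" where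
  "bump x = (max 0 (1 - (norm x)\<^sup>2))\<^sup>2"

definition bump_deriv :: "'a::real_inner \<Rightarrow> 'a \<Rightarrow> real" where
  "bump_deriv x v = - 4 * max 0 (1 - (norm x)\<^sup>2) * (x \<bullet> v)"

lemma bump_nonneg [simp]: "0 \<le> bump x"
  by (simp add: bump_def)

lemma bump_le_1: "bump x \<le> 1"
  unfolding bump_def by (rule power_le_one) auto

lemma bump_eq_0: "1 \<le> norm x \<Longrightarrow> bump x = 0"
  by (simp add: bump_def)

lemma continuous_bump [continuous_intros]:
  "continuous_on A f \<Longrightarrow> continuous_on A (\<lambda>x. bump (f x))"
  unfolding bump_def by (intro continuous_intros)

lemma continuous_bump_deriv [continuous_intros]:
  "continuous_on A f \<Longrightarrow> continuous_on A (\<lambda>x. bump_deriv (f x) v)"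
  unfolding bump_deriv_def by (intro continuous_intros)

lemma bump_deriv_bound: "\<bar>bump_deriv x v\<bar> \<le> 4 * norm v"
proof (cases "1 \<le> norm x")
  case False
  then have "\<bar>x \<bullet> v\<bar> \<le> 1 * norm v"
    using Cauchy_Schwarz_ineq2[of x v] by (meson dual_order.trans linear mult_right_mono norm_ge_zero)
  moreover have "\<bar>max 0 (1 - (norm x)\<^sup>2)\<bar> \<le> 1" by simp
  ultimately have "\<bar>max 0 (1 - (norm x)\<^sup>2)\<bar> * \<bar>x \<bullet> v\<bar> \<le> 1 * (1 * norm v)"
    by (intro mult_mono) auto
  then show ?thesis by (simp add: bump_deriv_def abs_mult)
qed (simp add: bump_deriv_def)

text \<open>The square of \<open>max 0 t\<close> has the derivative \<open>2 * max 0 t\<close>,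
  which is Lipschitz with constant 2; this is the corresponding Taylor remainder.\<close>

lemma max_sq_remainder:
  fixes t s :: real
  shows "\<bar>(max 0 (t + s))\<^sup>2 - (max 0 t)\<^sup>2 - 2 * max 0 t * s\<bar> \<le> s\<^sup>2"
proof -
  consider "0 \<le> t" "0 \<le> t + s" | "0 \<le> t" "t + s < 0" | "t < 0" "0 \<le> t + s" | "t < 0" "t + s < 0" by linarith
  then show ?thesis
  proof cases
    case 1 then show ?thesis by (simp add: power2_eq_square algebra_simps)
  next
    case 2
    then have "(max 0 (t + s))\<^sup>2 - (max 0 t)\<^sup>2 - 2 * max 0 t * s = s\<^sup>2 - (t + s)\<^sup>2"
      by (simp add: power2_eq_square algebra_simps)
    moreover have "\<bar>t + s\<bar> \<le> \<bar>s\<bar>" using 2 by simp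
    then have "(t + s)\<^sup>2 \<le> s\<^sup>2" by (simp add: abs_le_square_iff)
    ultimately show ?thesis by simp
  next
    case 3
    then have "\<bar>t + s\<bar> \<le> \<bar>s\<bar>" by simp
    then have "(t + s)\<^sup>2 \<le> s\<^sup>2" by (simp add: abs_le_square_iff)
    then show ?thesis using 3 by simp
  next
    case 4 then show ?thesis by simp
  qed
qed

text \<open>The constant depends on \<open>x\<close> only through \<open>R\<close>. Hence the
  remainder can be integrated over a bounded domain, which takes the place of a theorem on
  differentiation under the integral.\<close>

lemma bump_remainder:
  assumes "norm x \<le> R" "norm v \<le> 1"
  shows "\<bar>bump (x + v) - bump x - bump_deriv x v\<bar> \<le> ((2 * R + 1)\<^sup>2 + 2) * (norm v)\<^sup>2"
proof -
  define t where "t = 1 - (norm x)\<^sup>2"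
  \<comment> \<open>The increment of \<open>1 - (norm x)^2\<close>. It is of first order in
    \<open>v\<close>; its quadratic part accounts for the difference between
    \<open>2 * max 0 t * s\<close> and \<open>bump_deriv x v\<close>.\<close>
  define s where "s = - (2 * (x \<bullet> v) + (norm v)\<^sup>2)"
  have ts: "1 - (norm (x + v))\<^sup>2 = t + s"
    by (simp add: t_def s_def power2_norm_eq_inner inner_add inner_commute)
  have "bump (x + v) - bump x - bump_deriv x v =
      ((max 0 (t + s))\<^sup>2 - (max 0 t)\<^sup>2 - 2 * max 0 t * s) - 2 * max 0 t * (norm v)\<^sup>2"
    unfolding bump_def bump_deriv_def ts t_def[symmetric] by (simp add: s_def algebra_simps)
  moreover have "\<bar>s\<bar> \<le> (2 * R + 1) * norm v"
  proof -
    have "\<bar>- (2 * a + b\<^sup>2)\<bar> \<le> 2 * \<bar>a\<bar> + b\<^sup>2" for a b :: real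
      using zero_le_power2[of b] by linarith
    then have "\<bar>s\<bar> \<le> 2 * \<bar>x \<bullet> v\<bar> + (norm v)\<^sup>2" unfolding s_def .
    also have "\<bar>x \<bullet> v\<bar> \<le> R * norm v"
      using Cauchy_Schwarz_ineq2[of x v] assms(1) by (meson mult_right_mono norm_ge_zero order_trans)
    also have "(norm v)\<^sup>2 \<le> norm v" using assms(2) by (simp add: power2_eq_square mult_left_le_one_le)
    finally show ?thesis by (simp add: algebra_simps)
  qed
  then have "s\<^sup>2 \<le> (2 * R + 1)\<^sup>2 * (norm v)\<^sup>2"
    by (metis abs_ge_zero power2_abs power_mono power_mult_distrib)
  moreover have "\<bar>2 * max 0 t * (norm v)\<^sup>2\<bar> \<le> 2 * (norm v)\<^sup>2"
    by (simp add: t_def abs_mult mult_left_le_one_le)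
  moreover have "\<bar>a - b\<bar> \<le> p + q" if "\<bar>a\<bar> \<le> r" "r \<le> p" "\<bar>b\<bar> \<le> q" for a b p q r :: real
    using that by linarith
  ultimately show ?thesis using max_sq_remainder[of t s] by (simp only: distrib_right)
qed

lemma has_derivativeI_quadratic:
  fixes f :: "'a::real_normed_vector \<Rightarrow> 'b::real_normed_vector"
  assumes D: "bounded_linear D" and "0 < d" and C: "0 \<le> C"
    and le: "\<And>v. norm v \<le> d \<Longrightarrow> norm (f (x + v) - f x - D v) \<le> C * (norm v)\<^sup>2"
  shows "(f has_derivative D) (at x)"
  unfolding has_derivative_at
proof (intro conjI D)
  show "(\<lambda>v. norm (f (x + v) - f x - D v) / norm v) \<midarrow>0\<rightarrow> 0"
  proof (rule Lim_null_comparison)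
    show "\<forall>\<^sub>F v in at 0. norm (norm (f (x + v) - f x - D v) / norm v) \<le> C * norm v"
      unfolding eventually_at
    proof (intro exI[of _ d] conjI ballI impI \<open>0 < d\<close>)
      fix v :: 'a assume "v \<noteq> 0 \<and> dist v 0 < d"
      then show "norm (norm (f (x + v) - f x - D v) / norm v) \<le> C * norm v"
        using le[of v] by (simp add: divide_le_eq power2_eq_square mult.assoc)
    qed
    show "((\<lambda>v. C * norm v) \<longlongrightarrow> 0) (at 0)"
      by (intro tendsto_mult_right_zero tendsto_norm_zero tendsto_ident_at)
  qed
qed

lemma bounded_linear_bump_deriv: "bounded_linear (bump_deriv x)"
  unfolding bump_deriv_def by (intro bounded_linear_const_mult bounded_linear_inner_right)

lemma has_derivative_bump: "(bump has_derivative bump_deriv x) (at x)"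
  by (rule has_derivativeI_quadratic[where d=1 and C="(2 * norm x + 1)\<^sup>2 + 2", OF bounded_linear_bump_deriv])
     (use bump_remainder[of x "norm x"] in auto)

lemma partial_derivI: "(f has_derivative D) (at x) \<Longrightarrow> partial_deriv i f x = D (axis i 1)"
  unfolding partial_deriv_def by (metis frechet_derivative_at)

lemma C1I:
  assumes "\<And>x. (f has_derivative D x) (at x)" "\<And>i. continuous_on UNIV (\<lambda>x. D x (axis i 1))"
  shows "f \<in> C1"
proof -
  have "partial_deriv i f = (\<lambda>x. D x (axis i 1))" for i
    using partial_derivI[OF assms(1)] by auto
  then show ?thesis using assms unfolding C1_def differentiable_def by auto
qed

lemma C1_has_derivative: "f \<in> C1 \<Longrightarrow> (f has_derivative frechet_derivative f (at x)) (at x)"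
  by (simp add: C1_def frechet_derivative_works)

lemma C1_continuous: "f \<in> C1 \<Longrightarrow> continuous_on A f"
  by (meson C1_has_derivative continuous_at_imp_continuous_on has_derivative_continuous)

lemma C1_partial_continuous: "f \<in> C1 \<Longrightarrow> continuous_on A (partial_deriv i f)"
  using continuous_on_subset[of UNIV "partial_deriv i f" A] by (auto simp: C1_def)

lemma nn_integral_affine:
  fixes f :: "'n::euclidean_space \<Rightarrow> ennreal"
  assumes [measurable]: "f \<in> borel_measurable borel" and c: "c \<noteq> 0"
  shows "(\<integral>\<^sup>+x. f x \<partial>lborel) = ennreal (\<bar>c\<bar> ^ DIM('n)) * (\<integral>\<^sup>+x. f (t + c *\<^sub>R x) \<partial>lborel)"
  by (subst lborel_affine[OF c, of t]) (simp add: nn_integral_density nn_integral_distr nn_integral_cmult)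

definition bump_mass :: real where
  "bump_mass = enn2real (\<integral>\<^sup>+x. ennreal (bump (x::real^2)) \<partial>lborel)"

lemma bump_borel [measurable]: "bump \<in> borel_measurable borel"
  by (intro borel_measurable_continuous_onI continuous_intros)

text \<open>Finite because \<open>bump\<close> lies below the indicator of the unit ball; positive
  because it is positive on the open ball, which is not negligible.\<close>

lemma bump_mass:
  "(\<integral>\<^sup>+x. ennreal (bump (x::real^2)) \<partial>lborel) = ennreal bump_mass" "0 < bump_mass"
proof -
  have "(\<integral>\<^sup>+x. ennreal (bump (x::real^2)) \<partial>lborel) \<le> (\<integral>\<^sup>+x. indicator (cball 0 1) (x::real^2) \<partial>lborel)"
    by (intro nn_integral_mono) (auto simp: indicator_def bump_le_1 bump_eq_0)
  also have "\<dots> = emeasure lborel (cball (0::real^2) 1)" by simp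
  also have "\<dots> < \<infinity>" by (rule emeasure_lborel_cball_finite)
  finally have fin: "(\<integral>\<^sup>+x. ennreal (bump (x::real^2)) \<partial>lborel) < \<infinity>" .
  then show eq: "(\<integral>\<^sup>+x. ennreal (bump (x::real^2)) \<partial>lborel) = ennreal bump_mass"
    unfolding bump_mass_def by (simp add: less_top)
  have "(\<integral>\<^sup>+x. ennreal (bump (x::real^2)) \<partial>lborel) \<noteq> 0"
  proof
    assume "(\<integral>\<^sup>+x. ennreal (bump (x::real^2)) \<partial>lborel) = 0"
    then have "AE x::real^2 in lborel. bump x = 0"
      by (subst (asm) nn_integral_0_iff_AE) (auto simp: ennreal_eq_0_iff dest: antisym[OF _ bump_nonneg] elim!: eventually_mono)
    then have "AE x::real^2 in lborel. x \<notin> ball 0 1"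
    proof eventually_elim
      case (elim x)
      show "x \<notin> ball 0 1"
      proof
        assume "x \<in> ball 0 1"
        then have "(norm x)\<^sup>2 < 1" by (simp add: power_less_one_iff)
        then show False using elim by (simp add: bump_def)
      qed
    qed
    then have "ball (0::real^2) 1 \<in> null_sets lborel" by (subst AE_iff_null_sets) auto
    then have "negligible (ball (0::real^2) 1)"
      by (auto simp: negligible_iff_null_sets intro: null_sets_completionI)
    then show False using open_not_negligible[of "ball (0::real^2) 1"] by simp
  qed
  then show "0 < bump_mass" using eq
    by (metis bump_mass_def enn2real_nonneg ennreal_0 less_eq_real_def)
qed


subsection \<open>Mollification on a convex domain\<close>

text \<open>Points are first contracted towards \<open>z0\<close> by the factor \<open>1 - \<delta>\<close>; the average at \<open>x\<close> is then taken
  over a ball of radius \<open>\<delta> r0\<close>, which stays inside the domain by convexity.\<close>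

locale convex_domain =
  fixes \<Omega> :: "(real^2) set" and z0 :: "real^2" and r0 :: real
  assumes open_dom: "open \<Omega>" and bounded_dom: "bounded \<Omega>" and convex_dom: "convex \<Omega>"
    and r0_pos: "0 < r0" and ball_sub: "cball z0 r0 \<subseteq> \<Omega>"
begin

abbreviation M :: "(real^2) measure" where "M \<equiv> lebesgue_on \<Omega>"

lemma lmeas [simp]: "\<Omega> \<in> lmeasurable"
  by (rule lmeasurable_open[OF bounded_dom open_dom])

lemma sets_leb [simp]: "\<Omega> \<in> sets lebesgue"
  by (rule fmeasurableD[OF lmeas])

sublocale finite_measure M
  by (rule finite_measure_lebesgue_on) simp

sublocale MM: pair_sigma_finite M M ..

text \<open>Position of \<open>\<zeta>\<close> relative to the centre
  \<open>(1 - \<delta>) x + \<delta> z0\<close> of the averaging ball, in units of its radius. It is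
  affine in both variables, with slope \<open>1 / (\<delta> * r0)\<close> in \<open>\<zeta>\<close>
  and \<open>- (1 - \<delta>) / (\<delta> * r0)\<close> in \<open>x\<close>.\<close>

definition arg :: "real \<Rightarrow> real^2 \<Rightarrow> real^2 \<Rightarrow> real^2" where
  "arg \<delta> x \<zeta> = (1 / (\<delta> * r0)) *\<^sub>R (\<zeta> - ((1 - \<delta>) *\<^sub>R x + \<delta> *\<^sub>R z0))"

text \<open>The square in the denominator is the Jacobian of the scaling in dimension two, so that
  the kernel has mass one in \<open>\<zeta>\<close>.\<close>

definition ker :: "real \<Rightarrow> real^2 \<Rightarrow> real^2 \<Rightarrow> real" where
  "ker \<delta> x \<zeta> = 1 / (bump_mass * (\<delta> * r0)\<^sup>2) * bump (arg \<delta> x \<zeta>)"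

definition moll :: "real \<Rightarrow> (real^2 \<Rightarrow> complex) \<Rightarrow> real^2 \<Rightarrow> complex" where
  "moll \<delta> f x = (\<integral>\<zeta>. ker \<delta> x \<zeta> *\<^sub>R f \<zeta> \<partial>M)"

lemma ker_nonneg [simp]: "0 \<le> ker \<delta> x \<zeta>"
  using bump_mass(2) by (simp add: ker_def)

lemma ker_bound: "ker \<delta> x \<zeta> \<le> 1 / (bump_mass * (\<delta> * r0)\<^sup>2)"
  unfolding ker_def using bump_le_1 bump_mass(2) by (intro mult_left_le) auto

lemma arg_alt: "arg \<delta> x \<zeta> = (1 / (\<delta> * r0)) *\<^sub>R (\<zeta> - \<delta> *\<^sub>R z0) + (- ((1 - \<delta>) / (\<delta> * r0))) *\<^sub>R x"
  by (simp add: arg_def scaleR_diff_right scaleR_add_right)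

lemma arg_continuous [continuous_intros]:
  "continuous_on A f \<Longrightarrow> continuous_on A g \<Longrightarrow> continuous_on A (\<lambda>y. arg \<delta> (f y) (g y))"
  unfolding arg_def by (intro continuous_intros)

lemma ker_continuous [continuous_intros]:
  "continuous_on A f \<Longrightarrow> continuous_on A g \<Longrightarrow> continuous_on A (\<lambda>y. ker \<delta> (f y) (g y))"
  unfolding ker_def by (intro continuous_intros)

lemma M_to_borel: "(\<lambda>x. x) \<in> M \<rightarrow>\<^sub>M borel"
  by (intro continuous_measurable_lebesgue_on continuous_intros)

lemma ker_measurable_pair [measurable]:
  "case_prod (ker \<delta>) \<in> borel_measurable (M \<Otimes>\<^sub>M M)"
proof -
  have "continuous_on UNIV (\<lambda>p. ker \<delta> (fst p) (snd p))" by (intro continuous_intros)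
  then have "(\<lambda>p. ker \<delta> (fst p) (snd p)) \<in> borel_measurable (borel \<Otimes>\<^sub>M borel)"
    by (simp add: borel_prod borel_measurable_continuous_onI)
  moreover have "(\<lambda>p. (fst p, snd p)) \<in> M \<Otimes>\<^sub>M M \<rightarrow>\<^sub>M borel \<Otimes>\<^sub>M borel"
    by (intro measurable_Pair measurable_compose[OF measurable_fst M_to_borel]
        measurable_compose[OF measurable_snd M_to_borel])
  ultimately show ?thesis
    by (auto dest: measurable_compose simp: case_prod_beta')
qed

lemma ker_measurable: "(\<lambda>\<zeta>. ker \<delta> x \<zeta>) \<in> borel_measurable M" "(\<lambda>x. ker \<delta> x \<zeta>) \<in> borel_measurable M"
  by (intro continuous_measurable_lebesgue_on continuous_intros)+

text \<open>Where the kernel can be nonzero, \<open>\<zeta>\<close> is a convex combination of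
  \<open>x\<close> and a point of the ball about \<open>z0\<close>, and therefore stays in the
  domain.\<close>

lemma ker_support:
  assumes "x \<in> \<Omega>" "0 < \<delta>" "\<delta> < 1" "norm (arg \<delta> x \<zeta>) \<le> 1"
  obtains y where "y \<in> cball z0 r0" "\<zeta> = (1 - \<delta>) *\<^sub>R x + \<delta> *\<^sub>R y" "\<zeta> \<in> \<Omega>"
proof
  let ?y = "z0 + r0 *\<^sub>R arg \<delta> x \<zeta>"
  show y: "?y \<in> cball z0 r0" using assms(4) r0_pos by (simp add: dist_norm mult_left_le)
  have "\<delta> *\<^sub>R r0 *\<^sub>R arg \<delta> x \<zeta> = \<zeta> - ((1 - \<delta>) *\<^sub>R x + \<delta> *\<^sub>R z0)"
    using assms(2) r0_pos by (simp add: arg_def)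
  then show \<zeta>: "\<zeta> = (1 - \<delta>) *\<^sub>R x + \<delta> *\<^sub>R ?y" by (simp add: algebra_simps)
  show "\<zeta> \<in> \<Omega>"
    by (subst \<zeta>, rule convexD[OF convex_dom assms(1)]) (use y ball_sub assms in auto)
qed

lemma ker_eq_0: "1 \<le> norm (arg \<delta> x \<zeta>) \<Longrightarrow> ker \<delta> x \<zeta> = 0"
  by (simp add: ker_def bump_eq_0)

lemma nn_integral_M: "f \<in> borel_measurable borel \<Longrightarrow> (\<integral>\<^sup>+x. f x \<partial>M) = (\<integral>\<^sup>+x. f x * indicator \<Omega> x \<partial>lborel)"
  using open_dom by (simp add: nn_integral_restrict_space nn_integral_completion)

lemma nn_integral_bump_affine:
  assumes "c \<noteq> 0"
  shows "(\<integral>\<^sup>+x. ennreal (bump (t + c *\<^sub>R (x::real^2))) \<partial>lborel) = ennreal (bump_mass / c\<^sup>2)"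
proof -
  have "ennreal (1 / c\<^sup>2) * ennreal bump_mass
      = ennreal (1 / c\<^sup>2) * (ennreal (\<bar>c\<bar> ^ 2) * (\<integral>\<^sup>+x. ennreal (bump (t + c *\<^sub>R (x::real^2))) \<partial>lborel))"
    using nn_integral_affine[OF _ assms, of "\<lambda>x::real^2. ennreal (bump x)" t] by (simp add: bump_mass(1))
  also have "\<dots> = ennreal (1 / c\<^sup>2 * c\<^sup>2) * (\<integral>\<^sup>+x. ennreal (bump (t + c *\<^sub>R (x::real^2))) \<partial>lborel)"
    by (subst ennreal_mult) (auto simp: mult.assoc)
  finally show ?thesis
    using assms by (simp add: ennreal_mult[symmetric] less_imp_le bump_mass(2))
qed

text \<open>Both parts are affine substitutions in the bump. In \<open>\<zeta>\<close> the support
  lies in the domain and the mass is exactly one. In \<open>x\<close> the domain is enlarged to the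
  plane, and the slope carries the factor \<open>1 - \<delta>\<close>, whose inverse square
  appears.\<close>

lemma ker_nn_integral:
  assumes "0 < \<delta>" "\<delta> < 1"
  shows "x \<in> \<Omega> \<Longrightarrow> (\<integral>\<^sup>+\<zeta>. ennreal (ker \<delta> x \<zeta>) \<partial>M) = 1"
    and "(\<integral>\<^sup>+x. ennreal (ker \<delta> x \<zeta>) \<partial>M) \<le> ennreal (1 / (1 - \<delta>)\<^sup>2)"
proof -
  have k: "ennreal (ker \<delta> x \<zeta>) = ennreal (1 / (bump_mass * (\<delta> * r0)\<^sup>2)) * ennreal (bump (arg \<delta> x \<zeta>))" for x \<zeta>
    by (subst ennreal_mult[symmetric]) (auto simp: ker_def bump_mass(2) less_imp_le)
  have [measurable]: "(\<lambda>\<zeta>. ennreal (ker \<delta> x \<zeta>)) \<in> borel_measurable borel"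
    "(\<lambda>x. ennreal (ker \<delta> x \<zeta>)) \<in> borel_measurable borel"
    "(\<lambda>\<zeta>. ennreal (bump (arg \<delta> x \<zeta>))) \<in> borel_measurable borel"
    "(\<lambda>x. ennreal (bump (arg \<delta> x \<zeta>))) \<in> borel_measurable borel" for x \<zeta>
    by (intro measurable_compose[OF _ measurable_ennreal] borel_measurable_continuous_onI continuous_intros)+
  {
    assume x: "x \<in> \<Omega>"
    have "(\<integral>\<^sup>+\<zeta>. ennreal (ker \<delta> x \<zeta>) \<partial>M) = (\<integral>\<^sup>+\<zeta>. ennreal (ker \<delta> x \<zeta>) * indicator \<Omega> \<zeta> \<partial>lborel)"
      by (rule nn_integral_M) measurable
    also have "\<dots> = (\<integral>\<^sup>+\<zeta>. ennreal (ker \<delta> x \<zeta>) \<partial>lborel)"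
    proof (rule nn_integral_cong)
      fix \<zeta>
      show "ennreal (ker \<delta> x \<zeta>) * indicator \<Omega> \<zeta> = ennreal (ker \<delta> x \<zeta>)"
      proof (cases "\<zeta> \<in> \<Omega>")
        case False
        then have "ker \<delta> x \<zeta> = 0"
          using ker_support[OF x assms] ker_eq_0 by (metis linear)
        then show ?thesis by simp
      qed simp
    qed
    also have "\<dots> = ennreal (1 / (bump_mass * (\<delta> * r0)\<^sup>2)) * (\<integral>\<^sup>+\<zeta>. ennreal (bump (arg \<delta> x \<zeta>)) \<partial>lborel)"
      unfolding k by (rule nn_integral_cmult) measurable
    also have "(\<integral>\<^sup>+\<zeta>. ennreal (bump (arg \<delta> x \<zeta>)) \<partial>lborel) =
       (\<integral>\<^sup>+\<zeta>. ennreal (bump (- (1 / (\<delta> * r0)) *\<^sub>R ((1 - \<delta>) *\<^sub>R x + \<delta> *\<^sub>R z0) + (1 / (\<delta> * r0)) *\<^sub>R \<zeta>)) \<partial>lborel)"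
      by (simp add: arg_def algebra_simps)
    also have "\<dots> = ennreal (bump_mass / (1 / (\<delta> * r0))\<^sup>2)"
      by (rule nn_integral_bump_affine) (use assms r0_pos in simp)
    also have "ennreal (1 / (bump_mass * (\<delta> * r0)\<^sup>2)) * \<dots> = 1"
      using assms r0_pos bump_mass(2) by (subst ennreal_mult[symmetric]) (auto simp: field_simps)
    finally show "(\<integral>\<^sup>+\<zeta>. ennreal (ker \<delta> x \<zeta>) \<partial>M) = 1" .
  }
  have "(\<integral>\<^sup>+x. ennreal (ker \<delta> x \<zeta>) \<partial>M) = (\<integral>\<^sup>+x. ennreal (ker \<delta> x \<zeta>) * indicator \<Omega> x \<partial>lborel)"
    by (rule nn_integral_M) measurable
  also have "\<dots> \<le> (\<integral>\<^sup>+x. ennreal (ker \<delta> x \<zeta>) \<partial>lborel)"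
    by (intro nn_integral_mono) (auto simp: indicator_def)
  also have "\<dots> = ennreal (1 / (bump_mass * (\<delta> * r0)\<^sup>2)) * (\<integral>\<^sup>+x. ennreal (bump (arg \<delta> x \<zeta>)) \<partial>lborel)"
    unfolding k by (rule nn_integral_cmult) measurable
  also have "(\<integral>\<^sup>+x. ennreal (bump (arg \<delta> x \<zeta>)) \<partial>lborel) =
     (\<integral>\<^sup>+x. ennreal (bump ((1 / (\<delta> * r0)) *\<^sub>R (\<zeta> - \<delta> *\<^sub>R z0) + (- ((1 - \<delta>) / (\<delta> * r0))) *\<^sub>R x)) \<partial>lborel)"
    unfolding arg_alt ..
  also have "\<dots> = ennreal (bump_mass / (- ((1 - \<delta>) / (\<delta> * r0)))\<^sup>2)"
    by (rule nn_integral_bump_affine) (use assms r0_pos in simp)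
  also have "ennreal (1 / (bump_mass * (\<delta> * r0)\<^sup>2)) * \<dots> = ennreal (1 / (1 - \<delta>)\<^sup>2)"
    using assms r0_pos bump_mass(2) by (subst ennreal_mult[symmetric]) (auto simp: field_simps)
  finally show "(\<integral>\<^sup>+x. ennreal (ker \<delta> x \<zeta>) \<partial>M) \<le> ennreal (1 / (1 - \<delta>)\<^sup>2)" .
qed


lemma ker_integral:
  assumes "0 < \<delta>" "\<delta> < 1" "x \<in> \<Omega>"
  shows "integrable M (ker \<delta> x)" "(\<integral>\<zeta>. ker \<delta> x \<zeta> \<partial>M) = 1"
proof -
  show i: "integrable M (ker \<delta> x)"
    by (rule integrable_const_bound[of _ "1 / (bump_mass * (\<delta> * r0)\<^sup>2)"])
       (use ker_bound ker_measurable in auto)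
  have "ennreal (\<integral>\<zeta>. ker \<delta> x \<zeta> \<partial>M) = 1"
    using nn_integral_eq_integral[OF i] ker_nn_integral(1)[OF assms] by simp
  then show "(\<integral>\<zeta>. ker \<delta> x \<zeta> \<partial>M) = 1" by (simp add: ennreal_eq_1)
qed

lemma integrable_bounded_times:
  fixes f :: "real^2 \<Rightarrow> complex"
  assumes "integrable M f" "k \<in> borel_measurable M" "\<And>\<zeta>. \<bar>k \<zeta>\<bar> \<le> B"
  shows "integrable M (\<lambda>\<zeta>. k \<zeta> *\<^sub>R f \<zeta>)"
proof (rule Bochner_Integration.integrable_bound)
  show "integrable M (\<lambda>\<zeta>. B *\<^sub>R f \<zeta>)" using assms(1) by simp
  have "\<bar>k \<zeta>\<bar> \<le> \<bar>B\<bar>" for \<zeta> using assms(3)[of \<zeta>] by linarith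
  then show "AE \<zeta> in M. norm (k \<zeta> *\<^sub>R f \<zeta>) \<le> norm (B *\<^sub>R f \<zeta>)"
    by (intro AE_I2) (auto intro!: mult_right_mono)
qed (use assms in \<open>auto intro: borel_measurable_scaleR\<close>)

lemma moll_integrable:
  fixes f :: "real^2 \<Rightarrow> complex"
  shows "integrable M f \<Longrightarrow> integrable M (\<lambda>\<zeta>. ker \<delta> x \<zeta> *\<^sub>R f \<zeta>)"
  by (rule integrable_bounded_times[OF _ ker_measurable(1)]) (use ker_bound in auto)

text \<open>The derivative of the kernel in its variable \<open>x\<close>, in direction
  \<open>v\<close>; the slope of \<open>arg\<close> in \<open>x\<close> is already inserted.\<close>

definition kerD :: "real \<Rightarrow> real^2 \<Rightarrow> real^2 \<Rightarrow> real^2 \<Rightarrow> real" where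
  "kerD \<delta> x v \<zeta> = 1 / (bump_mass * (\<delta> * r0)\<^sup>2) * bump_deriv (arg \<delta> x \<zeta>) ((- ((1 - \<delta>) / (\<delta> * r0))) *\<^sub>R v)"

lemma kerD_bound:
  "\<bar>kerD \<delta> x v \<zeta>\<bar> \<le> 1 / (bump_mass * (\<delta> * r0)\<^sup>2) * (4 * \<bar>(1 - \<delta>) / (\<delta> * r0)\<bar>) * norm v"
proof -
  have "\<bar>kerD \<delta> x v \<zeta>\<bar> \<le> 1 / (bump_mass * (\<delta> * r0)\<^sup>2) * (4 * norm ((- ((1 - \<delta>) / (\<delta> * r0))) *\<^sub>R v))"
    unfolding kerD_def abs_mult using bump_mass(2) by (intro mult_mono bump_deriv_bound) auto
  then show ?thesis by (simp add: mult.assoc)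
qed

lemma kerD_continuous [continuous_intros]:
  "continuous_on A f \<Longrightarrow> continuous_on A g \<Longrightarrow> continuous_on A (\<lambda>y. kerD \<delta> (f y) v (g y))"
  unfolding kerD_def by (intro continuous_intros)

lemma kerD_integrable:
  fixes f :: "real^2 \<Rightarrow> complex"
  shows "integrable M f \<Longrightarrow> integrable M (\<lambda>\<zeta>. kerD \<delta> x v \<zeta> *\<^sub>R f \<zeta>)"
  by (rule integrable_bounded_times[OF _ _ kerD_bound])
     (auto intro!: continuous_measurable_lebesgue_on continuous_intros)

lemma kerD_linear:
  "kerD \<delta> x (v + w) \<zeta> = kerD \<delta> x v \<zeta> + kerD \<delta> x w \<zeta>"
  "kerD \<delta> x (t *\<^sub>R v) \<zeta> = t * kerD \<delta> x v \<zeta>"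
  by (simp_all add: kerD_def bump_deriv_def inner_add algebra_simps add_divide_distrib)

text \<open>The kernel has a quadratic Taylor remainder that is uniform in \<open>\<zeta>\<close>;
  integrated against \<open>f\<close> it gives a quadratic remainder for
  \<open>moll\<close>.\<close>

lemma moll_has_derivative:
  assumes f: "integrable M f" and \<delta>: "0 < \<delta>"
  shows "(moll \<delta> f has_derivative (\<lambda>v. \<integral>\<zeta>. kerD \<delta> x v \<zeta> *\<^sub>R f \<zeta> \<partial>M)) (at x)"
proof -
  define a where "a = 1 / (bump_mass * (\<delta> * r0)\<^sup>2)"
  define b where "b = - ((1 - \<delta>) / (\<delta> * r0))"
  define K where "K = (\<integral>\<zeta>. norm (f \<zeta>) \<partial>M)"
  have a0: "0 \<le> a" using bump_mass(2) by (simp add: a_def)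
  have K0: "0 \<le> K" by (simp add: K_def)
  have fn: "integrable M (\<lambda>\<zeta>. norm (f \<zeta>))" using f by simp
  have bound: "norm (\<integral>\<zeta>. k \<zeta> *\<^sub>R f \<zeta> \<partial>M) \<le> B * K"
    if "integrable M (\<lambda>\<zeta>. k \<zeta> *\<^sub>R f \<zeta>)" "\<And>\<zeta>. \<zeta> \<in> \<Omega> \<Longrightarrow> \<bar>k \<zeta>\<bar> \<le> B" for k B
  proof -
    have "norm (\<integral>\<zeta>. k \<zeta> *\<^sub>R f \<zeta> \<partial>M) \<le> (\<integral>\<zeta>. norm (k \<zeta> *\<^sub>R f \<zeta>) \<partial>M)"
      by (rule integral_norm_bound)
    also have "\<dots> \<le> (\<integral>\<zeta>. B * norm (f \<zeta>) \<partial>M)"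
      by (rule integral_mono[OF integrable_norm[OF that(1)]]) (use that(2) fn in \<open>auto intro!: mult_right_mono\<close>)
    finally show ?thesis by (simp add: K_def)
  qed
  obtain Rd where Rd: "\<And>y. y \<in> \<Omega> \<Longrightarrow> norm y \<le> Rd" using bounded_dom by (auto simp: bounded_iff)
  define R where "R = \<bar>1 / (\<delta> * r0)\<bar> * (Rd + norm ((1 - \<delta>) *\<^sub>R x + \<delta> *\<^sub>R z0))"
  have R: "norm (arg \<delta> x \<zeta>) \<le> R" if "\<zeta> \<in> \<Omega>" for \<zeta>
    unfolding arg_def R_def norm_scaleR
    by (intro mult_left_mono order_trans[OF norm_triangle_ineq4] add_right_mono Rd that) auto
  define C where "C = a * (((2 * R + 1)\<^sup>2 + 2) * b\<^sup>2)"
  \<comment> \<open>The restriction on \<open>v\<close> keeps the shift of \<open>arg\<close> within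
    the unit ball, where \<open>bump_remainder\<close> applies.\<close>
  have rem: "\<bar>ker \<delta> (x + v) \<zeta> - ker \<delta> x \<zeta> - kerD \<delta> x v \<zeta>\<bar> \<le> C * (norm v)\<^sup>2"
    if "\<zeta> \<in> \<Omega>" "norm v \<le> 1 / (\<bar>b\<bar> + 1)" for v \<zeta>
  proof -
    have sh: "arg \<delta> (x + v) \<zeta> = arg \<delta> x \<zeta> + b *\<^sub>R v"
      unfolding arg_alt b_def by (simp only: scaleR_add_right add.assoc)
    have "norm (b *\<^sub>R v) \<le> \<bar>b\<bar> * (1 / (\<bar>b\<bar> + 1))" using mult_left_mono[OF that(2), of "\<bar>b\<bar>"] by simp
    also have "\<dots> \<le> 1" by simp
    finally have "\<bar>bump (arg \<delta> x \<zeta> + b *\<^sub>R v) - bump (arg \<delta> x \<zeta>) - bump_deriv (arg \<delta> x \<zeta>) (b *\<^sub>R v)\<bar>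
        \<le> ((2 * R + 1)\<^sup>2 + 2) * (norm (b *\<^sub>R v))\<^sup>2"
      by (rule bump_remainder[OF R[OF that(1)]])
    from mult_left_mono[OF this a0] show ?thesis
      unfolding ker_def kerD_def sh a_def[symmetric] b_def[symmetric] right_diff_distrib[symmetric] abs_mult
      using a0 by (simp add: C_def power_mult_distrib mult.assoc)
  qed
  show ?thesis
  proof (rule has_derivativeI_quadratic)
    show "bounded_linear (\<lambda>v. \<integral>\<zeta>. kerD \<delta> x v \<zeta> *\<^sub>R f \<zeta> \<partial>M)"
    proof (rule bounded_linear_intro)
      show "(\<integral>\<zeta>. kerD \<delta> x (v + w) \<zeta> *\<^sub>R f \<zeta> \<partial>M)
          = (\<integral>\<zeta>. kerD \<delta> x v \<zeta> *\<^sub>R f \<zeta> \<partial>M) + (\<integral>\<zeta>. kerD \<delta> x w \<zeta> *\<^sub>R f \<zeta> \<partial>M)" for v w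
        using kerD_integrable[OF f] by (simp add: kerD_linear scaleR_add_left)
      show "(\<integral>\<zeta>. kerD \<delta> x (t *\<^sub>R v) \<zeta> *\<^sub>R f \<zeta> \<partial>M) = t *\<^sub>R (\<integral>\<zeta>. kerD \<delta> x v \<zeta> *\<^sub>R f \<zeta> \<partial>M)" for t v
        by (simp add: kerD_linear flip: scaleR_scaleR)
      show "norm (\<integral>\<zeta>. kerD \<delta> x v \<zeta> *\<^sub>R f \<zeta> \<partial>M)
          \<le> norm v * (1 / (bump_mass * (\<delta> * r0)\<^sup>2) * (4 * \<bar>(1 - \<delta>) / (\<delta> * r0)\<bar>) * K)" for v
        using bound[OF kerD_integrable[OF f] kerD_bound, of \<delta> x v] by (simp add: ac_simps)
    qed
    show "0 < 1 / (\<bar>b\<bar> + 1)" by simp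
    show "0 \<le> C * K" using a0 K0 by (simp add: C_def)
    fix v :: "real^2" assume v: "norm v \<le> 1 / (\<bar>b\<bar> + 1)"
    have eq: "moll \<delta> f (x + v) - moll \<delta> f x - (\<integral>\<zeta>. kerD \<delta> x v \<zeta> *\<^sub>R f \<zeta> \<partial>M)
       = (\<integral>\<zeta>. (ker \<delta> (x + v) \<zeta> - ker \<delta> x \<zeta> - kerD \<delta> x v \<zeta>) *\<^sub>R f \<zeta> \<partial>M)"
      unfolding moll_def using moll_integrable[OF f] kerD_integrable[OF f]
      by (simp add: scaleR_diff_left)
    have "integrable M (\<lambda>\<zeta>. (ker \<delta> (x + v) \<zeta> - ker \<delta> x \<zeta> - kerD \<delta> x v \<zeta>) *\<^sub>R f \<zeta>)"
      unfolding scaleR_diff_left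
      by (intro Bochner_Integration.integrable_diff moll_integrable kerD_integrable f)
    from bound[OF this rem[OF _ v]]
    show "norm (moll \<delta> f (x + v) - moll \<delta> f x - (\<integral>\<zeta>. kerD \<delta> x v \<zeta> *\<^sub>R f \<zeta> \<partial>M)) \<le> C * K * (norm v)\<^sup>2"
      unfolding eq by (simp add: ac_simps)
  qed
qed

lemma moll_C1:
  assumes f: "integrable M f" and \<delta>: "0 < \<delta>"
  shows "moll \<delta> f \<in> C1"
proof (rule C1I[OF moll_has_derivative[OF assms]])
  fix i :: 2
  show "continuous_on UNIV (\<lambda>x. \<integral>\<zeta>. kerD \<delta> x (axis i 1) \<zeta> *\<^sub>R f \<zeta> \<partial>M)"
    unfolding continuous_on_sequentially
  proof (intro allI ballI impI)
    fix X :: "nat \<Rightarrow> real^2" and x assume "(\<forall>n. X n \<in> UNIV) \<and> X \<longlonglongrightarrow> x"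
    then have X: "X \<longlonglongrightarrow> x" by simp
    let ?B = "1 / (bump_mass * (\<delta> * r0)\<^sup>2) * (4 * \<bar>(1 - \<delta>) / (\<delta> * r0)\<bar>) * norm (axis i 1 :: real^2)"
    have "(\<lambda>n. \<integral>\<zeta>. kerD \<delta> (X n) (axis i 1) \<zeta> *\<^sub>R f \<zeta> \<partial>M) \<longlonglongrightarrow> (\<integral>\<zeta>. kerD \<delta> x (axis i 1) \<zeta> *\<^sub>R f \<zeta> \<partial>M)"
    proof (rule integral_dominated_convergence[where w="\<lambda>\<zeta>. ?B * norm (f \<zeta>)"])
      show "AE \<zeta> in M. (\<lambda>n. kerD \<delta> (X n) (axis i 1) \<zeta> *\<^sub>R f \<zeta>) \<longlonglongrightarrow> kerD \<delta> x (axis i 1) \<zeta> *\<^sub>R f \<zeta>"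
      proof (intro AE_I2 tendsto_scaleR tendsto_const)
        fix \<zeta>
        have "continuous_on UNIV (\<lambda>y. kerD \<delta> y (axis i 1) \<zeta>)" by (intro continuous_intros)
        then show "(\<lambda>n. kerD \<delta> (X n) (axis i 1) \<zeta>) \<longlonglongrightarrow> kerD \<delta> x (axis i 1) \<zeta>"
          by (rule continuous_on_tendsto_compose[OF _ X]) auto
      qed
      show "AE \<zeta> in M. norm (kerD \<delta> (X n) (axis i 1) \<zeta> *\<^sub>R f \<zeta>) \<le> ?B * norm (f \<zeta>)" for n
        unfolding norm_scaleR by (intro AE_I2 mult_right_mono kerD_bound) simp
    qed (use f kerD_integrable[OF f] in \<open>auto intro: borel_measurable_integrable\<close>)
    then show "((\<lambda>x. \<integral>\<zeta>. kerD \<delta> x (axis i 1) \<zeta> *\<^sub>R f \<zeta> \<partial>M) \<circ> X) \<longlonglongrightarrow> (\<integral>\<zeta>. kerD \<delta> x (axis i 1) \<zeta> *\<^sub>R f \<zeta> \<partial>M)"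
      by (simp add: o_def)
  qed
qed

text \<open>Since \<open>arg\<close> is affine in both variables, the two derivatives of the kernel
  are proportional. This and the compact support allow the kernel itself to be the test function in
  the definition of the weak gradient.\<close>

lemma ker_test_function:
  assumes \<delta>: "0 < \<delta>" "\<delta> < 1" and x: "x \<in> \<Omega>"
  shows "ker \<delta> x \<in> C1_compact \<Omega>"
    and "kerD \<delta> x (axis i 1) \<zeta> = - (1 - \<delta>) * partial_deriv i (ker \<delta> x) \<zeta>"
proof -
  let ?D = "\<lambda>\<zeta> v. 1 / (bump_mass * (\<delta> * r0)\<^sup>2) * bump_deriv (arg \<delta> x \<zeta>) ((1 / (\<delta> * r0)) *\<^sub>R v)"
  have a: "(arg \<delta> x has_derivative (\<lambda>v. (1 / (\<delta> * r0)) *\<^sub>R v)) (at \<zeta>)" for \<zeta>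
    unfolding arg_def by (auto intro!: derivative_eq_intros)
  have D: "(ker \<delta> x has_derivative ?D \<zeta>) (at \<zeta>)" for \<zeta>
    unfolding ker_def[abs_def]
    by (intro has_derivative_mult_right has_derivative_compose[OF a has_derivative_bump])
  have "ker \<delta> x \<in> C1"
    by (rule C1I[OF D]) (intro continuous_intros)
  moreover have "compact ((\<lambda>y. (1 - \<delta>) *\<^sub>R x + \<delta> *\<^sub>R y) ` cball z0 r0)"
    by (intro compact_continuous_image continuous_intros) simp
  moreover have "(\<lambda>y. (1 - \<delta>) *\<^sub>R x + \<delta> *\<^sub>R y) ` cball z0 r0 \<subseteq> \<Omega>"
    using convexD[OF convex_dom x] ball_sub \<delta> by auto
  moreover have "\<zeta> \<in> (\<lambda>y. (1 - \<delta>) *\<^sub>R x + \<delta> *\<^sub>R y) ` cball z0 r0" if "ker \<delta> x \<zeta> \<noteq> 0" for \<zeta>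
    using ker_support[OF x \<delta>, of \<zeta>] ker_eq_0[of \<delta> x \<zeta>] that by (metis image_eqI linear)
  ultimately show "ker \<delta> x \<in> C1_compact \<Omega>" unfolding C1_compact_def by blast
  show "kerD \<delta> x (axis i 1) \<zeta> = - (1 - \<delta>) * partial_deriv i (ker \<delta> x) \<zeta>"
    unfolding partial_derivI[OF D] kerD_def by (simp add: bump_deriv_def field_simps)
qed

text \<open>The derivative passes from \<open>x\<close> to \<open>\<zeta>\<close> on the kernel, and
  from the kernel to \<open>f\<close> by the definition of the weak gradient. The factor
  \<open>1 - \<delta>\<close> comes from the contraction; the identity is exact up to the
  boundary.\<close>

lemma moll_weak_gradient:
  assumes f: "integrable M f" and wg: "weak_gradient \<Omega> f G" and \<delta>: "0 < \<delta>" "\<delta> < 1" and x: "x \<in> \<Omega>"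
  shows "partial_deriv i (moll \<delta> f) x = of_real (1 - \<delta>) * moll \<delta> (\<lambda>\<zeta>. G \<zeta> $ i) x"
proof -
  have "partial_deriv i (moll \<delta> f) x = (\<integral>\<zeta>. kerD \<delta> x (axis i 1) \<zeta> *\<^sub>R f \<zeta> \<partial>M)"
    by (rule partial_derivI[OF moll_has_derivative[OF f \<delta>(1)]])
  also have "\<dots> = (\<integral>\<zeta>. (- (1 - \<delta>)) *\<^sub>R (partial_deriv i (ker \<delta> x) \<zeta> *\<^sub>R f \<zeta>) \<partial>M)"
    by (simp only: ker_test_function(2)[OF \<delta> x] scaleR_scaleR)
  also have "\<dots> = (- (1 - \<delta>)) *\<^sub>R (\<integral>\<zeta>. partial_deriv i (ker \<delta> x) \<zeta> *\<^sub>R f \<zeta> \<partial>M)"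
    by (rule integral_scaleR_right)
  also have "(\<integral>\<zeta>. partial_deriv i (ker \<delta> x) \<zeta> *\<^sub>R f \<zeta> \<partial>M) = - (\<integral>\<zeta>. ker \<delta> x \<zeta> *\<^sub>R (G \<zeta> $ i) \<partial>M)"
    using wg ker_test_function(1)[OF \<delta> x] unfolding weak_gradient_def by blast
  finally show ?thesis unfolding moll_def scaleR_conv_of_real by (simp add: minus_mult_left del: mult_minus_left)
qed


lemma moll_measurable: "integrable M f \<Longrightarrow> 0 < \<delta> \<Longrightarrow> moll \<delta> f \<in> borel_measurable M"
  by (intro continuous_measurable_lebesgue_on C1_continuous moll_C1)

text \<open>Schur's test: the kernel has bounded integral in each variable.\<close>

lemma moll_L2:
  assumes f: "f \<in> L2 M" and \<delta>: "0 < \<delta>" "\<delta> < 1"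
  shows "moll \<delta> f \<in> L2 M" "L2norm M (moll \<delta> f) \<le> 1 / (1 - \<delta>) * L2norm M f"
proof -
  have [measurable]: "f \<in> borel_measurable M" using f by (rule L2D)
  have [measurable]: "ker \<delta> x \<in> borel_measurable M" for x by (rule ker_measurable)
  have fi: "integrable M f" by (rule L2_integrable[OF f])
  have pt: "ennreal ((norm (moll \<delta> f x))\<^sup>2) \<le> (\<integral>\<^sup>+\<zeta>. ennreal (ker \<delta> x \<zeta>) * ennreal ((norm (f \<zeta>))\<^sup>2) \<partial>M)"
    if x: "x \<in> \<Omega>" for x
  proof -
    have "ennreal (norm (moll \<delta> f x)) \<le> (\<integral>\<^sup>+\<zeta>. ennreal (norm (ker \<delta> x \<zeta> *\<^sub>R f \<zeta>)) \<partial>M)"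
      unfolding moll_def by (rule integral_norm_bound_ennreal[OF moll_integrable[OF fi]])
    \<comment> \<open>Splitting the kernel into two square roots prepares Cauchy-Schwarz; the factor
      without \<open>f\<close> has integral one.\<close>
    also have "\<dots> = (\<integral>\<^sup>+\<zeta>. ennreal (sqrt (ker \<delta> x \<zeta>)) * ennreal (sqrt (ker \<delta> x \<zeta>) * norm (f \<zeta>)) \<partial>M)"
      by (intro nn_integral_cong) (simp add: ennreal_mult[symmetric] mult.assoc[symmetric])
    finally have "(ennreal (norm (moll \<delta> f x)))\<^sup>2 \<le>
        (\<integral>\<^sup>+\<zeta>. ennreal (sqrt (ker \<delta> x \<zeta>)) * ennreal (sqrt (ker \<delta> x \<zeta>) * norm (f \<zeta>)) \<partial>M)\<^sup>2"
      by (rule power_mono) simp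
    also have "\<dots> \<le> (\<integral>\<^sup>+\<zeta>. (ennreal (sqrt (ker \<delta> x \<zeta>)))\<^sup>2 \<partial>M) *
        (\<integral>\<^sup>+\<zeta>. (ennreal (sqrt (ker \<delta> x \<zeta>) * norm (f \<zeta>)))\<^sup>2 \<partial>M)"
      by (rule Cauchy_Schwarz_nn_integral) measurable
    also have "\<dots> = (\<integral>\<^sup>+\<zeta>. ennreal (ker \<delta> x \<zeta>) \<partial>M) * (\<integral>\<^sup>+\<zeta>. ennreal (ker \<delta> x \<zeta>) * ennreal ((norm (f \<zeta>))\<^sup>2) \<partial>M)"
      by (simp add: ennreal_power power_mult_distrib ennreal_mult)
    finally show ?thesis using ker_nn_integral(1)[OF \<delta> x] by (simp add: ennreal_power)
  qed
  have km: "(\<lambda>(x, \<zeta>). ennreal (ker \<delta> x \<zeta>) * ennreal ((norm (f \<zeta>))\<^sup>2)) \<in> borel_measurable (M \<Otimes>\<^sub>M M)"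
    using ker_measurable_pair[of \<delta>] by measurable
  have "(\<integral>\<^sup>+x. ennreal ((norm (moll \<delta> f x))\<^sup>2) \<partial>M)
      \<le> (\<integral>\<^sup>+x. (\<integral>\<^sup>+\<zeta>. ennreal (ker \<delta> x \<zeta>) * ennreal ((norm (f \<zeta>))\<^sup>2) \<partial>M) \<partial>M)"
    by (intro nn_integral_mono pt) simp
  also have "\<dots> = (\<integral>\<^sup>+\<zeta>. (\<integral>\<^sup>+x. ennreal (ker \<delta> x \<zeta>) * ennreal ((norm (f \<zeta>))\<^sup>2) \<partial>M) \<partial>M)"
    by (rule MM.Fubini'[OF km, symmetric])
  also have "\<dots> \<le> (\<integral>\<^sup>+\<zeta>. ennreal (1 / (1 - \<delta>)\<^sup>2) * ennreal ((norm (f \<zeta>))\<^sup>2) \<partial>M)"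
  proof (rule nn_integral_mono)
    fix \<zeta>
    have "(\<lambda>x. ennreal (ker \<delta> x \<zeta>)) \<in> borel_measurable M"
      by (intro measurable_compose[OF _ measurable_ennreal] ker_measurable)
    then have "(\<integral>\<^sup>+x. ennreal (ker \<delta> x \<zeta>) * ennreal ((norm (f \<zeta>))\<^sup>2) \<partial>M)
       = (\<integral>\<^sup>+x. ennreal (ker \<delta> x \<zeta>) \<partial>M) * ennreal ((norm (f \<zeta>))\<^sup>2)"
      by (rule nn_integral_multc)
    also have "\<dots> \<le> ennreal (1 / (1 - \<delta>)\<^sup>2) * ennreal ((norm (f \<zeta>))\<^sup>2)"
      by (intro mult_right_mono ker_nn_integral(2) \<delta>) simp
    finally show "(\<integral>\<^sup>+x. ennreal (ker \<delta> x \<zeta>) * ennreal ((norm (f \<zeta>))\<^sup>2) \<partial>M)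
      \<le> ennreal (1 / (1 - \<delta>)\<^sup>2) * ennreal ((norm (f \<zeta>))\<^sup>2)" .
  qed
  also have "\<dots> = ennreal (1 / (1 - \<delta>)\<^sup>2) * ennreal ((L2norm M f)\<^sup>2)"
    by (subst nn_integral_cmult) (auto simp: nn_integral_L2[OF f])
  also have "\<dots> = ennreal ((1 / (1 - \<delta>) * L2norm M f)\<^sup>2)"
    by (simp add: ennreal_mult[symmetric] power_divide)
  finally have "(\<integral>\<^sup>+x. ennreal ((norm (moll \<delta> f x))\<^sup>2) \<partial>M) \<le> ennreal ((1 / (1 - \<delta>) * L2norm M f)\<^sup>2)" .
  from L2_of_nn_integral[OF moll_measurable[OF fi \<delta>(1)] this]
  show "moll \<delta> f \<in> L2 M" "L2norm M (moll \<delta> f) \<le> 1 / (1 - \<delta>) * L2norm M f"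
    using \<delta> by auto
qed

lemma moll_diff: "integrable M f \<Longrightarrow> integrable M g \<Longrightarrow> moll \<delta> (\<lambda>x. f x - g x) x = moll \<delta> f x - moll \<delta> g x"
  unfolding moll_def using moll_integrable[of f] moll_integrable[of g] by (simp add: scaleR_diff_right)

text \<open>The kernel averages with mass one over points at distance at most
  \<open>\<delta> * D\<close> from \<open>x\<close>, where \<open>D\<close> bounds the diameter.
  Uniform continuity on the compact closure does the rest.\<close>

lemma moll_continuous_tendsto:
  assumes g: "continuous_on UNIV g" and "0 < \<epsilon>"
  obtains d where "0 < d" "\<And>\<delta> x. 0 < \<delta> \<Longrightarrow> \<delta> < d \<Longrightarrow> \<delta> < 1 \<Longrightarrow> x \<in> \<Omega> \<Longrightarrow> norm (moll \<delta> g x - g x) \<le> \<epsilon>"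
proof -
  have "compact (closure \<Omega>)" using bounded_dom by (simp add: compact_closure)
  then have "uniformly_continuous_on (closure \<Omega>) g"
    by (intro compact_uniformly_continuous continuous_on_subset[OF g]) auto
  then obtain \<eta> where \<eta>: "0 < \<eta>"
      "\<And>x y. x \<in> closure \<Omega> \<Longrightarrow> y \<in> closure \<Omega> \<Longrightarrow> dist y x < \<eta> \<Longrightarrow> dist (g y) (g x) < \<epsilon>"
    unfolding uniformly_continuous_on_def using \<open>0 < \<epsilon>\<close> by metis
  obtain D where D: "0 < D" "\<And>x y. x \<in> \<Omega> \<Longrightarrow> y \<in> \<Omega> \<Longrightarrow> dist x y \<le> D"
    using bounded_dom unfolding bounded_two_points by (metis less_add_one max.strict_coboundedI1 max_def le_less_trans linear not_less)
  obtain B where B: "\<And>x. x \<in> \<Omega> \<Longrightarrow> norm (g x) \<le> B"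
  proof -
    have "bounded (g ` closure \<Omega>)"
      by (intro compact_imp_bounded compact_continuous_image continuous_on_subset[OF g] \<open>compact (closure \<Omega>)\<close>) auto
    then show ?thesis using that closure_subset[of \<Omega>] unfolding bounded_iff by blast
  qed
  have gi: "integrable M g"
    by (rule integrable_const_bound[of _ B]) (use B continuous_measurable_lebesgue_on[OF g] in auto)
  show ?thesis
  proof (rule that[of "\<eta> / D"])
    show "0 < \<eta> / D" using \<eta> D by simp
    fix \<delta> x assume \<delta>: "0 < \<delta>" "\<delta> < \<eta> / D" "\<delta> < 1" and x: "x \<in> \<Omega>"
    have close: "ker \<delta> x \<zeta> * norm (g \<zeta> - g x) \<le> ker \<delta> x \<zeta> * \<epsilon>" for \<zeta>
    proof (cases "norm (arg \<delta> x \<zeta>) \<le> 1")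
      case True
      obtain y where y: "y \<in> cball z0 r0" "\<zeta> = (1 - \<delta>) *\<^sub>R x + \<delta> *\<^sub>R y" "\<zeta> \<in> \<Omega>"
        by (rule ker_support[OF x \<delta>(1,3) True])
      have "dist \<zeta> x = norm (\<delta> *\<^sub>R (y - x))" unfolding y(2) dist_norm by (simp add: algebra_simps)
      also have "\<dots> \<le> \<delta> * D" using D(2)[of y x] y(1) ball_sub x \<delta>(1) by (auto simp: dist_norm intro!: mult_left_mono)
      also have "\<dots> < \<eta>" using \<delta>(2) D(1) by (simp add: pos_less_divide_eq)
      finally have "dist (g \<zeta>) (g x) < \<epsilon>" using \<eta>(2)[of x \<zeta>] x y(3) closure_subset[of \<Omega>] by auto
      then show ?thesis by (intro mult_left_mono) (auto simp: dist_norm)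
    qed (simp add: ker_eq_0)
    have "g x = (\<integral>\<zeta>. ker \<delta> x \<zeta> *\<^sub>R g x \<partial>M)"
      using ker_integral[OF \<delta>(1,3) x] by simp
    then have "moll \<delta> g x - g x = (\<integral>\<zeta>. ker \<delta> x \<zeta> *\<^sub>R g \<zeta> \<partial>M) - (\<integral>\<zeta>. ker \<delta> x \<zeta> *\<^sub>R g x \<partial>M)"
      by (simp add: moll_def)
    also have "\<dots> = (\<integral>\<zeta>. ker \<delta> x \<zeta> *\<^sub>R (g \<zeta> - g x) \<partial>M)"
      using moll_integrable[OF gi] ker_integral(1)[OF \<delta>(1,3) x] by (simp add: scaleR_diff_right)
    also have "norm \<dots> \<le> (\<integral>\<zeta>. norm (ker \<delta> x \<zeta> *\<^sub>R (g \<zeta> - g x)) \<partial>M)"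
      by (rule integral_norm_bound)
    also have "\<dots> \<le> (\<integral>\<zeta>. ker \<delta> x \<zeta> * \<epsilon> \<partial>M)"
    proof (rule integral_mono)
      show "integrable M (\<lambda>\<zeta>. norm (ker \<delta> x \<zeta> *\<^sub>R (g \<zeta> - g x)))"
        by (intro integrable_norm moll_integrable Bochner_Integration.integrable_diff gi) simp
    qed (use close ker_integral(1)[OF \<delta>(1,3) x] in auto)
    also have "\<dots> = \<epsilon>" using ker_integral[OF \<delta>(1,3) x] by simp
    finally show "norm (moll \<delta> g x - g x) \<le> \<epsilon>" .
  qed
qed

text \<open>The shift by 2 keeps the parameter at most \<open>1 / 2\<close>, so the norm bound
  \<open>1 / (1 - \<delta>)\<close> of the mollification is at most 2.\<close>

definition mseq :: "nat \<Rightarrow> real" where "mseq n = 1 / (real n + 2)"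

lemma mseq: "0 < mseq n" "mseq n < 1" "mseq n \<le> 1 / 2" "mseq \<longlonglongrightarrow> 0"
proof -
  show "0 < mseq n" "mseq n < 1" "mseq n \<le> 1 / 2" by (auto simp: mseq_def divide_simps)
  have "(\<lambda>n. 1 / real (n + 2)) \<longlonglongrightarrow> 0" by (rule LIMSEQ_ignore_initial_segment[OF lim_1_over_n])
  then show "mseq \<longlonglongrightarrow> 0" by (simp add: mseq_def[abs_def] add.commute)
qed

text \<open>Along \<open>mseq\<close> the mollifications have norm at most 2, so convergence on the
  dense continuous functions suffices. The errors are twice \<open>\<epsilon> / 6\<close> for the
  mollified difference, \<open>\<epsilon> / 4\<close> for the continuous function and
  \<open>\<epsilon> / 6\<close> for the difference itself.\<close>

lemma moll_tendsto:
  assumes f: "f \<in> L2 M"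
  shows "(\<lambda>n. L2norm M (\<lambda>x. moll (mseq n) f x - f x)) \<longlonglongrightarrow> 0"
proof (rule LIMSEQ_I)
  fix \<epsilon> :: real assume "0 < \<epsilon>"
  define \<mu> where "\<mu> = measure M (space M)"
  obtain g B where g: "continuous_on UNIV g" "\<And>x. norm (g x) \<le> B" "L2norm M (\<lambda>x. f x - g x) < \<epsilon> / 6"
    using L2_continuous_dense[OF f lmeas, of "\<epsilon> / 6"] \<open>0 < \<epsilon>\<close> by auto
  have gm: "g \<in> borel_measurable M" by (rule continuous_measurable_lebesgue_on[OF g(1)])
  have g2: "g \<in> L2 M" by (rule L2_bounded[OF gm]) (use g(2) in auto)
  have "0 < \<epsilon> / (4 * (sqrt \<mu> + 1))" using \<open>0 < \<epsilon>\<close> by (simp add: \<mu>_def add_nonneg_pos)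
  then obtain d where d: "0 < d"
    "\<And>\<delta> x. 0 < \<delta> \<Longrightarrow> \<delta> < d \<Longrightarrow> \<delta> < 1 \<Longrightarrow> x \<in> \<Omega> \<Longrightarrow> norm (moll \<delta> g x - g x) \<le> \<epsilon> / (4 * (sqrt \<mu> + 1))"
    using moll_continuous_tendsto[OF g(1)] by metis
  obtain n0 where n0: "\<And>n. n0 \<le> n \<Longrightarrow> mseq n < d"
    using order_tendstoD(2)[OF mseq(4) d(1)] unfolding eventually_sequentially by auto
  show "\<exists>n0. \<forall>n\<ge>n0. norm (L2norm M (\<lambda>x. moll (mseq n) f x - f x) - 0) < \<epsilon>"
  proof (intro exI[of _ n0] allI impI)
    fix n assume "n0 \<le> n"
    let ?\<delta> = "mseq n"
    have \<delta>: "0 < ?\<delta>" "?\<delta> < 1" "?\<delta> < d" using mseq n0 \<open>n0 \<le> n\<close> by auto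
    have fi: "integrable M f" "integrable M g" using f g2 by (auto intro: L2_integrable)
    have fg: "(\<lambda>x. f x - g x) \<in> L2 M" by (rule L2_diff[OF f g2])
    have m2: "moll ?\<delta> (\<lambda>x. f x - g x) \<in> L2 M" "moll ?\<delta> g \<in> L2 M"
      using moll_L2(1)[OF _ \<delta>(1,2)] fg g2 by auto
    have mg: "(\<lambda>x. moll ?\<delta> g x - g x) \<in> L2 M" by (rule L2_diff[OF m2(2) g2])
    have "L2norm M (\<lambda>x. moll ?\<delta> f x - f x) =
        L2norm M (\<lambda>x. moll ?\<delta> (\<lambda>x. f x - g x) x + ((moll ?\<delta> g x - g x) - (f x - g x)))"
      by (simp add: moll_diff[OF fi])
    also have "\<dots> \<le> L2norm M (moll ?\<delta> (\<lambda>x. f x - g x)) + L2norm M (\<lambda>x. (moll ?\<delta> g x - g x) - (f x - g x))"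
      by (intro L2norm_triangle m2 L2_diff mg fg)
    also have "\<dots> \<le> L2norm M (moll ?\<delta> (\<lambda>x. f x - g x))
        + (L2norm M (\<lambda>x. moll ?\<delta> g x - g x) + L2norm M (\<lambda>x. f x - g x))"
      by (intro add_left_mono L2norm_triangle_diff mg fg)
    also have "L2norm M (moll ?\<delta> (\<lambda>x. f x - g x)) \<le> 2 * L2norm M (\<lambda>x. f x - g x)"
    proof -
      have "1 / (1 - ?\<delta>) \<le> 2" using mseq(3)[of n] by (simp add: divide_le_eq)
      then have "1 / (1 - ?\<delta>) * L2norm M (\<lambda>x. f x - g x) \<le> 2 * L2norm M (\<lambda>x. f x - g x)"
        by (rule mult_right_mono) simp
      then show ?thesis using moll_L2(2)[OF fg \<delta>(1,2)] by linarith
    qed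
    also have "L2norm M (\<lambda>x. moll ?\<delta> g x - g x) \<le> \<epsilon> / (4 * (sqrt \<mu> + 1)) * sqrt \<mu>"
      unfolding \<mu>_def
    proof (rule L2norm_bounded)
      show "(\<lambda>x. moll ?\<delta> g x - g x) \<in> borel_measurable M" using mg by (rule L2D)
      show "AE x in M. norm (moll ?\<delta> g x - g x) \<le> \<epsilon> / (4 * (sqrt (measure M (space M)) + 1))"
        using d(2)[OF \<delta>(1,3,2)] by (intro AE_I2) (auto simp: \<mu>_def)
    qed (use \<open>0 < \<epsilon>\<close> in \<open>auto simp: add_nonneg_pos\<close>)
    also have "\<epsilon> / (4 * (sqrt \<mu> + 1)) * sqrt \<mu> \<le> \<epsilon> / 4"
    proof -
      have "0 \<le> sqrt \<mu>" by (simp add: \<mu>_def)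
      then have "sqrt \<mu> / (sqrt \<mu> + 1) \<le> 1" by (intro divide_le_eq_1[THEN iffD2] disjI1) linarith
      from mult_left_mono[OF this, of "\<epsilon> / 4"] show ?thesis using \<open>0 < \<epsilon>\<close> by simp
    qed
    finally show "norm (L2norm M (\<lambda>x. moll ?\<delta> f x - f x) - 0) < \<epsilon>" using g(3) \<open>0 < \<epsilon>\<close> by simp
  qed
qed

end

subsection \<open>Weak gradients\<close>

text \<open>The complement of \<open>K\<close> is open and \<open>\<phi>\<close> is zero on it, so
  its derivatives vanish there too.\<close>

lemma C1_compactD:
  assumes "\<phi> \<in> C1_compact S"
  obtains K where "compact K" "K \<subseteq> S" "\<And>x. x \<notin> K \<Longrightarrow> \<phi> x = 0" "\<And>x i. x \<notin> K \<Longrightarrow> partial_deriv i \<phi> x = 0" "\<phi> \<in> C1"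
proof -
  from assms obtain K where K: "compact K" "K \<subseteq> S" "\<And>x. x \<notin> K \<Longrightarrow> \<phi> x = 0" and "\<phi> \<in> C1"
    unfolding C1_compact_def by auto
  have "partial_deriv i \<phi> x = 0" if "x \<notin> K" for x i
  proof -
    have "((\<lambda>_. 0) has_derivative (\<lambda>_. 0)) (at x)" by simp
    then have "(\<phi> has_derivative (\<lambda>_. 0)) (at x)"
      by (rule has_derivative_transform_within_open[of _ _ _ _ "- K"])
         (use K that compact_imp_closed in \<open>auto simp: open_Compl\<close>)
    then show ?thesis by (simp add: partial_derivI)
  qed
  with K \<open>\<phi> \<in> C1\<close> show ?thesis by (intro that) auto
qed

lemma C1_compact_bounded:
  assumes "\<phi> \<in> C1_compact S"
  obtains B where "\<And>x. norm (\<phi> x) \<le> B" "\<And>x i. norm (partial_deriv i \<phi> x) \<le> B" "0 \<le> B"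
proof -
  obtain K where K: "compact K" "\<And>x. x \<notin> K \<Longrightarrow> \<phi> x = 0" "\<And>x i. x \<notin> K \<Longrightarrow> partial_deriv i \<phi> x = 0" "\<phi> \<in> C1"
    using C1_compactD[OF assms] by metis
  have bd: "\<exists>B. \<forall>x. norm (f x) \<le> B" if "continuous_on K f" "\<And>x. x \<notin> K \<Longrightarrow> f x = 0" for f :: "real^2 \<Rightarrow> 'a"
  proof -
    have "bounded (f ` K)" using compact_continuous_image[OF that(1) K(1)] by (rule compact_imp_bounded)
    then obtain B where "0 < B" "\<And>x. x \<in> K \<Longrightarrow> norm (f x) \<le> B" by (auto simp: bounded_pos)
    then show ?thesis using that(2) by (metis less_imp_le norm_zero)
  qed
  obtain B where B: "\<And>x. norm (\<phi> x) \<le> B" using bd[OF C1_continuous[OF K(4)] K(2)] by blast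
  have "\<forall>i. \<exists>B. \<forall>x. norm (partial_deriv i \<phi> x) \<le> B" using bd[OF C1_partial_continuous[OF K(4)] K(3)] by blast
  then obtain C where C: "\<And>x i. norm (partial_deriv i \<phi> x) \<le> C i" by metis
  show ?thesis
  proof (rule that[of "\<bar>B\<bar> + (\<Sum>i\<in>UNIV. \<bar>C i\<bar>)"])
    fix x i
    have s: "0 \<le> (\<Sum>i\<in>UNIV. \<bar>C i\<bar>)" "\<bar>C i\<bar> \<le> (\<Sum>i\<in>UNIV. \<bar>C i\<bar>)" by (auto intro: member_le_sum)
    show "norm (\<phi> x) \<le> \<bar>B\<bar> + (\<Sum>i\<in>UNIV. \<bar>C i\<bar>)" using B[of x] s by linarith
    show "norm (partial_deriv i \<phi> x) \<le> \<bar>B\<bar> + (\<Sum>i\<in>UNIV. \<bar>C i\<bar>)" using C[of i x] s by linarith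
  qed (auto intro!: add_nonneg_nonneg sum_nonneg)
qed

lemma tendsto_difference_quotient:
  assumes D: "(f has_derivative D) (at x)" and t: "t \<longlonglongrightarrow> 0" "\<And>n. 0 < (t n :: real)" and v: "v \<noteq> 0"
  shows "(\<lambda>n. (1 / t n) *\<^sub>R (f (x + t n *\<^sub>R v) - f x)) \<longlonglongrightarrow> D v"
proof -
  have lim: "(\<lambda>h. norm (f (x + h) - f x - D h) / norm h) \<midarrow>0\<rightarrow> 0"
    and lin: "bounded_linear D" using D by (auto simp: has_derivative_at)
  have "filterlim (\<lambda>n. t n *\<^sub>R v) (at 0) sequentially"
    unfolding filterlim_at using t v by (auto intro!: tendsto_eq_intros simp: less_imp_neq[symmetric])
  from filterlim_compose[OF lim this]
  have "(\<lambda>n. norm v * (norm (f (x + t n *\<^sub>R v) - f x - D (t n *\<^sub>R v)) / norm (t n *\<^sub>R v))) \<longlonglongrightarrow> 0"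
    by (rule tendsto_mult_right_zero)
  moreover have "norm v * (norm (f (x + t n *\<^sub>R v) - f x - D (t n *\<^sub>R v)) / norm (t n *\<^sub>R v))
      = norm ((1 / t n) *\<^sub>R (f (x + t n *\<^sub>R v) - f x) - D v)" for n
  proof -
    have "(1 / t n) *\<^sub>R (f (x + t n *\<^sub>R v) - f x) - D v = (1 / t n) *\<^sub>R (f (x + t n *\<^sub>R v) - f x - D (t n *\<^sub>R v))"
      using t(2)[of n] linear_scale[OF bounded_linear.linear[OF lin]] by (simp add: scaleR_diff_right)
    then show ?thesis using t(2)[of n] v by simp
  qed
  ultimately have "(\<lambda>n. norm ((1 / t n) *\<^sub>R (f (x + t n *\<^sub>R v) - f x) - D v)) \<longlonglongrightarrow> 0" by simp
  then show ?thesis by (simp add: tendsto_norm_zero_iff LIM_zero_iff)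
qed

text \<open>The difference quotients of \<open>g\<close> have integral zero by translation invariance.\<close>

lemma integral_partial_deriv_eq_0:
  fixes g :: "real^2 \<Rightarrow> complex"
  assumes g: "g \<in> C1_compact S"
  shows "integrable lborel (partial_deriv i g)" "(\<integral>x. partial_deriv i g x \<partial>lborel) = 0"
proof -
  obtain K where K: "compact K" "\<And>x. x \<notin> K \<Longrightarrow> g x = 0" "\<And>x i. x \<notin> K \<Longrightarrow> partial_deriv i g x = 0" and g1: "g \<in> C1"
    using C1_compactD[OF g] by metis
  obtain B where B: "\<And>x. norm (g x) \<le> B" "\<And>x i. norm (partial_deriv i g x) \<le> B" "0 \<le> B"
    using C1_compact_bounded[OF g] by metis
  obtain R where R: "\<And>x. x \<in> K \<Longrightarrow> norm x \<le> R" using compact_imp_bounded[OF K(1)] by (auto simp: bounded_iff)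
  \<comment> \<open>The margin 1 accommodates all shifts by \<open>t n\<close>, so one indicator
    dominates every difference quotient.\<close>
  let ?C = "cball (0::real^2) (R + 1)"
  have ind: "integrable lborel (\<lambda>x. B * indicator ?C x)"
    using emeasure_lborel_cball_finite[of "0::real^2" "R + 1"] by (intro integrable_mult_right integrable_real_indicator) auto
  have gm: "g \<in> borel_measurable borel" "partial_deriv i g \<in> borel_measurable borel"
    by (intro borel_measurable_continuous_onI C1_continuous C1_partial_continuous g1)+
  have bnd: "norm (g x) \<le> norm (B * indicator ?C x)" "norm (partial_deriv i g x) \<le> norm (B * indicator ?C x)" for x
  proof -
    have "x \<notin> K" if "x \<notin> ?C" using R[of x] that by auto
    then show "norm (g x) \<le> norm (B * indicator ?C x)" "norm (partial_deriv i g x) \<le> norm (B * indicator ?C x)"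
      using K(2,3) B by (cases "x \<in> ?C"; simp)+
  qed
  have gi: "integrable lborel g"
    by (rule Bochner_Integration.integrable_bound[OF ind]) (use gm bnd(1) in auto)
  show "integrable lborel (partial_deriv i g)"
    by (rule Bochner_Integration.integrable_bound[OF ind]) (use gm bnd(2) in auto)
  define e where "e = (axis i 1 :: real^2)"
  have ne: "norm e = 1" "e \<noteq> 0" by (auto simp: e_def norm_axis_1 axis_eq_0_iff)
  define t where "t n = 1 / real (Suc n)" for n
  have t: "t \<longlonglongrightarrow> 0" "\<And>n. 0 < t n" "\<And>n. t n \<le> 1"
    unfolding t_def using LIMSEQ_inverse_real_of_nat by (auto simp: inverse_eq_divide)
  define q where "q n x = (1 / t n) *\<^sub>R (g (x + t n *\<^sub>R e) - g x)" for n x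
  have trans: "integrable lborel (\<lambda>x. g (x + c)) \<and> (\<integral>x. g (x + c) \<partial>lborel) = (\<integral>x. g x \<partial>lborel)" for c
  proof -
    have "integrable (distr lborel borel ((+) c)) g" using gi by (simp add: lborel_distr_plus)
    moreover have "(\<integral>x. g x \<partial>distr lborel borel ((+) c)) = (\<integral>x. g x \<partial>lborel)" by (simp add: lborel_distr_plus)
    ultimately show ?thesis
      using gm by (subst (asm) integrable_distr_eq, simp_all, subst (asm) integral_distr, simp_all add: add.commute)
  qed
  have q0: "(\<integral>x. q n x \<partial>lborel) = 0" for n
    unfolding q_def using trans gi by simp
  have qlim: "(\<lambda>n. q n x) \<longlonglongrightarrow> partial_deriv i g x" for x
    unfolding q_def partial_deriv_def e_def[symmetric]
    by (rule tendsto_difference_quotient[OF C1_has_derivative[OF g1] t(1,2) ne(2)])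
  \<comment> \<open>Inside the ball this is the mean value inequality along \<open>e\<close>;
    outside it, both points of the quotient lie off \<open>K\<close>.\<close>
  have qb: "norm (q n x) \<le> B * indicator ?C x" for n x
  proof (cases "x \<in> ?C")
    case True
    have "norm (g (x + t n *\<^sub>R e) - g (x + 0 *\<^sub>R e)) \<le> B * norm (t n - 0)"
    proof (rule differentiable_bound[of "{0..t n}" "\<lambda>s. g (x + s *\<^sub>R e)" "\<lambda>s u. u *\<^sub>R partial_deriv i g (x + s *\<^sub>R e)"])
      fix s :: real
      let ?D = "frechet_derivative g (at (x + s *\<^sub>R e))"
      have "((\<lambda>s. g (x + s *\<^sub>R e)) has_derivative (\<lambda>u. ?D (u *\<^sub>R e))) (at s)"
        by (rule has_derivative_compose[of "\<lambda>s. x + s *\<^sub>R e" _ s UNIV g ?D]) (auto intro!: derivative_eq_intros C1_has_derivative[OF g1])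
      moreover have "?D (u *\<^sub>R e) = u *\<^sub>R partial_deriv i g (x + s *\<^sub>R e)" for u
        unfolding partial_deriv_def e_def
        by (rule linear_scale[OF has_derivative_linear[OF C1_has_derivative[OF g1]]])
      ultimately show "((\<lambda>s. g (x + s *\<^sub>R e)) has_derivative (\<lambda>u. u *\<^sub>R partial_deriv i g (x + s *\<^sub>R e))) (at s within {0..t n})"
        by (simp add: has_derivative_at_withinI)
      show "onorm (\<lambda>u. u *\<^sub>R partial_deriv i g (x + s *\<^sub>R e)) \<le> B"
        by (rule onorm_le) (simp add: mult.commute[of B] mult_left_mono B)
    qed (use t(2)[of n] in auto)
    then have "norm (q n x) \<le> 1 / t n * (B * t n)"
      unfolding q_def norm_scaleR using t(2)[of n] by (intro mult_mono) auto
    then show ?thesis using True t(2)[of n] by simp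
  next
    case False
    then have "x \<notin> K" using R by fastforce
    moreover have "x + t n *\<^sub>R e \<notin> K"
    proof
      assume "x + t n *\<^sub>R e \<in> K"
      then have "norm (x + t n *\<^sub>R e) \<le> R" by (rule R)
      moreover have "norm x \<le> norm (x + t n *\<^sub>R e) + norm (t n *\<^sub>R e)"
        using norm_triangle_ineq4[of "x + t n *\<^sub>R e" "t n *\<^sub>R e"] by simp
      ultimately show False using False t(2)[of n] t(3)[of n] ne by simp
    qed
    ultimately have "q n x = 0" by (simp add: q_def K(2))
    then show ?thesis using B(3) by simp
  qed
  have "(\<lambda>n. \<integral>x. q n x \<partial>lborel) \<longlonglongrightarrow> (\<integral>x. partial_deriv i g x \<partial>lborel)"
  proof (rule integral_dominated_convergence[OF _ _ ind])
    show "(\<lambda>x. q n x) \<in> borel_measurable lborel" for n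
      unfolding q_def using gm(1) by measurable
  qed (use gm qlim qb in auto)
  then show "(\<integral>x. partial_deriv i g x \<partial>lborel) = 0" by (simp add: q0 LIMSEQ_const_iff)
qed

lemma integral_lebesgue_on_vanishing:
  fixes f :: "'n::euclidean_space \<Rightarrow> 'b::{banach,second_countable_topology}"
  assumes "open S" "f \<in> borel_measurable borel" "\<And>x. x \<notin> S \<Longrightarrow> f x = 0"
  shows "(\<integral>x. f x \<partial>lebesgue_on S) = (\<integral>x. f x \<partial>lborel)"
proof -
  have "(\<integral>x. f x \<partial>lebesgue_on S) = (\<integral>x. indicator S x *\<^sub>R f x \<partial>lebesgue)"
    using assms(1) by (subst integral_restrict_space) auto
  also have "\<dots> = (\<integral>x. f x \<partial>lebesgue)"
    using assms(3) by (intro Bochner_Integration.integral_cong) (auto simp: indicator_def)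
  also have "\<dots> = (\<integral>x. f x \<partial>lborel)" using assms(2) by (intro integral_completion) simp
  finally show ?thesis .
qed

definition cgrad :: "(real^2 \<Rightarrow> complex) \<Rightarrow> real^2 \<Rightarrow> complex^2" where
  "cgrad f x = (\<chi> i. partial_deriv i f x)"

lemma norm_scale_vec: "norm (c *s (v :: complex^2)) = norm c * norm v"
  by (simp add: norm_vec_def L2_set_def norm_mult power_mult_distrib flip: sum_distrib_left)
     (simp add: real_sqrt_mult)

lemma continuous_on_cgrad: "f \<in> C1 \<Longrightarrow> continuous_on A (cgrad f)"
  unfolding cgrad_def by (intro continuous_on_vec_lambda C1_partial_continuous)

lemma L2_component:
  fixes G :: "'a \<Rightarrow> complex^2"
  assumes "G \<in> L2 N"
  shows "(\<lambda>x. G x $ i) \<in> L2 N"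
proof (rule L2_dominated[OF assms, where C=1])
  show "(\<lambda>x. G x $ i) \<in> borel_measurable N"
    using L2D(1)[OF assms] by (rule measurable_compose) (intro borel_measurable_continuous_onI continuous_intros)
qed (simp add: Finite_Cartesian_Product.norm_nth_le)

lemma L2_scale_vec:
  fixes G :: "'a \<Rightarrow> complex^2"
  assumes "G \<in> L2 N"
  shows "(\<lambda>x. c *s G x) \<in> L2 N"
proof (rule L2_dominated[OF assms, where C="norm c"])
  have "continuous_on UNIV (\<lambda>v::complex^2. c *s v)"
    unfolding vector_scalar_mult_def
    by (intro continuous_on_vec_lambda continuous_on_mult_left continuous_on_component continuous_on_id)
  from measurable_compose[OF L2D(1)[OF assms] borel_measurable_continuous_onI[OF this]]
  show "(\<lambda>x. c *s G x) \<in> borel_measurable N" .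
qed (simp add: norm_scale_vec)

lemma L2norm_scale_vec: "L2norm N (\<lambda>x. c *s (G x :: complex^2)) = norm c * L2norm N G"
  by (simp add: L2norm_def norm_scale_vec power_mult_distrib real_sqrt_mult)

lemma L2norm_vec_le:
  fixes G :: "'a \<Rightarrow> complex^2"
  assumes "G \<in> L2 N"
  shows "L2norm N G \<le> (\<Sum>i\<in>UNIV. L2norm N (\<lambda>x. G x $ i))"
proof -
  have "(L2norm N G)\<^sup>2 = (\<Sum>i\<in>UNIV. (L2norm N (\<lambda>x. G x $ i))\<^sup>2)"
    using L2_component[OF assms] unfolding L2norm_sq
    by (subst Bochner_Integration.integral_sum[symmetric]) (auto simp: L2D norm_vec_def L2_set_def sum_nonneg)
  also have "\<dots> \<le> (\<Sum>i\<in>UNIV. L2norm N (\<lambda>x. G x $ i))\<^sup>2"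
    by (simp add: sum_2 power2_sum)
  finally show ?thesis by (rule power2_le_imp_le) (simp add: sum_nonneg)
qed

context convex_domain
begin

lemma test_integrable:
  fixes f :: "real^2 \<Rightarrow> complex" and \<phi> :: "real^2 \<Rightarrow> real"
  assumes "\<phi> \<in> C1_compact \<Omega>" "integrable M f"
  shows "integrable M (\<lambda>x. \<phi> x *\<^sub>R f x)" "integrable M (\<lambda>x. partial_deriv i \<phi> x *\<^sub>R f x)"
proof -
  obtain B where B: "\<And>x. norm (\<phi> x) \<le> B" "\<And>x i. norm (partial_deriv i \<phi> x) \<le> B"
    using C1_compact_bounded[OF assms(1)] by metis
  have "\<phi> \<in> C1" using assms(1) by (simp add: C1_compact_def)
  then show "integrable M (\<lambda>x. \<phi> x *\<^sub>R f x)" "integrable M (\<lambda>x. partial_deriv i \<phi> x *\<^sub>R f x)"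
    using B by (auto intro!: integrable_bounded_times[OF assms(2)] continuous_measurable_lebesgue_on C1_continuous C1_partial_continuous)
qed

text \<open>Testing with the kernels shows that the mollifications of each component of the
  difference vanish on the whole domain. They converge to that component in norm, so it is
  null.\<close>

lemma weak_gradient_unique:
  assumes G: "weak_gradient \<Omega> y G" "G \<in> L2 M" and K: "weak_gradient \<Omega> y K" "K \<in> L2 M"
  shows "AE x in M. G x = K x"
proof -
  have "AE x in M. G x $ i - K x $ i = 0" for i
  proof -
    let ?h = "\<lambda>x. G x $ i - K x $ i"
    have Gi: "(\<lambda>x. G x $ i) \<in> L2 M" "(\<lambda>x. K x $ i) \<in> L2 M" using G K L2_component by auto
    have h: "?h \<in> L2 M" by (intro L2_diff Gi)
    have "moll (mseq n) ?h x = 0" if "x \<in> \<Omega>" for n x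
    proof -
      let ?\<phi> = "ker (mseq n) x"
      have "(\<integral>x. partial_deriv i ?\<phi> x *\<^sub>R y x \<partial>M) = - (\<integral>x. ?\<phi> x *\<^sub>R G x $ i \<partial>M)"
        "(\<integral>x. partial_deriv i ?\<phi> x *\<^sub>R y x \<partial>M) = - (\<integral>x. ?\<phi> x *\<^sub>R K x $ i \<partial>M)"
        using G(1) K(1) ker_test_function(1)[OF mseq(1,2) that] unfolding weak_gradient_def by blast+
      then have "moll (mseq n) (\<lambda>x. G x $ i) x = moll (mseq n) (\<lambda>x. K x $ i) x"
        by (simp only: moll_def neg_equal_iff_equal)
      then show ?thesis by (simp add: moll_diff[OF L2_integrable[OF Gi(1)] L2_integrable[OF Gi(2)]])
    qed
    then have "(\<integral>x. (norm (moll (mseq n) ?h x - ?h x))\<^sup>2 \<partial>M) = (\<integral>x. (norm (?h x))\<^sup>2 \<partial>M)" for n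
      by (intro Bochner_Integration.integral_cong) (simp_all add: norm_minus_commute)
    then have "L2norm M (\<lambda>x. moll (mseq n) ?h x - ?h x) = L2norm M ?h" for n
      by (simp only: L2norm_def)
    then have "L2norm M ?h = 0" using moll_tendsto[OF h] by (simp add: LIMSEQ_const_iff)
    then show ?thesis using L2norm_eq_0_iff[OF h] by simp
  qed
  then have "AE x in M. \<forall>i. G x $ i - K x $ i = 0" by (simp add: AE_all_countable)
  then show ?thesis by eventually_elim (simp add: vec_eq_iff)
qed

lemma H1D:
  assumes "y \<in> H1 \<Omega>"
  shows "y \<in> L2 M" "wgrad \<Omega> y \<in> L2 M" "weak_gradient \<Omega> y (wgrad \<Omega> y)"
proof -
  show "y \<in> L2 M" using assms by (simp add: H1_def)
  have "\<exists>G. G \<in> L2 M \<and> weak_gradient \<Omega> y G" using assms by (auto simp: H1_def)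
  from someI_ex[OF this] show "wgrad \<Omega> y \<in> L2 M" "weak_gradient \<Omega> y (wgrad \<Omega> y)"
    by (auto simp: wgrad_def)
qed

text \<open>\<open>wgrad\<close> is an arbitrary choice; by uniqueness any weak gradient known
  explicitly may replace it up to null sets.\<close>

lemma H1I:
  assumes "y \<in> L2 M" "G \<in> L2 M" "weak_gradient \<Omega> y G"
  shows "y \<in> H1 \<Omega>" "AE x in M. wgrad \<Omega> y x = G x"
proof -
  show "y \<in> H1 \<Omega>" using assms by (auto simp: H1_def)
  then show "AE x in M. wgrad \<Omega> y x = G x" using weak_gradient_unique H1D assms by blast
qed

lemma weak_gradient_add_scale:
  assumes "y \<in> L2 M" "z \<in> L2 M" "G \<in> L2 M" "K \<in> L2 M" "weak_gradient \<Omega> y G" "weak_gradient \<Omega> z K"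
  shows "weak_gradient \<Omega> (\<lambda>x. y x + c * z x) (\<lambda>x. G x + c *s K x)"
  unfolding weak_gradient_def
proof (intro ballI allI)
  fix \<phi> :: "real^2 \<Rightarrow> real" and i assume \<phi>: "\<phi> \<in> C1_compact \<Omega>"
  note i1 = test_integrable(2)[OF \<phi> L2_integrable[OF assms(1)]] test_integrable(2)[OF \<phi> L2_integrable[OF assms(2)]]
  note i2 = test_integrable(1)[OF \<phi> L2_integrable[OF L2_component[OF assms(3)]]]
    test_integrable(1)[OF \<phi> L2_integrable[OF L2_component[OF assms(4)]]]
  have "(\<integral>x. partial_deriv i \<phi> x *\<^sub>R (y x + c * z x) \<partial>M)
      = (\<integral>x. partial_deriv i \<phi> x *\<^sub>R y x + c * (partial_deriv i \<phi> x *\<^sub>R z x) \<partial>M)"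
    by (simp add: scaleR_add_right)
  also have "\<dots> = (\<integral>x. partial_deriv i \<phi> x *\<^sub>R y x \<partial>M) + c * (\<integral>x. partial_deriv i \<phi> x *\<^sub>R z x \<partial>M)"
    using i1 by (subst Bochner_Integration.integral_add) (auto intro!: integrable_mult_right simp del: mult_scaleR_right)
  also have "\<dots> = - ((\<integral>x. \<phi> x *\<^sub>R G x $ i \<partial>M) + c * (\<integral>x. \<phi> x *\<^sub>R K x $ i \<partial>M))"
    using assms(5,6) \<phi> unfolding weak_gradient_def by (simp add: algebra_simps)
  also have "(\<integral>x. \<phi> x *\<^sub>R G x $ i \<partial>M) + c * (\<integral>x. \<phi> x *\<^sub>R K x $ i \<partial>M)
      = (\<integral>x. \<phi> x *\<^sub>R G x $ i + c * (\<phi> x *\<^sub>R K x $ i) \<partial>M)"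
    using i2 by (subst Bochner_Integration.integral_add) (auto intro!: integrable_mult_right simp del: mult_scaleR_right)
  also have "\<dots> = (\<integral>x. \<phi> x *\<^sub>R (G x + c *s K x) $ i \<partial>M)"
    by (simp add: scaleR_add_right)
  finally show "(\<integral>x. partial_deriv i \<phi> x *\<^sub>R (y x + c * z x) \<partial>M) = - (\<integral>x. \<phi> x *\<^sub>R (G x + c *s K x) $ i \<partial>M)" .
qed

lemma H1_add_scale:
  assumes "y \<in> H1 \<Omega>" "z \<in> H1 \<Omega>"
  shows "(\<lambda>x. y x + c * z x) \<in> H1 \<Omega>"
    and "AE x in M. wgrad \<Omega> (\<lambda>x. y x + c * z x) x = wgrad \<Omega> y x + c *s wgrad \<Omega> z x"
proof -
  note y = H1D[OF assms(1)] and z = H1D[OF assms(2)]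
  note * = H1I[OF L2_add[OF y(1) L2_scaleC[OF z(1)]] L2_add[OF y(2) L2_scale_vec[OF z(2)]]
      weak_gradient_add_scale[OF y(1) z(1) y(2) z(2) y(3) z(3)]]
  show "(\<lambda>x. y x + c * z x) \<in> H1 \<Omega>" by (rule *(1))
  show "AE x in M. wgrad \<Omega> (\<lambda>x. y x + c * z x) x = wgrad \<Omega> y x + c *s wgrad \<Omega> z x"
    by (rule *(2))
qed

lemma H1_diff:
  assumes "y \<in> H1 \<Omega>" "z \<in> H1 \<Omega>"
  shows "(\<lambda>x. y x - z x) \<in> H1 \<Omega>" "AE x in M. wgrad \<Omega> (\<lambda>x. y x - z x) x = wgrad \<Omega> y x - wgrad \<Omega> z x"
  using H1_add_scale[OF assms, of "-1"] by (simp_all add: vector_scalar_mult_def vec_eq_iff)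

lemma continuous_L2:
  fixes h :: "real^2 \<Rightarrow> 'b::{banach,second_countable_topology}"
  assumes "continuous_on UNIV h"
  shows "h \<in> L2 M"
proof -
  have "bounded (h ` closure \<Omega>)" using bounded_dom
    by (intro compact_imp_bounded compact_continuous_image continuous_on_subset[OF assms]) (auto simp: compact_closure)
  then obtain B where "\<And>x. x \<in> \<Omega> \<Longrightarrow> norm (h x) \<le> B" using closure_subset[of \<Omega>] unfolding bounded_iff by blast
  then show ?thesis using continuous_measurable_lebesgue_on[OF assms] by (intro L2_bounded[of _ B]) auto
qed

text \<open>Integration by parts: the product of \<open>f\<close> with a test function has compact
  support, so its partial derivative integrates to zero, and the product rule splits that
  integral.\<close>

lemma weak_gradient_C1:
  assumes f: "f \<in> C1"
  shows "weak_gradient \<Omega> f (cgrad f)"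
  unfolding weak_gradient_def
proof (intro ballI allI)
  fix \<phi> :: "real^2 \<Rightarrow> real" and i assume \<phi>: "\<phi> \<in> C1_compact \<Omega>"
  obtain K where K: "compact K" "K \<subseteq> \<Omega>" "\<And>x. x \<notin> K \<Longrightarrow> \<phi> x = 0"
    "\<And>x i. x \<notin> K \<Longrightarrow> partial_deriv i \<phi> x = 0" and \<phi>1: "\<phi> \<in> C1"
    using C1_compactD[OF \<phi>] by metis
  let ?g = "\<lambda>x. \<phi> x *\<^sub>R f x"
  let ?D = "\<lambda>x v. frechet_derivative \<phi> (at x) v *\<^sub>R f x + \<phi> x *\<^sub>R frechet_derivative f (at x) v"
  have D: "(?g has_derivative ?D x) (at x)" for x
    using has_derivative_scaleR[OF C1_has_derivative[OF \<phi>1, of x] C1_has_derivative[OF f, of x]]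
    by (simp add: add.commute)
  have pd: "partial_deriv j ?g x = partial_deriv j \<phi> x *\<^sub>R f x + \<phi> x *\<^sub>R partial_deriv j f x" for j x
    using partial_derivI[OF D] by (simp add: partial_deriv_def)
  have g1: "?g \<in> C1"
  proof (rule C1I[OF D])
    fix j :: 2
    have "continuous_on UNIV (\<lambda>x. partial_deriv j \<phi> x *\<^sub>R f x + \<phi> x *\<^sub>R partial_deriv j f x)"
      by (intro continuous_intros C1_continuous C1_partial_continuous \<phi>1 f)
    then show "continuous_on UNIV (\<lambda>x. ?D x (axis j 1))" by (simp add: partial_deriv_def)
  qed
  then have g: "?g \<in> C1_compact \<Omega>"
    using K unfolding C1_compact_def by (auto intro!: exI[of _ K])
  have b: "\<And>x. x \<notin> \<Omega> \<Longrightarrow> \<phi> x = 0" "\<And>x i. x \<notin> \<Omega> \<Longrightarrow> partial_deriv i \<phi> x = 0" using K by auto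
  have meas: "(\<lambda>x. partial_deriv i \<phi> x *\<^sub>R f x) \<in> borel_measurable borel"
    "(\<lambda>x. \<phi> x *\<^sub>R partial_deriv i f x) \<in> borel_measurable borel"
    by (intro borel_measurable_continuous_onI continuous_intros C1_continuous C1_partial_continuous \<phi>1 f)+
  have hi: "integrable M h" if "continuous_on UNIV h" for h :: "real^2 \<Rightarrow> complex"
    by (rule L2_integrable[OF continuous_L2[OF that]])
  note ints = test_integrable(2)[OF \<phi> hi[OF C1_continuous[OF f]], of i]
    test_integrable(1)[OF \<phi> hi[OF C1_partial_continuous[OF f]], of i]
  have "(\<integral>x. partial_deriv i \<phi> x *\<^sub>R f x \<partial>M) + (\<integral>x. \<phi> x *\<^sub>R partial_deriv i f x \<partial>M)
      = (\<integral>x. partial_deriv i ?g x \<partial>M)"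
    unfolding pd using ints by simp
  also have "\<dots> = (\<integral>x. partial_deriv i ?g x \<partial>lborel)"
    using b by (intro integral_lebesgue_on_vanishing open_dom borel_measurable_continuous_onI C1_partial_continuous g1)
       (auto simp: pd)
  also have "\<dots> = 0" by (rule integral_partial_deriv_eq_0(2)[OF g])
  finally show "(\<integral>x. partial_deriv i \<phi> x *\<^sub>R f x \<partial>M) = - (\<integral>x. \<phi> x *\<^sub>R cgrad f x $ i \<partial>M)"
    by (simp add: cgrad_def eq_neg_iff_add_eq_0)
qed

lemma C1_H1:
  assumes "f \<in> C1"
  shows "f \<in> H1 \<Omega>" "AE x in M. wgrad \<Omega> f x = cgrad f x"
  using H1I[OF continuous_L2[OF C1_continuous[OF assms]] continuous_L2[OF continuous_on_cgrad[OF assms]]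
      weak_gradient_C1[OF assms]] .


text \<open>Pairing with a bounded function is continuous in the norm because the measure is finite.
  It carries the identity that defines weak gradients over to limits.\<close>

lemma L2_limit_integral:
  fixes f :: "nat \<Rightarrow> real^2 \<Rightarrow> complex"
  assumes f: "\<And>n. f n \<in> L2 M" "g \<in> L2 M" and lim: "(\<lambda>n. L2norm M (\<lambda>x. f n x - g x)) \<longlonglongrightarrow> 0"
    and k: "k \<in> borel_measurable M" "\<And>x. \<bar>k x\<bar> \<le> B"
  shows "(\<lambda>n. \<integral>x. k x *\<^sub>R f n x \<partial>M) \<longlonglongrightarrow> (\<integral>x. k x *\<^sub>R g x \<partial>M)"
proof (rule LIM_zero_cancel, rule Lim_null_comparison)
  have k2: "k \<in> L2 M" by (rule L2_bounded[OF k(1), of B]) (use k(2) in auto)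
  show "\<forall>\<^sub>F n in sequentially. norm ((\<integral>x. k x *\<^sub>R f n x \<partial>M) - (\<integral>x. k x *\<^sub>R g x \<partial>M))
      \<le> L2norm M k * L2norm M (\<lambda>x. f n x - g x)"
  proof (intro always_eventually allI)
    fix n
    have d: "(\<lambda>x. f n x - g x) \<in> L2 M" by (intro L2_diff f)
    have "(\<integral>x. k x *\<^sub>R f n x \<partial>M) - (\<integral>x. k x *\<^sub>R g x \<partial>M) = (\<integral>x. k x *\<^sub>R (f n x - g x) \<partial>M)"
      using integrable_bounded_times[OF L2_integrable[OF f(1)] k] integrable_bounded_times[OF L2_integrable[OF f(2)] k]
      by (simp add: scaleR_diff_right)
    also have "norm \<dots> \<le> (\<integral>x. norm (k x *\<^sub>R (f n x - g x)) \<partial>M)" by (rule integral_norm_bound)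
    also have "\<dots> = (\<integral>x. norm (k x) * norm (f n x - g x) \<partial>M)" by simp
    also have "\<dots> \<le> L2norm M k * L2norm M (\<lambda>x. f n x - g x)" by (rule L2_Cauchy_Schwarz[OF k2 d])
    finally show "norm ((\<integral>x. k x *\<^sub>R f n x \<partial>M) - (\<integral>x. k x *\<^sub>R g x \<partial>M))
      \<le> L2norm M k * L2norm M (\<lambda>x. f n x - g x)" .
  qed
  show "(\<lambda>n. L2norm M k * L2norm M (\<lambda>x. f n x - g x)) \<longlonglongrightarrow> 0"
    by (rule tendsto_mult_right_zero[OF lim])
qed

subsection \<open>The space \<open>H\<^sup>1\<close>\<close>

lemma H1norm_nonneg [simp]: "0 \<le> H1norm \<Omega> y"
  by (simp add: H1norm_def)

lemma H1norm_sq: "(H1norm \<Omega> y)\<^sup>2 = (L2norm M y)\<^sup>2 + (L2norm M (wgrad \<Omega> y))\<^sup>2"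
  by (simp add: H1norm_def)

lemma L2norm_le_H1norm: "L2norm M y \<le> H1norm \<Omega> y" "L2norm M (wgrad \<Omega> y) \<le> H1norm \<Omega> y"
  unfolding H1norm_def by simp_all

lemma H1norm_le_sum: "H1norm \<Omega> y \<le> L2norm M y + L2norm M (wgrad \<Omega> y)"
  unfolding H1norm_def by (rule sqrt_sum_squares_le_sum) simp_all

lemma L2norm_wgrad:
  assumes "y \<in> L2 M" "G \<in> L2 M" "weak_gradient \<Omega> y G"
  shows "L2norm M (wgrad \<Omega> y) = L2norm M G"
  using H1I(2)[OF assms] assms(2) H1D(2)[OF H1I(1)[OF assms]] by (intro L2norm_cong_AE) (auto simp: L2D)

lemma L2norm_wgrad_add_scale:
  assumes "y \<in> H1 \<Omega>" "z \<in> H1 \<Omega>"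
  shows "L2norm M (wgrad \<Omega> (\<lambda>x. y x + c * z x)) = L2norm M (\<lambda>x. wgrad \<Omega> y x + c *s wgrad \<Omega> z x)"
  using H1_add_scale[OF assms, of c] assms
  by (intro L2norm_cong_AE L2D(1) L2_add L2_scale_vec H1D)

lemma L2norm_wgrad_diff:
  assumes "y \<in> H1 \<Omega>" "z \<in> H1 \<Omega>"
  shows "L2norm M (wgrad \<Omega> (\<lambda>x. y x - z x)) = L2norm M (\<lambda>x. wgrad \<Omega> y x - wgrad \<Omega> z x)"
  using H1_diff[OF assms] assms by (intro L2norm_cong_AE L2D(1) L2_diff H1D)

lemma H1norm_add_scale:
  assumes y: "y \<in> H1 \<Omega>" and z: "z \<in> H1 \<Omega>"
  shows "H1norm \<Omega> (\<lambda>x. y x + c * z x) \<le> H1norm \<Omega> y + norm c * H1norm \<Omega> z"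
proof -
  have 1: "L2norm M (\<lambda>x. y x + c * z x) \<le> L2norm M y + norm c * L2norm M z"
    using L2norm_triangle[OF H1D(1)[OF y] L2_scaleC[OF H1D(1)[OF z]]] by (simp add: L2norm_scaleC)
  have 2: "L2norm M (wgrad \<Omega> (\<lambda>x. y x + c * z x)) \<le> L2norm M (wgrad \<Omega> y) + norm c * L2norm M (wgrad \<Omega> z)"
    unfolding L2norm_wgrad_add_scale[OF y z]
    using L2norm_triangle[OF H1D(2)[OF y] L2_scale_vec[OF H1D(2)[OF z]]] by (simp add: L2norm_scale_vec)
  have "H1norm \<Omega> (\<lambda>x. y x + c * z x) \<le>
      sqrt ((L2norm M y + norm c * L2norm M z)\<^sup>2 + (L2norm M (wgrad \<Omega> y) + norm c * L2norm M (wgrad \<Omega> z))\<^sup>2)"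
    unfolding H1norm_def by (intro real_sqrt_le_mono add_mono power_mono 1 2) auto
  also have "\<dots> \<le> H1norm \<Omega> y + sqrt ((norm c * L2norm M z)\<^sup>2 + (norm c * L2norm M (wgrad \<Omega> z))\<^sup>2)"
    unfolding H1norm_def by (rule real_sqrt_sum_squares_triangle_ineq)
  also have "sqrt ((norm c * L2norm M z)\<^sup>2 + (norm c * L2norm M (wgrad \<Omega> z))\<^sup>2) = norm c * H1norm \<Omega> z"
    unfolding H1norm_def power_mult_distrib distrib_left[symmetric] real_sqrt_mult by simp
  finally show ?thesis by simp
qed

lemma H1norm_diff_le:
  assumes "y \<in> H1 \<Omega>" "z \<in> H1 \<Omega>"
  shows "H1norm \<Omega> (\<lambda>x. y x - z x) \<le> H1norm \<Omega> y + H1norm \<Omega> z"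
  using H1norm_add_scale[OF assms, of "-1"] by simp

lemma weak_gradient_limit:
  assumes X: "\<And>n. X n \<in> L2 M" "\<And>n. W n \<in> L2 M" "\<And>n. weak_gradient \<Omega> (X n) (W n)"
    and y: "y \<in> L2 M" "(\<lambda>n. L2norm M (\<lambda>x. X n x - y x)) \<longlonglongrightarrow> 0"
    and G: "G \<in> L2 M" "(\<lambda>n. L2norm M (\<lambda>x. W n x - G x)) \<longlonglongrightarrow> 0"
  shows "weak_gradient \<Omega> y G"
  unfolding weak_gradient_def
proof (intro ballI allI)
  fix \<phi> :: "real^2 \<Rightarrow> real" and i assume \<phi>: "\<phi> \<in> C1_compact \<Omega>"
  obtain B where B: "\<And>x. norm (\<phi> x) \<le> B" "\<And>x i. norm (partial_deriv i \<phi> x) \<le> B"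
    using C1_compact_bounded[OF \<phi>] by metis
  have \<phi>1: "\<phi> \<in> C1" using \<phi> by (simp add: C1_compact_def)
  have m: "\<phi> \<in> borel_measurable M" "partial_deriv i \<phi> \<in> borel_measurable M"
    by (intro continuous_measurable_lebesgue_on C1_continuous C1_partial_continuous \<phi>1)+
  have 1: "(\<lambda>n. \<integral>x. partial_deriv i \<phi> x *\<^sub>R X n x \<partial>M) \<longlonglongrightarrow> (\<integral>x. partial_deriv i \<phi> x *\<^sub>R y x \<partial>M)"
    by (rule L2_limit_integral[OF X(1) y m(2)]) (use B in auto)
  have "(\<lambda>n. L2norm M (\<lambda>x. W n x $ i - G x $ i)) \<longlonglongrightarrow> 0"
  proof (rule Lim_null_comparison[OF _ G(2)], intro always_eventually allI)
    fix n
    have "L2norm M (\<lambda>x. W n x $ i - G x $ i) \<le> 1 * L2norm M (\<lambda>x. W n x - G x)"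
      by (rule L2norm_le[OF L2_diff[OF X(2) G(1)]])
         (auto simp: Finite_Cartesian_Product.norm_nth_le simp flip: vector_minus_component)
    then show "norm (L2norm M (\<lambda>x. W n x $ i - G x $ i)) \<le> L2norm M (\<lambda>x. W n x - G x)" by simp
  qed
  then have 2: "(\<lambda>n. \<integral>x. \<phi> x *\<^sub>R (W n x $ i) \<partial>M) \<longlonglongrightarrow> (\<integral>x. \<phi> x *\<^sub>R (G x $ i) \<partial>M)"
    by (rule L2_limit_integral[OF L2_component[OF X(2)] L2_component[OF G(1)] _ m(1)]) (use B in auto)
  have "(\<integral>x. partial_deriv i \<phi> x *\<^sub>R X n x \<partial>M) = - (\<integral>x. \<phi> x *\<^sub>R (W n x $ i) \<partial>M)" for n
    using X(3) \<phi> unfolding weak_gradient_def by blast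
  with 1 tendsto_minus[OF 2] show "(\<integral>x. partial_deriv i \<phi> x *\<^sub>R y x \<partial>M) = - (\<integral>x. \<phi> x *\<^sub>R (G x $ i) \<partial>M)"
    by (simp add: LIMSEQ_unique)
qed

text \<open>Functions and gradients converge separately in \<open>L2\<close>, and the limits still
  belong together because taking the weak gradient is a closed operation.\<close>

lemma H1_complete:
  assumes X: "\<And>n. X n \<in> H1 \<Omega>"
    and cau: "\<And>e. 0 < e \<Longrightarrow> \<exists>N. \<forall>m\<ge>N. \<forall>n\<ge>N. H1norm \<Omega> (\<lambda>x. X m x - X n x) < e"
  obtains y where "y \<in> H1 \<Omega>" "(\<lambda>n. H1norm \<Omega> (\<lambda>x. X n x - y x)) \<longlonglongrightarrow> 0"
proof -
  note XD = H1D[OF X]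
  obtain y where y: "y \<in> L2 M" "(\<lambda>n. L2norm M (\<lambda>x. X n x - y x)) \<longlonglongrightarrow> 0"
  proof (rule L2_complete[OF XD(1)])
    fix e :: real assume "0 < e"
    then show "\<exists>N. \<forall>m\<ge>N. \<forall>n\<ge>N. L2norm M (\<lambda>x. X m x - X n x) < e"
      using cau L2norm_le_H1norm(1) by (meson le_less_trans)
  qed
  obtain G where G: "G \<in> L2 M" "(\<lambda>n. L2norm M (\<lambda>x. wgrad \<Omega> (X n) x - G x)) \<longlonglongrightarrow> 0"
  proof (rule L2_complete[OF XD(2)])
    fix e :: real assume "0 < e"
    then show "\<exists>N. \<forall>m\<ge>N. \<forall>n\<ge>N. L2norm M (\<lambda>x. wgrad \<Omega> (X m) x - wgrad \<Omega> (X n) x) < e"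
      using cau[of e] L2norm_le_H1norm(2) unfolding L2norm_wgrad_diff[OF X X, symmetric] by (meson le_less_trans)
  qed
  have wg: "weak_gradient \<Omega> y G" by (rule weak_gradient_limit[OF XD y G])
  note yH = H1I[OF y(1) G(1) wg]
  have "(\<lambda>n. H1norm \<Omega> (\<lambda>x. X n x - y x)) \<longlonglongrightarrow> 0"
  proof (rule Lim_null_comparison[OF _ tendsto_add_zero[OF y(2) G(2)]], intro always_eventually allI)
    fix n
    have "L2norm M (\<lambda>x. wgrad \<Omega> (X n) x - wgrad \<Omega> y x) = L2norm M (\<lambda>x. wgrad \<Omega> (X n) x - G x)"
      using yH(2) by (intro L2norm_cong_AE L2D(1) L2_diff XD(2) G(1) H1D(2)[OF yH(1)]) auto
    then show "norm (H1norm \<Omega> (\<lambda>x. X n x - y x))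
        \<le> L2norm M (\<lambda>x. X n x - y x) + L2norm M (\<lambda>x. wgrad \<Omega> (X n) x - G x)"
      using H1norm_le_sum[of "\<lambda>x. X n x - y x"] L2norm_wgrad_diff[OF X yH(1), of n] by simp
  qed
  with yH(1) show ?thesis by (rule that)
qed

text \<open>The gradient of a mollification is \<open>1 - \<delta>\<close> times the mollified
  gradient, exactly and on the whole domain. Beyond convergence in \<open>L2\<close>, only an error
  of size \<open>\<delta>\<close> times the norm of the gradient has to vanish.\<close>

lemma C1_dense_H1:
  assumes y: "y \<in> H1 \<Omega>"
  obtains f where "\<And>n. f n \<in> C1" "(\<lambda>n. H1norm \<Omega> (\<lambda>x. f n x - y x)) \<longlonglongrightarrow> 0"
proof -
  note yD = H1D[OF y]
  define f where "f n = moll (mseq n) y" for n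
  have yi: "integrable M y" by (rule L2_integrable[OF yD(1)])
  have fC: "f n \<in> C1" for n unfolding f_def by (rule moll_C1[OF yi mseq(1)])
  let ?G = "\<lambda>i x. wgrad \<Omega> y x $ i"
  have G2: "?G i \<in> L2 M" for i by (rule L2_component[OF yD(2)])
  have comp: "L2norm M (\<lambda>x. (cgrad (f n) x - wgrad \<Omega> y x) $ i)
      \<le> L2norm M (\<lambda>x. moll (mseq n) (?G i) x - ?G i x) + mseq n * L2norm M (?G i)" for n i
  proof -
    let ?\<delta> = "mseq n"
    have m2: "moll ?\<delta> (?G i) \<in> L2 M" by (rule moll_L2(1)[OF G2 mseq(1,2)])
    have "L2norm M (\<lambda>x. (cgrad (f n) x - wgrad \<Omega> y x) $ i)
        = L2norm M (\<lambda>x. of_real (1 - ?\<delta>) * (moll ?\<delta> (?G i) x - ?G i x) - of_real ?\<delta> * ?G i x)"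
      unfolding L2norm_def
      by (intro arg_cong[of _ _ sqrt] Bochner_Integration.integral_cong)
         (auto simp: cgrad_def f_def moll_weak_gradient[OF yi yD(3) mseq(1,2)] algebra_simps)
    also have "\<dots> \<le> L2norm M (\<lambda>x. of_real (1 - ?\<delta>) * (moll ?\<delta> (?G i) x - ?G i x))
        + L2norm M (\<lambda>x. of_real ?\<delta> * ?G i x)"
      by (intro L2norm_triangle_diff L2_scaleC L2_diff m2 G2)
    also have "\<dots> = (1 - ?\<delta>) * L2norm M (\<lambda>x. moll ?\<delta> (?G i) x - ?G i x) + ?\<delta> * L2norm M (?G i)"
      unfolding L2norm_scaleC norm_of_real using mseq(1,2)[of n] by simp
    also have "\<dots> \<le> 1 * L2norm M (\<lambda>x. moll ?\<delta> (?G i) x - ?G i x) + ?\<delta> * L2norm M (?G i)"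
      using mseq(1)[of n] by (intro add_right_mono mult_right_mono) auto
    finally show ?thesis by simp
  qed
  have "(\<lambda>n. H1norm \<Omega> (\<lambda>x. f n x - y x)) \<longlonglongrightarrow> 0"
  proof (rule Lim_null_comparison)
    show "\<forall>\<^sub>F n in sequentially. norm (H1norm \<Omega> (\<lambda>x. f n x - y x)) \<le> L2norm M (\<lambda>x. moll (mseq n) y x - y x)
        + (\<Sum>i\<in>UNIV. L2norm M (\<lambda>x. moll (mseq n) (?G i) x - ?G i x) + mseq n * L2norm M (?G i))"
    proof (intro always_eventually allI)
      fix n
      note fH = C1_H1[OF fC[of n]]
      have c2: "cgrad (f n) \<in> L2 M" by (rule continuous_L2[OF continuous_on_cgrad[OF fC]])
      have "L2norm M (wgrad \<Omega> (\<lambda>x. f n x - y x)) = L2norm M (\<lambda>x. wgrad \<Omega> (f n) x - wgrad \<Omega> y x)"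
        by (rule L2norm_wgrad_diff[OF fH(1) y])
      also have "\<dots> = L2norm M (\<lambda>x. cgrad (f n) x - wgrad \<Omega> y x)"
        using fH(2) by (intro L2norm_cong_AE L2D(1) L2_diff c2 yD(2) H1D(2)[OF fH(1)]) auto
      also have "\<dots> \<le> (\<Sum>i\<in>UNIV. L2norm M (\<lambda>x. (cgrad (f n) x - wgrad \<Omega> y x) $ i))"
        by (rule L2norm_vec_le[OF L2_diff[OF c2 yD(2)]])
      also have "\<dots> \<le> (\<Sum>i\<in>UNIV. L2norm M (\<lambda>x. moll (mseq n) (?G i) x - ?G i x) + mseq n * L2norm M (?G i))"
        by (intro sum_mono comp)
      finally show "norm (H1norm \<Omega> (\<lambda>x. f n x - y x)) \<le> L2norm M (\<lambda>x. moll (mseq n) y x - y x)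
        + (\<Sum>i\<in>UNIV. L2norm M (\<lambda>x. moll (mseq n) (?G i) x - ?G i x) + mseq n * L2norm M (?G i))"
        using H1norm_le_sum[of "\<lambda>x. f n x - y x"] by (simp add: f_def)
    qed
    show "(\<lambda>n. L2norm M (\<lambda>x. moll (mseq n) y x - y x)
        + (\<Sum>i\<in>UNIV. L2norm M (\<lambda>x. moll (mseq n) (?G i) x - ?G i x) + mseq n * L2norm M (?G i))) \<longlonglongrightarrow> 0"
      by (intro tendsto_add_zero tendsto_null_sum moll_tendsto yD(1) G2 tendsto_mult_left_zero mseq(4))
  qed
  with fC show ?thesis by (rule that)
qed

lemma grad_inner_eq:
  assumes "u \<in> H1 \<Omega>" "v \<in> H1 \<Omega>"
  shows "grad_inner \<Omega> u v = (\<Sum>i\<in>UNIV. L2inner M (\<lambda>x. wgrad \<Omega> u x $ i) (\<lambda>x. wgrad \<Omega> v x $ i))"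
  unfolding grad_inner_def L2inner_def
  by (intro Bochner_Integration.integral_sum L2inner_integrable L2_component H1D assms)

lemma grad_inner_commute: "grad_inner \<Omega> v u = cnj (grad_inner \<Omega> u v)"
  unfolding grad_inner_def by (subst Bochner_Integration.integral_cnj[symmetric]) (simp add: mult.commute)

lemma grad_inner_add_scale_left:
  assumes "u \<in> H1 \<Omega>" "v \<in> H1 \<Omega>" "z \<in> H1 \<Omega>"
  shows "grad_inner \<Omega> (\<lambda>x. u x + c * v x) z = grad_inner \<Omega> u z + c * grad_inner \<Omega> v z"
proof -
  note uD = H1D[OF assms(1)] and vD = H1D[OF assms(2)] and zD = H1D[OF assms(3)]
  note w = H1_add_scale[OF assms(1,2), of c]
  have "L2inner M (\<lambda>x. wgrad \<Omega> (\<lambda>x. u x + c * v x) x $ i) (\<lambda>x. wgrad \<Omega> z x $ i)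
      = L2inner M (\<lambda>x. wgrad \<Omega> u x $ i + c * wgrad \<Omega> v x $ i) (\<lambda>x. wgrad \<Omega> z x $ i)" for i
    using w(2) by (intro L2inner_cong_AE L2D(1) L2_component L2_add L2_scaleC uD(2) vD(2) zD(2) H1D(2)[OF w(1)]) auto
  also have "\<dots> i = L2inner M (\<lambda>x. wgrad \<Omega> u x $ i) (\<lambda>x. wgrad \<Omega> z x $ i)
      + c * L2inner M (\<lambda>x. wgrad \<Omega> v x $ i) (\<lambda>x. wgrad \<Omega> z x $ i)" for i
    by (intro L2inner_add_scale_left L2_component uD vD zD)
  finally show ?thesis
    unfolding grad_inner_eq[OF w(1) assms(3)] grad_inner_eq[OF assms(1,3)] grad_inner_eq[OF assms(2,3)]
    by (simp add: sum.distrib sum_distrib_left)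
qed

lemma grad_inner_self: "grad_inner \<Omega> u u = of_real ((L2norm M (wgrad \<Omega> u))\<^sup>2)"
proof -
  have "(\<Sum>i\<in>UNIV. z $ i * cnj (z $ i)) = complex_of_real ((norm z)\<^sup>2)" for z :: "complex^2"
    by (simp add: norm_vec_def L2_set_def complex_norm_square sum_nonneg flip: of_real_power)
  then show ?thesis unfolding grad_inner_def L2norm_sq by (simp only: integral_complex_of_real)
qed

lemma grad_inner_bound:
  assumes "u \<in> H1 \<Omega>" "v \<in> H1 \<Omega>"
  shows "norm (grad_inner \<Omega> u v) \<le> L2norm M (wgrad \<Omega> u) * L2norm M (wgrad \<Omega> v)"
proof -
  note uD = H1D[OF assms(1)] and vD = H1D[OF assms(2)]
  have "norm (\<Sum>i\<in>UNIV. a $ i * cnj (b $ i)) \<le> norm a * norm b" for a b :: "complex^2"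
  proof -
    have "norm (\<Sum>i\<in>UNIV. a $ i * cnj (b $ i)) \<le> (\<Sum>i\<in>UNIV. \<bar>norm (a $ i)\<bar> * \<bar>norm (b $ i)\<bar>)"
      by (rule order_trans[OF norm_sum]) (simp add: norm_mult)
    also have "\<dots> \<le> L2_set (\<lambda>i. norm (a $ i)) UNIV * L2_set (\<lambda>i. norm (b $ i)) UNIV"
      by (rule L2_set_mult_ineq)
    finally show ?thesis by (simp add: norm_vec_def)
  qed
  note pt = this
  have "norm (grad_inner \<Omega> u v) \<le> (\<integral>x. norm (\<Sum>i\<in>UNIV. wgrad \<Omega> u x $ i * cnj (wgrad \<Omega> v x $ i)) \<partial>M)"
    unfolding grad_inner_def by (rule integral_norm_bound)
  also have "\<dots> \<le> (\<integral>x. norm (wgrad \<Omega> u x) * norm (wgrad \<Omega> v x) \<partial>M)"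
    by (intro integral_mono integrable_norm Bochner_Integration.integrable_sum L2inner_integrable L2_component
        uD vD L2_integrable_product pt)
  also have "\<dots> \<le> L2norm M (wgrad \<Omega> u) * L2norm M (wgrad \<Omega> v)"
    by (rule L2_Cauchy_Schwarz[OF uD(2) vD(2)])
  finally show ?thesis .
qed

end

subsection \<open>Traces\<close>

text \<open>The boundary measure enters only through the trace inequality for \<open>C1\<close>
  functions; existence, uniqueness and linearity of traces follow from it by density.\<close>

locale trace_domain = convex_domain +
  fixes \<Gamma> :: "(real^2) measure" and Ct :: real
  assumes Ct_nonneg: "0 \<le> Ct"
    and trace_C1: "f \<in> C1 \<Longrightarrow> f \<in> L2 \<Gamma>" "f \<in> C1 \<Longrightarrow> L2norm \<Gamma> f \<le> Ct * H1norm \<Omega> (f :: real^2 \<Rightarrow> complex)"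
begin

abbreviation "is_tr \<equiv> is_bdry_trace \<Omega> \<Gamma>"
abbreviation "tr \<equiv> bdry_trace \<Omega> \<Gamma>"

lemma C1_add_scale:
  assumes "f \<in> C1" "g \<in> C1"
  shows "(\<lambda>x. f x + c * g x :: complex) \<in> C1"
proof (rule C1I)
  show "((\<lambda>x. f x + c * g x) has_derivative
      (\<lambda>v. frechet_derivative f (at x) v + c * frechet_derivative g (at x) v)) (at x)" for x
    by (intro has_derivative_add has_derivative_mult_right C1_has_derivative assms)
  show "continuous_on UNIV (\<lambda>x. frechet_derivative f (at x) (axis i 1) + c * frechet_derivative g (at x) (axis i 1))" for i
    using C1_partial_continuous[OF assms(1), of UNIV i] C1_partial_continuous[OF assms(2), of UNIV i]
    by (intro continuous_intros) (simp_all add: partial_deriv_def[abs_def])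
qed

lemma C1_diff: "f \<in> C1 \<Longrightarrow> g \<in> C1 \<Longrightarrow> (\<lambda>x. f x - g x :: complex) \<in> C1"
  using C1_add_scale[of f g "-1"] by simp

text \<open>The trace inequality survives the limit along any approximating sequence. As the bound
  depends on \<open>y\<close> alone, it also forces uniqueness.\<close>

lemma is_tr_bound:
  assumes y: "y \<in> H1 \<Omega>" and g: "is_tr y g"
  shows "L2norm \<Gamma> g \<le> Ct * H1norm \<Omega> y"
proof -
  from g obtain f where g2: "g \<in> L2 \<Gamma>" and f: "\<And>n. f n \<in> C1"
    and 1: "(\<lambda>n. H1norm \<Omega> (\<lambda>x. f n x - y x)) \<longlonglongrightarrow> 0" and 2: "(\<lambda>n. L2norm \<Gamma> (\<lambda>x. f n x - g x)) \<longlonglongrightarrow> 0"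
    unfolding is_bdry_trace_def by auto
  have "(\<lambda>n. L2norm \<Gamma> (\<lambda>x. f n x - g x) + Ct * (H1norm \<Omega> (\<lambda>x. f n x - y x) + H1norm \<Omega> y)) \<longlonglongrightarrow> 0 + Ct * (0 + H1norm \<Omega> y)"
    by (intro tendsto_intros 1 2)
  moreover have "L2norm \<Gamma> g \<le> L2norm \<Gamma> (\<lambda>x. f n x - g x) + Ct * (H1norm \<Omega> (\<lambda>x. f n x - y x) + H1norm \<Omega> y)" for n
  proof -
    have "L2norm \<Gamma> g \<le> L2norm \<Gamma> (\<lambda>x. g x - f n x) + L2norm \<Gamma> (f n)"
      by (rule L2norm_le_diff_add[OF g2 trace_C1(1)[OF f]])
    also have "L2norm \<Gamma> (f n) \<le> Ct * H1norm \<Omega> (f n)" by (rule trace_C1(2)[OF f])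
    also have "H1norm \<Omega> (f n) \<le> H1norm \<Omega> (\<lambda>x. f n x - y x) + H1norm \<Omega> y"
      using H1norm_add_scale[OF H1_diff(1)[OF C1_H1(1)[OF f] y] y, of n 1] by simp
    finally show ?thesis using Ct_nonneg by (simp add: L2norm_minus_commute[of \<Gamma> g] mult_left_mono)
  qed
  ultimately show ?thesis using LIMSEQ_le_const by fastforce
qed

lemma is_tr_add_scale:
  assumes y: "y \<in> H1 \<Omega>" "is_tr y g" and z: "z \<in> H1 \<Omega>" "is_tr z k"
  shows "is_tr (\<lambda>x. y x + c * z x) (\<lambda>x. g x + c * k x)"
proof -
  from y(2) obtain f where g2: "g \<in> L2 \<Gamma>" and f: "\<And>n. f n \<in> C1"
    and f1: "(\<lambda>n. H1norm \<Omega> (\<lambda>x. f n x - y x)) \<longlonglongrightarrow> 0" and f2: "(\<lambda>n. L2norm \<Gamma> (\<lambda>x. f n x - g x)) \<longlonglongrightarrow> 0"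
    unfolding is_bdry_trace_def by auto
  from z(2) obtain h where k2: "k \<in> L2 \<Gamma>" and h: "\<And>n. h n \<in> C1"
    and h1: "(\<lambda>n. H1norm \<Omega> (\<lambda>x. h n x - z x)) \<longlonglongrightarrow> 0" and h2: "(\<lambda>n. L2norm \<Gamma> (\<lambda>x. h n x - k x)) \<longlonglongrightarrow> 0"
    unfolding is_bdry_trace_def by auto
  show ?thesis unfolding is_bdry_trace_def
  proof (intro conjI exI[of _ "\<lambda>n x. f n x + c * h n x"] allI)
    show "(\<lambda>x. g x + c * k x) \<in> L2 \<Gamma>" by (intro L2_add L2_scaleC g2 k2)
    show "(\<lambda>x. f n x + c * h n x) \<in> C1" for n by (rule C1_add_scale[OF f h])
    have e: "(f n x + c * h n x) - (p + c * q) = (f n x - p) + c * (h n x - q)" for n x p q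
      by (simp add: algebra_simps)
    show "(\<lambda>n. H1norm \<Omega> (\<lambda>x. f n x + c * h n x - (y x + c * z x))) \<longlonglongrightarrow> 0"
    proof (rule Lim_null_comparison[OF always_eventually])
      show "\<forall>n. norm (H1norm \<Omega> (\<lambda>x. f n x + c * h n x - (y x + c * z x)))
          \<le> H1norm \<Omega> (\<lambda>x. f n x - y x) + norm c * H1norm \<Omega> (\<lambda>x. h n x - z x)"
        unfolding e using H1norm_add_scale[OF H1_diff(1)[OF C1_H1(1)[OF f] y(1)] H1_diff(1)[OF C1_H1(1)[OF h] z(1)]] by simp
      show "(\<lambda>n. H1norm \<Omega> (\<lambda>x. f n x - y x) + norm c * H1norm \<Omega> (\<lambda>x. h n x - z x)) \<longlonglongrightarrow> 0"
        by (intro tendsto_add_zero tendsto_mult_right_zero f1 h1)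
    qed
    show "(\<lambda>n. L2norm \<Gamma> (\<lambda>x. f n x + c * h n x - (g x + c * k x))) \<longlonglongrightarrow> 0"
    proof (rule Lim_null_comparison[OF always_eventually])
      show "\<forall>n. norm (L2norm \<Gamma> (\<lambda>x. f n x + c * h n x - (g x + c * k x)))
          \<le> L2norm \<Gamma> (\<lambda>x. f n x - g x) + norm c * L2norm \<Gamma> (\<lambda>x. h n x - k x)"
        unfolding e using L2norm_triangle[OF L2_diff[OF trace_C1(1)[OF f] g2] L2_scaleC[OF L2_diff[OF trace_C1(1)[OF h] k2]]]
        by (simp add: L2norm_scaleC)
      show "(\<lambda>n. L2norm \<Gamma> (\<lambda>x. f n x - g x) + norm c * L2norm \<Gamma> (\<lambda>x. h n x - k x)) \<longlonglongrightarrow> 0"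
        by (intro tendsto_add_zero tendsto_mult_right_zero f2 h2)
    qed
  qed
qed

lemma is_tr_exists:
  assumes y: "y \<in> H1 \<Omega>"
  shows "\<exists>g. is_tr y g"
proof -
  obtain f where f: "\<And>n. f n \<in> C1" and lim: "(\<lambda>n. H1norm \<Omega> (\<lambda>x. f n x - y x)) \<longlonglongrightarrow> 0"
    using C1_dense_H1[OF y] by auto
  have "\<exists>N. \<forall>m\<ge>N. \<forall>n\<ge>N. L2norm \<Gamma> (\<lambda>x. f m x - f n x) < e" if "0 < e" for e
  proof -
    \<comment> \<open>Adding 1 keeps the denominator positive when \<open>Ct = 0\<close> and makes
      the final inequality strict.\<close>
    have "0 < e / (2 * (Ct + 1))" using that Ct_nonneg by simp
    from order_tendstoD(2)[OF lim this] obtain N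
      where N: "\<And>n. N \<le> n \<Longrightarrow> H1norm \<Omega> (\<lambda>x. f n x - y x) < e / (2 * (Ct + 1))"
      unfolding eventually_sequentially by auto
    have "L2norm \<Gamma> (\<lambda>x. f m x - f n x) < e" if "N \<le> m" "N \<le> n" for m n
    proof -
      note d = H1_diff(1)[OF C1_H1(1)[OF f] y]
      have "L2norm \<Gamma> (\<lambda>x. f m x - f n x) \<le> Ct * H1norm \<Omega> (\<lambda>x. f m x - f n x)"
        by (rule trace_C1(2)[OF C1_diff[OF f f]])
      also have "H1norm \<Omega> (\<lambda>x. f m x - f n x) \<le> H1norm \<Omega> (\<lambda>x. f m x - y x) + H1norm \<Omega> (\<lambda>x. f n x - y x)"
        using H1norm_diff_le[OF d d, of m n] by simp
      also have "\<dots> \<le> e / (2 * (Ct + 1)) + e / (2 * (Ct + 1))"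
        using N[OF that(1)] N[OF that(2)] by (intro add_mono) auto
      also have "\<dots> = e / (Ct + 1)"
      proof -
        have "e / (2 * D) + e / (2 * D) = e / D" for D by simp
        then show ?thesis .
      qed
      also have "Ct * (e / (Ct + 1)) < e" using Ct_nonneg \<open>0 < e\<close> by (simp add: field_simps)
      finally show ?thesis using Ct_nonneg by (simp add: mult_left_mono)
    qed
    then show ?thesis by blast
  qed
  with trace_C1(1)[OF f] obtain g where "g \<in> L2 \<Gamma>" "(\<lambda>n. L2norm \<Gamma> (\<lambda>x. f n x - g x)) \<longlonglongrightarrow> 0"
    by (rule L2_complete)
  then show ?thesis using f lim unfolding is_bdry_trace_def by blast
qed

lemma is_tr_bdry_trace: "y \<in> H1 \<Omega> \<Longrightarrow> is_tr y (tr y)"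
  unfolding bdry_trace_def using is_tr_exists by (rule someI_ex)

lemma tr_L2: "y \<in> H1 \<Omega> \<Longrightarrow> tr y \<in> L2 \<Gamma>"
  using is_tr_bdry_trace unfolding is_bdry_trace_def by blast

lemma tr_bound: "y \<in> H1 \<Omega> \<Longrightarrow> L2norm \<Gamma> (tr y) \<le> Ct * H1norm \<Omega> y"
  using is_tr_bound is_tr_bdry_trace by blast

lemma H1norm_diff_self: "y \<in> H1 \<Omega> \<Longrightarrow> H1norm \<Omega> (\<lambda>x. y x - y x) = 0"
  unfolding H1norm_def by (subst L2norm_wgrad_diff) (auto simp: L2norm_def)

text \<open>By linearity the difference of two traces of \<open>y\<close> is a trace of a function
  with \<open>H1\<close> norm zero.\<close>

lemma is_tr_unique:
  assumes y: "y \<in> H1 \<Omega>" and g: "is_tr y g" and k: "is_tr y k"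
  shows "AE x in \<Gamma>. g x = k x"
proof -
  have gk: "g \<in> L2 \<Gamma>" "k \<in> L2 \<Gamma>" using g k unfolding is_bdry_trace_def by auto
  have "is_tr (\<lambda>x. y x - y x) (\<lambda>x. g x - k x)"
    using is_tr_add_scale[OF y g y k, of "-1"] by simp
  from is_tr_bound[OF H1_diff(1)[OF y y] this] have "L2norm \<Gamma> (\<lambda>x. g x - k x) = 0"
    using H1norm_diff_self[OF y] by (intro antisym) auto
  then show ?thesis by (simp add: L2norm_eq_0_iff[OF L2_diff[OF gk]])
qed

lemma tr_add_scale:
  assumes "y \<in> H1 \<Omega>" "z \<in> H1 \<Omega>"
  shows "AE x in \<Gamma>. tr (\<lambda>x. y x + c * z x) x = tr y x + c * tr z x"
  by (rule is_tr_unique[OF H1_add_scale(1)[OF assms, of c]])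
     (intro H1_add_scale is_tr_bdry_trace is_tr_add_scale assms)+

lemma tr_C1:
  assumes "f \<in> C1"
  shows "AE x in \<Gamma>. tr f x = f x"
proof (rule is_tr_unique)
  show f: "f \<in> H1 \<Omega>" by (rule C1_H1(1)[OF assms])
  then show "is_tr f (tr f)" by (rule is_tr_bdry_trace)
  show "is_tr f f" unfolding is_bdry_trace_def
    using H1norm_diff_self[OF f] assms trace_C1(1) by (auto intro!: exI[of _ "\<lambda>_. f"] simp: L2norm_def)
qed

lemma bdry_inner_commute: "bdry_inner \<Omega> \<Gamma> v u = cnj (bdry_inner \<Omega> \<Gamma> u v)"
  unfolding bdry_inner_def by (rule L2inner_commute)

lemma bdry_inner_add_scale_left:
  assumes "u \<in> H1 \<Omega>" "v \<in> H1 \<Omega>" "z \<in> H1 \<Omega>"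
  shows "bdry_inner \<Omega> \<Gamma> (\<lambda>x. u x + c * v x) z = bdry_inner \<Omega> \<Gamma> u z + c * bdry_inner \<Omega> \<Gamma> v z"
proof -
  have "bdry_inner \<Omega> \<Gamma> (\<lambda>x. u x + c * v x) z = L2inner \<Gamma> (\<lambda>x. tr u x + c * tr v x) (tr z)"
    unfolding bdry_inner_def using tr_add_scale[OF assms(1,2)]
    by (intro L2inner_cong_AE L2D(1) L2_add L2_scaleC tr_L2 H1_add_scale assms) auto
  then show ?thesis
    unfolding bdry_inner_def by (simp add: L2inner_add_scale_left tr_L2 assms)
qed

lemma bdry_inner_self: "bdry_inner \<Omega> \<Gamma> u u = of_real ((L2norm \<Gamma> (tr u))\<^sup>2)"
  unfolding bdry_inner_def by (rule L2inner_self)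

lemma bdry_inner_bound:
  assumes "u \<in> H1 \<Omega>" "v \<in> H1 \<Omega>"
  shows "norm (bdry_inner \<Omega> \<Gamma> u v) \<le> L2norm \<Gamma> (tr u) * L2norm \<Gamma> (tr v)"
  unfolding bdry_inner_def by (intro L2inner_bound tr_L2 assms)

end

subsection \<open>The square\<close>

lemma perp_simps [simp]: "perp e $ 1 = - (e $ 2)" "perp e $ 2 = e $ 1"
  by (simp_all add: perp_def)

lemma inner_2: "(x :: real^2) \<bullet> y = x $ 1 * y $ 1 + x $ 2 * y $ 2"
  by (simp add: inner_vec_def sum_2)

lemma measurable_vec_pair:
  "(\<lambda>(s, t). vector [s, t] :: real^2) \<in> borel_measurable (lborel \<Otimes>\<^sub>M lborel)"
proof -
  have c: "(\<lambda>p. vector [fst p, snd p] :: real^2) = (\<lambda>p. \<chi> i. if i = 1 then fst p else snd p)"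
    by (auto simp: vec_eq_iff forall_2)
  have "continuous_on UNIV (\<lambda>p::real\<times>real. if i = 1 then fst p else snd p)" for i :: 2
    by (cases "i = 1") (auto intro: continuous_on_fst continuous_on_snd continuous_on_id)
  then have "continuous_on UNIV (\<lambda>p. vector [fst p, snd p] :: real^2)"
    unfolding c by (intro continuous_on_vec_lambda)
  then show ?thesis by (simp add: lborel_prod case_prod_beta' borel_measurable_continuous_onI)
qed

text \<open>Comparison on boxes. It makes Fubini's theorem available for integrals over
  vectors.\<close>

lemma distr_lborel_vec_pair:
  "distr (lborel \<Otimes>\<^sub>M lborel) borel (\<lambda>(s, t). vector [s, t] :: real^2) = lborel"
proof (rule lborel_eqI[symmetric])
  fix l u :: "real^2" assume lu: "\<And>b. b \<in> Basis \<Longrightarrow> l \<bullet> b \<le> u \<bullet> b"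
  have le: "l $ i \<le> u $ i" for i using lu[of "axis i 1"] by (simp add: cart_eq_inner_axis)
  have "emeasure (distr (lborel \<Otimes>\<^sub>M lborel) borel (\<lambda>(s, t). vector [s, t])) (box l u)
      = emeasure (lborel \<Otimes>\<^sub>M lborel) ((\<lambda>(s, t). vector [s, t]) -` box l u \<inter> space (lborel \<Otimes>\<^sub>M lborel))"
    by (rule emeasure_distr[OF measurable_vec_pair]) simp
  also have "(\<lambda>(s, t). vector [s, t]) -` box l u \<inter> space (lborel \<Otimes>\<^sub>M lborel) = {l $ 1<..<u $ 1} \<times> {l $ 2<..<u $ 2}"
    by (auto simp: mem_box_cart forall_2 space_pair_measure)
  also have "emeasure (lborel \<Otimes>\<^sub>M lborel) \<dots> = ennreal (u $ 1 - l $ 1) * ennreal (u $ 2 - l $ 2)"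
    using le by (subst lborel.emeasure_pair_measure_Times) auto
  also have "\<dots> = ennreal ((u $ 1 - l $ 1) * (u $ 2 - l $ 2))" using le by (simp add: ennreal_mult)
  also have "(u $ 1 - l $ 1) * (u $ 2 - l $ 2) = (\<Prod>b\<in>Basis. (u - l) \<bullet> b)"
  proof -
    have "cbox l u \<noteq> {}" using le by (auto simp: interval_ne_empty_cart)
    then have "measure lborel (cbox l u) = (u $ 1 - l $ 1) * (u $ 2 - l $ 2)"
      by (simp add: content_cbox_cart UNIV_2)
    then show ?thesis using lu by (simp add: measure_lborel_cbox_eq)
  qed
  finally show "emeasure (distr (lborel \<Otimes>\<^sub>M lborel) borel (\<lambda>(s, t). vector [s, t])) (box l u) = (\<Prod>b\<in>Basis. (u - l) \<bullet> b)" .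
qed simp

text \<open>Invariance under rigid motions, which brings a rotated square into axis-parallel
  position.\<close>

lemma distr_lborel_orthogonal:
  assumes f: "orthogonal_transformation (f :: real^2 \<Rightarrow> real^2)"
  shows "distr lborel borel (\<lambda>x. a + f x) = lborel"
proof (rule lborel_eqI[symmetric])
  have m: "(\<lambda>x. a + f x) \<in> borel_measurable lborel"
  proof -
    have "bounded_linear f"
      using orthogonal_transformation_linear[OF f] by (simp add: linear_conv_bounded_linear)
    then have "continuous_on UNIV (\<lambda>x. a + f x)"
      by (intro continuous_on_add continuous_on_const linear_continuous_on)
    then show ?thesis using borel_measurable_continuous_onI by simp
  qed
  fix l u :: "real^2" assume lu: "\<And>b. b \<in> Basis \<Longrightarrow> l \<bullet> b \<le> u \<bullet> b"
  let ?g = "inv f"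
  have g: "orthogonal_transformation ?g" by (rule orthogonal_transformation_inv[OF f])
  have "emeasure (distr lborel borel (\<lambda>x. a + f x)) (box l u) = emeasure lborel ((\<lambda>x. a + f x) -` box l u)"
    by (subst emeasure_distr[OF m]) auto
  also have "(\<lambda>x. a + f x) -` box l u = ?g ` ((+) (- a) ` box l u)"
  proof (intro equalityI subsetI)
    fix x assume "x \<in> (\<lambda>x. a + f x) -` box l u"
    moreover have "x = ?g (- a + (a + f x))" by (simp add: inv_f_f orthogonal_transformation_inj[OF f])
    ultimately show "x \<in> ?g ` ((+) (- a) ` box l u)" by blast
  next
    fix x assume "x \<in> ?g ` ((+) (- a) ` box l u)"
    then obtain y where "y \<in> box l u" "x = ?g (- a + y)" by auto
    then show "x \<in> (\<lambda>x. a + f x) -` box l u" by (simp add: surj_f_inv_f orthogonal_transformation_surj[OF f])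
  qed
  also have "emeasure lborel \<dots> = ennreal (measure lebesgue (?g ` ((+) (- a) ` box l u)))"
  proof -
    have L: "(+) (- a) ` box l u \<in> lmeasurable" by (intro measurable_translation) simp
    have "?g ` ((+) (- a) ` box l u) \<in> lmeasurable" by (rule measurable_orthogonal_image[OF g L])
    moreover have "?g ` ((+) (- a) ` box l u) \<in> sets borel"
    proof -
      have "(\<lambda>x. a + f x) -` box l u \<inter> space lborel \<in> sets lborel" by (rule measurable_sets[OF m]) simp
      then show ?thesis using \<open>(\<lambda>x. a + f x) -` box l u = ?g ` ((+) (- a) ` box l u)\<close> by simp
    qed
    ultimately show ?thesis
      by (subst emeasure_eq_ennreal_measure[OF fmeasurableD2, symmetric]) simp_all
  qed
  also have "measure lebesgue (?g ` ((+) (- a) ` box l u)) = measure lebesgue (box l u)"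
    by (subst measure_orthogonal_image[OF g measurable_translation]) (auto simp: measure_translation_subtract)
  also have "ennreal \<dots> = (\<Prod>b\<in>Basis. (u - l) \<bullet> b)" using lu by (simp add: measure_lborel_box_eq)
  finally show "emeasure (distr lborel borel (\<lambda>x. a + f x)) (box l u) = (\<Prod>b\<in>Basis. (u - l) \<bullet> b)" .
qed simp


locale square =
  fixes a e :: "real^2" and L :: real
  assumes norm_e: "norm e = 1" and L_pos: "0 < L"
begin

definition pt :: "real \<Rightarrow> real \<Rightarrow> real^2" where
  "pt s t = a + s *\<^sub>R e + t *\<^sub>R perp e"

lemma e_sq: "e $ 1 * e $ 1 + e $ 2 * e $ 2 = 1"
  using norm_e by (simp add: norm_eq_1 inner_2)

lemma orthonormal: "e \<bullet> e = 1" "perp e \<bullet> perp e = 1" "e \<bullet> perp e = 0" "perp e \<bullet> e = 0" "norm (perp e) = 1"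
  using e_sq by (simp_all add: inner_2 norm_eq_1 algebra_simps)

lemma pt_coords: "(pt s t - a) \<bullet> e = s" "(pt s t - a) \<bullet> perp e = t"
  by (simp_all add: pt_def inner_add_left orthonormal)

lemma pt_expand: "pt ((x - a) \<bullet> e) ((x - a) \<bullet> perp e) = x"
proof -
  have "((y $ 1 * e $ 1 + y $ 2 * e $ 2) * e $ 1 - (- (y $ 1 * e $ 2) + y $ 2 * e $ 1) * e $ 2)
      = y $ 1 * (e $ 1 * e $ 1 + e $ 2 * e $ 2)"
    "((y $ 1 * e $ 1 + y $ 2 * e $ 2) * e $ 2 + (- (y $ 1 * e $ 2) + y $ 2 * e $ 1) * e $ 1)
      = y $ 2 * (e $ 1 * e $ 1 + e $ 2 * e $ 2)" for y :: "real^2"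
    by (simp_all add: algebra_simps)
  from this[of "x - a"] show ?thesis
    unfolding e_sq by (simp add: pt_def vec_eq_iff forall_2 inner_2)
qed

lemma open_square_eq:
  "open_square a e L = {x. 0 < (x - a) \<bullet> e \<and> (x - a) \<bullet> e < L \<and> 0 < (x - a) \<bullet> perp e \<and> (x - a) \<bullet> perp e < L}"
proof (intro equalityI subsetI)
  fix x assume "x \<in> open_square a e L"
  then obtain s t where "x = pt s t" "0 < s" "s < L" "0 < t" "t < L"
    by (auto simp: open_square_def pt_def)
  then show "x \<in> {x. 0 < (x - a) \<bullet> e \<and> (x - a) \<bullet> e < L \<and> 0 < (x - a) \<bullet> perp e \<and> (x - a) \<bullet> perp e < L}"
    by (simp add: pt_coords)
next
  fix x assume "x \<in> {x. 0 < (x - a) \<bullet> e \<and> (x - a) \<bullet> e < L \<and> 0 < (x - a) \<bullet> perp e \<and> (x - a) \<bullet> perp e < L}"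
  then show "x \<in> open_square a e L"
    using pt_expand[of x, symmetric] unfolding open_square_def pt_def by blast
qed

lemma pt_in_square: "pt s t \<in> open_square a e L \<longleftrightarrow> 0 < s \<and> s < L \<and> 0 < t \<and> t < L"
  by (simp add: open_square_eq pt_coords)

sublocale convex_domain "open_square a e L" "pt (L / 2) (L / 2)" "L / 4"
proof
  show "open (open_square a e L)"
    unfolding open_square_eq by (intro open_Collect_conj open_Collect_less continuous_intros)
  show "bounded (open_square a e L)" unfolding bounded_iff
  proof (intro exI ballI)
    fix x assume "x \<in> open_square a e L"
    then obtain s t where x: "x = a + s *\<^sub>R e + t *\<^sub>R perp e" "0 < s" "s < L" "0 < t" "t < L"
      by (auto simp: open_square_def)
    have "norm x \<le> norm a + norm (s *\<^sub>R e) + norm (t *\<^sub>R perp e)"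
      unfolding x(1) by (meson add_right_mono norm_triangle_ineq order_trans)
    then show "norm x \<le> norm a + L + L" using x norm_e orthonormal(5) by simp
  qed
  show "convex (open_square a e L)" unfolding open_square_eq convex_def
  proof (intro ballI allI impI, clarsimp simp only: mem_Collect_eq)
    fix x y :: "real^2" and u v :: real
    assume uv: "0 \<le> u" "0 \<le> v" "u + v = 1"
      and x: "0 < (x - a) \<bullet> e" "(x - a) \<bullet> e < L" "0 < (x - a) \<bullet> perp e" "(x - a) \<bullet> perp e < L"
      and y: "0 < (y - a) \<bullet> e" "(y - a) \<bullet> e < L" "0 < (y - a) \<bullet> perp e" "(y - a) \<bullet> perp e < L"
    have "u *\<^sub>R x + v *\<^sub>R y - a = u *\<^sub>R (x - a) + v *\<^sub>R (y - a)"
      using uv(3) by (simp add: algebra_simps) (metis scaleR_add_left scaleR_one add.commute)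
    then have c: "(u *\<^sub>R x + v *\<^sub>R y - a) \<bullet> z = u * ((x - a) \<bullet> z) + v * ((y - a) \<bullet> z)" for z
      by (simp only: inner_add_left inner_scaleR_left)
    show "0 < (u *\<^sub>R x + v *\<^sub>R y - a) \<bullet> e \<and> (u *\<^sub>R x + v *\<^sub>R y - a) \<bullet> e < L \<and>
        0 < (u *\<^sub>R x + v *\<^sub>R y - a) \<bullet> perp e \<and> (u *\<^sub>R x + v *\<^sub>R y - a) \<bullet> perp e < L"
      unfolding c using x y uv
        convexD[OF convex_real_interval(8)[of 0 L], of "(x - a) \<bullet> e" "(y - a) \<bullet> e" u v]
        convexD[OF convex_real_interval(8)[of 0 L], of "(x - a) \<bullet> perp e" "(y - a) \<bullet> perp e" u v] by simp
  qed
  show "0 < L / 4" using L_pos by simp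
  show "cball (pt (L / 2) (L / 2)) (L / 4) \<subseteq> open_square a e L"
  proof
    fix x assume "x \<in> cball (pt (L / 2) (L / 2)) (L / 4)"
    then have d: "norm (x - pt (L / 2) (L / 2)) \<le> L / 4" by (simp add: dist_norm norm_minus_commute)
    have "\<bar>(x - a) \<bullet> z - (pt (L / 2) (L / 2) - a) \<bullet> z\<bar> \<le> L / 4" if "norm z = 1" for z
      using Cauchy_Schwarz_ineq2[of "x - pt (L / 2) (L / 2)" z] d that by (simp add: inner_diff_left)
    from this[OF norm_e] this[OF orthonormal(5)] show "x \<in> open_square a e L"
      using L_pos unfolding open_square_eq pt_coords abs_le_iff mem_Collect_eq by (intro conjI; simp)
  qed
qed

text \<open>A rigid motion carries the coordinate axes to the edge directions, and Fubini's theorem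
  applies. The two orders of integration serve the two pairs of parallel edges.\<close>

lemma nn_integral_square:
  assumes [measurable]: "g \<in> borel_measurable borel"
  shows "(\<integral>\<^sup>+x. g x \<partial>M) = (\<integral>\<^sup>+s. \<integral>\<^sup>+t. g (pt s t) * indicator {0<..<L} s * indicator {0<..<L} t \<partial>lborel \<partial>lborel)"
    and "(\<integral>\<^sup>+x. g x \<partial>M) = (\<integral>\<^sup>+t. \<integral>\<^sup>+s. g (pt s t) * indicator {0<..<L} s * indicator {0<..<L} t \<partial>lborel \<partial>lborel)"
proof -
  define R where "R x = x $ 1 *\<^sub>R e + x $ 2 *\<^sub>R perp e" for x :: "real^2"
  have R: "orthogonal_transformation R"
    unfolding orthogonal_transformation_def
  proof (intro conjI allI)
    show "linear R" by (rule linearI) (simp_all add: R_def algebra_simps)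
    show "R v \<bullet> R w = v \<bullet> w" for v w
      by (simp add: R_def inner_add_left inner_add_right orthonormal) (simp add: inner_2)
  qed
  have Rm [measurable]: "(\<lambda>x. a + R x) \<in> borel_measurable borel"
    unfolding R_def by (intro borel_measurable_continuous_onI continuous_intros)
  note Vm [measurable] = measurable_vec_pair
  have [measurable]: "open_square a e L \<in> sets borel" using open_dom by simp
  have ptm: "(\<lambda>p. pt (fst p) (snd p)) \<in> borel_measurable (lborel \<Otimes>\<^sub>M lborel)"
    unfolding pt_def lborel_prod by (simp, intro borel_measurable_continuous_onI continuous_intros)
  let ?h = "\<lambda>p. g (pt (fst p) (snd p)) * indicator {0<..<L} (fst p) * indicator {0<..<L} (snd p) :: ennreal"
  have hm: "?h \<in> borel_measurable (lborel \<Otimes>\<^sub>M lborel)"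
    using ptm by measurable
  have "(\<integral>\<^sup>+x. g x \<partial>M) = (\<integral>\<^sup>+x. g x * indicator (open_square a e L) x \<partial>lborel)"
    by (rule nn_integral_M) measurable
  also have "\<dots> = (\<integral>\<^sup>+x. g x * indicator (open_square a e L) x \<partial>distr lborel borel (\<lambda>x. a + R x))"
    by (simp add: distr_lborel_orthogonal[OF R])
  also have "\<dots> = (\<integral>\<^sup>+x. g (a + R x) * indicator (open_square a e L) (a + R x) \<partial>lborel)"
    by (subst nn_integral_distr) auto
  also have "\<dots> = (\<integral>\<^sup>+x. g (a + R x) * indicator (open_square a e L) (a + R x)
      \<partial>distr (lborel \<Otimes>\<^sub>M lborel) borel (\<lambda>(s, t). vector [s, t] :: real^2))"
    by (simp add: distr_lborel_vec_pair)
  also have "\<dots> = (\<integral>\<^sup>+p. ?h p \<partial>(lborel \<Otimes>\<^sub>M lborel))"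
  proof (subst nn_integral_distr[OF Vm])
    show "(\<integral>\<^sup>+p. g (a + R (case p of (s, t) \<Rightarrow> vector [s, t])) * indicator (open_square a e L) (a + R (case p of (s, t) \<Rightarrow> vector [s, t])) \<partial>(lborel \<Otimes>\<^sub>M lborel))
       = (\<integral>\<^sup>+p. ?h p \<partial>(lborel \<Otimes>\<^sub>M lborel))"
    proof (rule nn_integral_cong)
      fix p :: "real \<times> real"
      have "a + R (case p of (s, t) \<Rightarrow> vector [s, t]) = pt (fst p) (snd p)"
        by (simp add: R_def pt_def case_prod_beta' add.assoc)
      then show "g (a + R (case p of (s, t) \<Rightarrow> vector [s, t])) * indicator (open_square a e L) (a + R (case p of (s, t) \<Rightarrow> vector [s, t])) = ?h p"
        by (auto simp: indicator_def pt_in_square)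
    qed
  qed measurable
  finally have eq: "(\<integral>\<^sup>+x. g x \<partial>M) = (\<integral>\<^sup>+p. ?h p \<partial>(lborel \<Otimes>\<^sub>M lborel))" .
  show 1: "(\<integral>\<^sup>+x. g x \<partial>M) = (\<integral>\<^sup>+s. \<integral>\<^sup>+t. g (pt s t) * indicator {0<..<L} s * indicator {0<..<L} t \<partial>lborel \<partial>lborel)"
    unfolding eq using lborel.nn_integral_fst[OF hm] by simp
  show "(\<integral>\<^sup>+x. g x \<partial>M) = (\<integral>\<^sup>+t. \<integral>\<^sup>+s. g (pt s t) * indicator {0<..<L} s * indicator {0<..<L} t \<partial>lborel \<partial>lborel)"
    unfolding 1 by (rule lborel_pair.Fubini'[symmetric]) (use hm in \<open>simp add: case_prod_beta'\<close>)
qed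


text \<open>The squared modulus of \<open>\<gamma>\<close> has derivative twice the inner product of
  \<open>\<gamma>\<close> and \<open>\<gamma>'\<close>, which is at most the integrand
  \<open>h\<close> in absolute value. Hence its value at \<open>\<tau>\<close> exceeds that at any
  \<open>s\<close> by at most the integral of \<open>h\<close>, and averaging over \<open>s\<close>
  gives the constant \<open>1 / L + 1\<close>.\<close>

lemma trace_one_dim:
  fixes \<gamma> :: "real \<Rightarrow> complex"
  assumes \<gamma>: "\<And>s. (\<gamma> has_vector_derivative \<gamma>' s) (at s)" and \<gamma>': "continuous_on UNIV \<gamma>'"
    and \<tau>: "\<tau> \<in> {0..L}"
  shows "ennreal ((norm (\<gamma> \<tau>))\<^sup>2) \<le> ennreal (1 / L + 1) *
    (\<integral>\<^sup>+s. ennreal ((norm (\<gamma> s))\<^sup>2 + (norm (\<gamma>' s))\<^sup>2) * indicator {0<..<L} s \<partial>lborel)"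
proof -
  define \<phi> where "\<phi> s = (norm (\<gamma> s))\<^sup>2" for s
  define \<psi> where "\<psi> s = 2 * (\<gamma> s \<bullet> \<gamma>' s)" for s
  define h where "h s = (norm (\<gamma> s))\<^sup>2 + (norm (\<gamma>' s))\<^sup>2" for s
  define J where "J = integral {0..L} h"
  have \<gamma>c: "continuous_on UNIV \<gamma>"
    by (intro continuous_at_imp_continuous_on ballI has_vector_derivative_continuous[OF \<gamma>])
  have hc: "continuous_on A h" for A
    unfolding h_def by (intro continuous_intros continuous_on_subset[OF \<gamma>c] continuous_on_subset[OF \<gamma>']) auto
  have hi: "h integrable_on {x..y}" for x y by (rule integrable_continuous_interval[OF hc])
  have \<phi>\<psi>: "(\<phi> has_vector_derivative \<psi> s) (at s within A)" for s A
  proof -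
    note d = has_derivative_at_withinI[OF \<gamma>[unfolded has_vector_derivative_def]]
    have "((\<lambda>s. \<gamma> s \<bullet> \<gamma> s) has_derivative (\<lambda>t. \<gamma> s \<bullet> (t *\<^sub>R \<gamma>' s) + (t *\<^sub>R \<gamma>' s) \<bullet> \<gamma> s)) (at s within A)"
      by (rule has_derivative_inner[OF d d])
    then show ?thesis
      unfolding has_vector_derivative_def \<phi>_def \<psi>_def power2_norm_eq_inner
      by (rule has_derivative_eq_rhs) (simp add: fun_eq_iff inner_commute)
  qed
  have \<psi>h: "\<psi> s \<le> h s" "- \<psi> s \<le> h s" for s
  proof -
    have "\<bar>\<gamma> s \<bullet> \<gamma>' s\<bar> \<le> norm (\<gamma> s) * norm (\<gamma>' s)" by (rule Cauchy_Schwarz_ineq2)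
    then have "2 * \<bar>\<gamma> s \<bullet> \<gamma>' s\<bar> \<le> h s"
      using sum_squares_bound[of "norm (\<gamma> s)" "norm (\<gamma>' s)"] by (simp add: h_def)
    then show "\<psi> s \<le> h s" "- \<psi> s \<le> h s" by (auto simp: \<psi>_def)
  qed
  have h0: "0 \<le> h s" for s by (simp add: h_def)
  have sub: "integral {x..y} h \<le> J" if "0 \<le> x" "y \<le> L" for x y
    unfolding J_def by (rule integral_subset_le) (use that hi h0 in auto)
  have key: "\<phi> \<tau> \<le> \<phi> s + J" if s: "s \<in> {0..L}" for s
  proof (cases "s \<le> \<tau>")
    case True
    have "(\<psi> has_integral (\<phi> \<tau> - \<phi> s)) {s..\<tau>}"
      by (rule fundamental_theorem_of_calculus[OF True]) (rule \<phi>\<psi>)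
    then have "\<phi> \<tau> - \<phi> s \<le> integral {s..\<tau>} h"
      using has_integral_le integrable_integral[OF hi] \<psi>h(1) by blast
    then show ?thesis using sub[of s \<tau>] s \<tau> by simp
  next
    case False
    then have "(\<psi> has_integral (\<phi> s - \<phi> \<tau>)) {\<tau>..s}"
      by (intro fundamental_theorem_of_calculus \<phi>\<psi>) simp
    then have "((\<lambda>s. - \<psi> s) has_integral - (\<phi> s - \<phi> \<tau>)) {\<tau>..s}" by (rule has_integral_neg)
    then have "- (\<phi> s - \<phi> \<tau>) \<le> integral {\<tau>..s} h"
      using has_integral_le integrable_integral[OF hi] \<psi>h(2) by blast
    then show ?thesis using sub[of \<tau> s] s \<tau> by simp
  qed
  have \<phi>i: "\<phi> integrable_on {0..L}"
    unfolding \<phi>_def by (intro integrable_continuous_interval continuous_intros continuous_on_subset[OF \<gamma>c]) auto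
  \<comment> \<open>Integration of the pointwise bound over \<open>s\<close> gives
    \<open>L * \<phi> \<tau> \<le> J + L * J\<close>.\<close>
  have "integral {0..L} (\<lambda>_. \<phi> \<tau>) \<le> integral {0..L} (\<lambda>s. h s + J)"
  proof (rule integral_le)
    show "(\<lambda>s. h s + J) integrable_on {0..L}" by (intro integrable_add hi) auto
    show "\<phi> \<tau> \<le> h s + J" if "s \<in> {0..L}" for s
    proof -
      have "\<phi> s \<le> h s" by (simp add: \<phi>_def h_def)
      with key[OF that] show ?thesis by linarith
    qed
  qed auto
  also have "integral {0..L} (\<lambda>s. h s + J) = J + L * J"
    using L_pos by (subst Henstock_Kurzweil_Integration.integral_add[OF hi]) (auto simp: J_def)
  finally have "L * \<phi> \<tau> \<le> J + L * J" using L_pos by simp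
  then have le: "\<phi> \<tau> \<le> (1 / L + 1) * J" using L_pos by (simp add: field_simps)
  have "(\<integral>\<^sup>+s. ennreal (h s) * indicator {0<..<L} s \<partial>lborel) = (\<integral>\<^sup>+s. ennreal (h s) * indicator {0..L} s \<partial>lborel)"
  proof (rule nn_integral_cong_AE)
    have "AE s in lborel. s \<noteq> 0 \<and> s \<noteq> L" using AE_lborel_singleton[of 0] AE_lborel_singleton[of L] by eventually_elim simp
    then show "AE s in lborel. ennreal (h s) * indicator {0<..<L} s = ennreal (h s) * indicator {0..L} s"
      by eventually_elim (auto simp: indicator_def)
  qed
  also have "\<dots> = ennreal J"
    unfolding J_def by (rule nn_integral_has_integral_lebesgue'[OF h0 integrable_integral[OF hi]])
  finally have J: "(\<integral>\<^sup>+s. ennreal (h s) * indicator {0<..<L} s \<partial>lborel) = ennreal J" .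
  have "0 \<le> J" unfolding J_def by (intro Henstock_Kurzweil_Integration.integral_nonneg hi h0)
  then have "ennreal (\<phi> \<tau>) \<le> ennreal (1 / L + 1) * ennreal J"
    using le L_pos by (subst ennreal_mult[symmetric]) (auto intro: ennreal_leI)
  then show ?thesis unfolding J[symmetric] h_def \<phi>_def .
qed

abbreviation "\<Gamma> \<equiv> square_boundary a e L"

lemma square_edge_pt:
  "square_edge a e L k t = (if k = 0 then pt t 0 else if k = 1 then pt L t else if k = 2 then pt t L else pt 0 t)"
  by (simp add: square_edge_def pt_def algebra_simps)

lemma continuous_on_square_edge: "continuous_on UNIV (square_edge a e L k)"
proof -
  have "continuous_on UNIV (\<lambda>t. pt t c)" "continuous_on UNIV (\<lambda>t. pt c t)" for c
    unfolding pt_def by (intro continuous_intros)+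
  then show ?thesis
    unfolding square_edge_pt[abs_def] by (cases "k = 0"; cases "k = 1"; cases "k = 2") auto
qed

lemma square_edge_measurable:
  "(\<lambda>(k, t). square_edge a e L k t) \<in> borel_measurable (count_space {..<4} \<Otimes>\<^sub>M restrict_space lborel {0..L})"
proof (rule measurable_pair_measure_countable1)
  show "(\<lambda>t. case (k, t) of (k, t) \<Rightarrow> square_edge a e L k t) \<in> borel_measurable (restrict_space lborel {0..L})" for k
    using borel_measurable_continuous_onI[OF continuous_on_square_edge, of k]
    by (auto intro!: measurable_restrict_space1)
qed simp

lemma nn_integral_boundary:
  assumes [measurable]: "g \<in> borel_measurable borel"
  shows "(\<integral>\<^sup>+x. g x \<partial>\<Gamma>) = (\<Sum>k<4. \<integral>\<^sup>+t. g (square_edge a e L k t) * indicator {0..L} t \<partial>lborel)"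
proof -
  let ?R = "restrict_space lborel {0..L}"
  interpret R: finite_measure ?R
    by (rule finite_measureI) (use L_pos in \<open>simp add: emeasure_restrict_space space_restrict_space\<close>)
  note [measurable] = square_edge_measurable
  have "(\<integral>\<^sup>+x. g x \<partial>\<Gamma>) = (\<integral>\<^sup>+p. g (case p of (k, t) \<Rightarrow> square_edge a e L k t) \<partial>(count_space {..<4} \<Otimes>\<^sub>M ?R))"
    unfolding square_boundary_def by (rule nn_integral_distr) measurable
  also have "\<dots> = (\<integral>\<^sup>+k. \<integral>\<^sup>+t. g (case (k, t) of (k, t) \<Rightarrow> square_edge a e L k t) \<partial>?R \<partial>count_space {..<4})"
    by (rule R.nn_integral_fst[symmetric]) measurable
  also have "\<dots> = (\<Sum>k<4. \<integral>\<^sup>+t. g (square_edge a e L k t) \<partial>?R)"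
    by (simp add: nn_integral_count_space_finite)
  also have "\<dots> = (\<Sum>k<4. \<integral>\<^sup>+t. g (square_edge a e L k t) * indicator {0..L} t \<partial>lborel)"
    by (simp add: nn_integral_restrict_space)
  finally show ?thesis .
qed

lemma C1_along_line:
  fixes f :: "real^2 \<Rightarrow> complex"
  assumes f: "f \<in> C1"
  shows "((\<lambda>s. f (x + s *\<^sub>R v)) has_vector_derivative (\<Sum>i\<in>UNIV. v $ i *\<^sub>R partial_deriv i f (x + s *\<^sub>R v))) (at s)"
    and "norm (\<Sum>i\<in>UNIV. v $ i *\<^sub>R partial_deriv i f y) \<le> norm v * norm (cgrad f y)"
proof -
  let ?D = "frechet_derivative f (at (x + s *\<^sub>R v))"
  have lin: "linear ?D" by (rule has_derivative_linear[OF C1_has_derivative[OF f]])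
  have "((\<lambda>s. f (x + s *\<^sub>R v)) has_derivative (\<lambda>t. ?D (t *\<^sub>R v))) (at s)"
    by (rule has_derivative_compose[of "\<lambda>s. x + s *\<^sub>R v" _ s UNIV f ?D]) (auto intro!: derivative_eq_intros C1_has_derivative[OF f])
  moreover have "?D v = (\<Sum>i\<in>UNIV. v $ i *\<^sub>R partial_deriv i f (x + s *\<^sub>R v))"
  proof -
    have "?D v = ?D (\<Sum>i\<in>UNIV. v $ i *\<^sub>R axis i 1)" by (simp add: basis_expansion flip: scalar_mult_eq_scaleR)
    also have "\<dots> = (\<Sum>i\<in>UNIV. v $ i *\<^sub>R ?D (axis i 1))" by (simp add: linear_sum[OF lin] linear_scale[OF lin])
    finally show ?thesis by (simp add: partial_deriv_def)
  qed
  ultimately show "((\<lambda>s. f (x + s *\<^sub>R v)) has_vector_derivative (\<Sum>i\<in>UNIV. v $ i *\<^sub>R partial_deriv i f (x + s *\<^sub>R v))) (at s)"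
    unfolding has_vector_derivative_def by (simp add: linear_scale[OF lin])
  have "norm (\<Sum>i\<in>UNIV. v $ i *\<^sub>R partial_deriv i f y) \<le> (\<Sum>i\<in>UNIV. \<bar>v $ i\<bar> * \<bar>norm (partial_deriv i f y)\<bar>)"
    by (rule order_trans[OF norm_sum]) simp
  also have "\<dots> \<le> L2_set (\<lambda>i. v $ i) UNIV * L2_set (\<lambda>i. norm (partial_deriv i f y)) UNIV"
    by (rule L2_set_mult_ineq)
  finally show "norm (\<Sum>i\<in>UNIV. v $ i *\<^sub>R partial_deriv i f y) \<le> norm v * norm (cgrad f y)"
    by (simp add: norm_vec_def cgrad_def L2_set_def)
qed

lemma trace_line:
  fixes f :: "real^2 \<Rightarrow> complex"
  assumes f: "f \<in> C1" and \<tau>: "\<tau> \<in> {0..L}" and v: "norm v = 1"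
  shows "ennreal ((norm (f (x + \<tau> *\<^sub>R v)))\<^sup>2) \<le> ennreal (1 / L + 1) *
    (\<integral>\<^sup>+s. ennreal ((norm (f (x + s *\<^sub>R v)))\<^sup>2 + (norm (cgrad f (x + s *\<^sub>R v)))\<^sup>2) * indicator {0<..<L} s \<partial>lborel)"
proof -
  have "ennreal ((norm (f (x + \<tau> *\<^sub>R v)))\<^sup>2) \<le> ennreal (1 / L + 1) *
    (\<integral>\<^sup>+s. ennreal ((norm (f (x + s *\<^sub>R v)))\<^sup>2
        + (norm (\<Sum>i\<in>UNIV. v $ i *\<^sub>R partial_deriv i f (x + s *\<^sub>R v)))\<^sup>2) * indicator {0<..<L} s \<partial>lborel)"
    by (rule trace_one_dim[OF C1_along_line(1)[OF f] _ \<tau>])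
       (intro continuous_intros continuous_on_compose2[OF C1_partial_continuous[OF f]], auto)
  also have "\<dots> \<le> ennreal (1 / L + 1) *
    (\<integral>\<^sup>+s. ennreal ((norm (f (x + s *\<^sub>R v)))\<^sup>2 + (norm (cgrad f (x + s *\<^sub>R v)))\<^sup>2) * indicator {0<..<L} s \<partial>lborel)"
    using C1_along_line(2)[OF f, of v] v
    by (intro mult_left_mono nn_integral_mono mult_right_mono ennreal_leI add_left_mono power_mono) auto
  finally show ?thesis .
qed

text \<open>Each edge point ends a segment of length \<open>L\<close> that crosses the square
  normally to the edge. The one-dimensional bound on these segments, integrated along the edge,
  gives the integral over the square: \<open>A\<close> treats the edges parallel to
  \<open>e\<close>, \<open>B\<close> those parallel to \<open>perp e\<close>.\<close>

lemma trace_edge: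
  fixes f :: "real^2 \<Rightarrow> complex"
  assumes f: "f \<in> C1"
  shows "(\<integral>\<^sup>+t. ennreal ((norm (f (square_edge a e L k t)))\<^sup>2) * indicator {0..L} t \<partial>lborel)
      \<le> ennreal (1 / L + 1) * (\<integral>\<^sup>+x. ennreal ((norm (f x))\<^sup>2 + (norm (cgrad f x))\<^sup>2) \<partial>M)"
proof -
  let ?g = "\<lambda>x. ennreal ((norm (f x))\<^sup>2 + (norm (cgrad f x))\<^sup>2)"
  have [measurable]: "f \<in> borel_measurable borel" "cgrad f \<in> borel_measurable borel"
    by (intro borel_measurable_continuous_onI C1_continuous continuous_on_cgrad f)+
  have gm: "?g \<in> borel_measurable borel" by measurable
  have open_int: "(\<integral>\<^sup>+t. q t * indicator {0..L} t \<partial>lborel) = (\<integral>\<^sup>+t. q t * indicator {0<..<L} t \<partial>lborel)" for q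
  proof (rule nn_integral_cong_AE)
    have "AE s in lborel. s \<noteq> 0 \<and> s \<noteq> L" using AE_lborel_singleton[of 0] AE_lborel_singleton[of L] by eventually_elim simp
    then show "AE s in lborel. q s * indicator {0..L} s = q s * indicator {0<..<L} s"
      by eventually_elim (auto simp: indicator_def)
  qed
  have c: "(0::real) \<in> {0..L}" "L \<in> {0..L}" using L_pos by auto
  have ptm: "(\<lambda>p. pt (fst p) (snd p)) \<in> borel_measurable (lborel \<Otimes>\<^sub>M lborel)"
    unfolding pt_def lborel_prod by (simp, intro borel_measurable_continuous_onI continuous_intros)
  have A: "(\<integral>\<^sup>+t. ennreal ((norm (f (pt t \<tau>)))\<^sup>2) * indicator {0..L} t \<partial>lborel) \<le> ennreal (1 / L + 1) * (\<integral>\<^sup>+x. ?g x \<partial>M)"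
    if \<tau>: "\<tau> \<in> {0..L}" for \<tau>
  proof -
    have "(\<integral>\<^sup>+t. ennreal ((norm (f (pt t \<tau>)))\<^sup>2) * indicator {0..L} t \<partial>lborel)
      \<le> (\<integral>\<^sup>+t. (ennreal (1 / L + 1) * (\<integral>\<^sup>+s. ?g (pt t s) * indicator {0<..<L} s \<partial>lborel)) * indicator {0<..<L} t \<partial>lborel)"
      unfolding open_int
      by (intro nn_integral_mono mult_right_mono) (use trace_line[OF f \<tau> orthonormal(5)] in \<open>auto simp: pt_def\<close>)
    also have "\<dots> = (\<integral>\<^sup>+t. ennreal (1 / L + 1) * (\<integral>\<^sup>+s. ?g (pt t s) * indicator {0<..<L} t * indicator {0<..<L} s \<partial>lborel) \<partial>lborel)"
      by (intro nn_integral_cong) (auto simp: indicator_def)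
    also have "\<dots> = ennreal (1 / L + 1) * (\<integral>\<^sup>+t. \<integral>\<^sup>+s. ?g (pt t s) * indicator {0<..<L} t * indicator {0<..<L} s \<partial>lborel \<partial>lborel)"
    proof (rule nn_integral_cmult)
      have "(\<lambda>p. ?g (pt (fst p) (snd p)) * indicator {0<..<L} (fst p) * indicator {0<..<L} (snd p)) \<in> borel_measurable (lborel \<Otimes>\<^sub>M lborel)"
        using ptm by measurable
      from lborel.borel_measurable_nn_integral_fst[OF this]
      show "(\<lambda>t. \<integral>\<^sup>+s. ?g (pt t s) * indicator {0<..<L} t * indicator {0<..<L} s \<partial>lborel) \<in> borel_measurable lborel" by simp
    qed
    finally show ?thesis unfolding nn_integral_square(1)[OF gm] .
  qed
  have B: "(\<integral>\<^sup>+t. ennreal ((norm (f (pt \<tau> t)))\<^sup>2) * indicator {0..L} t \<partial>lborel) \<le> ennreal (1 / L + 1) * (\<integral>\<^sup>+x. ?g x \<partial>M)"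
    if \<tau>: "\<tau> \<in> {0..L}" for \<tau>
  proof -
    have pt': "pt s t = (a + t *\<^sub>R perp e) + s *\<^sub>R e" for s t by (simp add: pt_def)
    have "(\<integral>\<^sup>+t. ennreal ((norm (f (pt \<tau> t)))\<^sup>2) * indicator {0..L} t \<partial>lborel)
      \<le> (\<integral>\<^sup>+t. (ennreal (1 / L + 1) * (\<integral>\<^sup>+s. ?g (pt s t) * indicator {0<..<L} s \<partial>lborel)) * indicator {0<..<L} t \<partial>lborel)"
      unfolding open_int
      by (intro nn_integral_mono mult_right_mono) (use trace_line[OF f \<tau> norm_e] in \<open>auto simp: pt'\<close>)
    also have "\<dots> = (\<integral>\<^sup>+t. ennreal (1 / L + 1) * (\<integral>\<^sup>+s. ?g (pt s t) * indicator {0<..<L} s * indicator {0<..<L} t \<partial>lborel) \<partial>lborel)"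
      by (intro nn_integral_cong) (auto simp: indicator_def)
    also have "\<dots> = ennreal (1 / L + 1) * (\<integral>\<^sup>+t. \<integral>\<^sup>+s. ?g (pt s t) * indicator {0<..<L} s * indicator {0<..<L} t \<partial>lborel \<partial>lborel)"
    proof (rule nn_integral_cmult)
      have ptm': "(\<lambda>p. pt (snd p) (fst p)) \<in> borel_measurable (lborel \<Otimes>\<^sub>M lborel)"
        unfolding pt_def lborel_prod by (simp, intro borel_measurable_continuous_onI continuous_intros)
      have "(\<lambda>p. ?g (pt (snd p) (fst p)) * indicator {0<..<L} (snd p) * indicator {0<..<L} (fst p)) \<in> borel_measurable (lborel \<Otimes>\<^sub>M lborel)"
        using ptm' by measurable
      from lborel.borel_measurable_nn_integral_fst[OF this]
      show "(\<lambda>t. \<integral>\<^sup>+s. ?g (pt s t) * indicator {0<..<L} s * indicator {0<..<L} t \<partial>lborel) \<in> borel_measurable lborel" by simp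
    qed
    finally show ?thesis unfolding nn_integral_square(2)[OF gm] .
  qed
  consider "square_edge a e L k = (\<lambda>t. pt t 0)" | "square_edge a e L k = (\<lambda>t. pt L t)"
    | "square_edge a e L k = (\<lambda>t. pt t L)" | "square_edge a e L k = (\<lambda>t. pt 0 t)"
    unfolding square_edge_pt[abs_def] by (cases "k = 0"; cases "k = 1"; cases "k = 2") simp_all
  then show ?thesis
  proof cases
    case 1 show ?thesis unfolding 1 by (rule A[OF c(1)])
  next
    case 2 show ?thesis unfolding 2 by (rule B[OF c(2)])
  next
    case 3 show ?thesis unfolding 3 by (rule A[OF c(2)])
  next
    case 4 show ?thesis unfolding 4 by (rule B[OF c(1)])
  qed
qed

text \<open>Each of the four edges contributes \<open>1 / L + 1\<close> to the squared norm; the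
  square root of the sum is the trace constant.\<close>

sublocale trace_domain "open_square a e L" "pt (L / 2) (L / 2)" "L / 4" \<Gamma> "sqrt (4 * (1 / L + 1))"
proof
  show "0 \<le> sqrt (4 * (1 / L + 1))" using L_pos by simp
  fix f :: "real^2 \<Rightarrow> complex" assume f: "f \<in> C1"
  have fb: "f \<in> borel_measurable borel" by (intro borel_measurable_continuous_onI C1_continuous f)
  have fm: "f \<in> borel_measurable \<Gamma>" using fb unfolding square_boundary_def by simp
  have f2: "f \<in> L2 M" and g2: "cgrad f \<in> L2 M"
    by (intro continuous_L2 C1_continuous continuous_on_cgrad f)+
  have I: "(\<integral>\<^sup>+x. ennreal ((norm (f x))\<^sup>2 + (norm (cgrad f x))\<^sup>2) \<partial>M) = ennreal ((H1norm (open_square a e L) f)\<^sup>2)"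
  proof -
    have "(\<integral>\<^sup>+x. ennreal ((norm (f x))\<^sup>2 + (norm (cgrad f x))\<^sup>2) \<partial>M) = ennreal ((L2norm M f)\<^sup>2 + (L2norm M (cgrad f))\<^sup>2)"
      using L2D[OF f2] L2D[OF g2] by (subst nn_integral_eq_integral) (auto simp: L2norm_sq)
    then show ?thesis
      unfolding H1norm_sq L2norm_wgrad[OF f2 g2 weak_gradient_C1[OF f]] .
  qed
  have "(\<integral>\<^sup>+x. ennreal ((norm (f x))\<^sup>2) \<partial>\<Gamma>)
      = (\<Sum>k<4. \<integral>\<^sup>+t. ennreal ((norm (f (square_edge a e L k t)))\<^sup>2) * indicator {0..L} t \<partial>lborel)"
    using fb by (intro nn_integral_boundary) measurable
  also have "\<dots> \<le> (\<Sum>k<4::nat. ennreal (1 / L + 1) * ennreal ((H1norm (open_square a e L) f)\<^sup>2))"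
    unfolding I[symmetric] by (intro sum_mono trace_edge f)
  also have "\<dots> = ennreal (\<Sum>k<4::nat. (1 / L + 1) * (H1norm (open_square a e L) f)\<^sup>2)"
  proof -
    have *: "(\<Sum>k<4::nat. ennreal A * ennreal B) = ennreal (\<Sum>k<4::nat. A * B)" if "0 \<le> A" "0 \<le> B" for A B
      using that by (simp add: ennreal_mult[symmetric] sum_ennreal del: sum_constant)
    show ?thesis by (rule *) (use L_pos in auto)
  qed
  also have "\<dots> = ennreal ((sqrt (4 * (1 / L + 1)) * H1norm (open_square a e L) f)\<^sup>2)"
    using L_pos by (simp add: power_mult_distrib)
  finally have le: "(\<integral>\<^sup>+x. ennreal ((norm (f x))\<^sup>2) \<partial>\<Gamma>) \<le> ennreal ((sqrt (4 * (1 / L + 1)) * H1norm (open_square a e L) f)\<^sup>2)" .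
  have "0 \<le> sqrt (4 * (1 / L + 1)) * H1norm (open_square a e L) f" using L_pos by simp
  from L2_of_nn_integral[OF fm le this]
  show "f \<in> L2 \<Gamma>" "L2norm \<Gamma> f \<le> sqrt (4 * (1 / L + 1)) * H1norm (open_square a e L) f" .
qed

text \<open>Every edge point has a coordinate equal to \<open>0\<close> or \<open>L\<close>, which
  the open square excludes. Consequently \<open>C1\<close> functions that vanish outside the square
  have trace zero.\<close>

lemma boundary_disjoint: "AE x in \<Gamma>. x \<notin> open_square a e L"
proof -
  have [measurable]: "open_square a e L \<in> sets borel" using open_dom by simp
  have "(\<integral>\<^sup>+x. indicator (open_square a e L) x \<partial>\<Gamma>)
      = (\<Sum>k<4. \<integral>\<^sup>+t. indicator (open_square a e L) (square_edge a e L k t) * indicator {0..L} t \<partial>lborel)"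
    by (rule nn_integral_boundary) measurable
  also have "\<dots> = 0"
  proof -
    have "square_edge a e L k t \<notin> open_square a e L" for k t
      by (simp add: square_edge_pt pt_in_square)
    then show ?thesis by simp
  qed
  finally have "emeasure \<Gamma> (open_square a e L) = 0"
    by (subst (asm) nn_integral_indicator) (auto simp: square_boundary_def)
  then show ?thesis by (intro AE_not_in null_setsI) (auto simp: square_boundary_def)
qed

end

subsection \<open>Averaging over the cells of a partition\<close>

locale partitioned_domain = convex_domain +
  fixes N :: nat and Q :: "nat \<Rightarrow> (real^2) set"
  assumes partition: "cell_partition \<Omega> N Q"
    and cell_pos: "i \<in> {1..N} \<Longrightarrow> 0 < measure lebesgue (Q i)"
begin

abbreviation "P \<equiv> local_average N Q"

lemma cell_subset: "i \<in> {1..N} \<Longrightarrow> Q i \<subseteq> \<Omega>"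
  using partition by (auto simp: cell_partition_def)

lemma cell_cover:
  assumes "x \<in> \<Omega>"
  obtains i where "i \<in> {1..N}" "x \<in> Q i"
  using assms partition by (auto simp: cell_partition_def)

lemma cell_unique: "i \<in> {1..N} \<Longrightarrow> j \<in> {1..N} \<Longrightarrow> x \<in> Q i \<Longrightarrow> x \<in> Q j \<Longrightarrow> i = j"
  using partition unfolding cell_partition_def disjoint_family_on_def by blast

lemma cell_sets: "i \<in> {1..N} \<Longrightarrow> Q i \<in> sets lebesgue"
  using partition by (auto simp: cell_partition_def)

lemma cell_lmeasurable: "i \<in> {1..N} \<Longrightarrow> Q i \<in> lmeasurable"
  by (rule fmeasurableI2[OF lmeas cell_subset cell_sets])

lemma cell_sets_M: "i \<in> {1..N} \<Longrightarrow> Q i \<in> sets M"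
  using cell_sets cell_subset by (auto simp: sets_restrict_space_iff)

lemma sum_indicator_cell:
  fixes c :: "nat \<Rightarrow> 'b::real_vector"
  assumes "i \<in> {1..N}" "x \<in> Q i"
  shows "(\<Sum>j\<in>{1..N}. indicator (Q j) x *\<^sub>R c j) = c i"
proof -
  have "indicator (Q j) x *\<^sub>R c j = (if j = i then c i else 0)" if "j \<in> {1..N}" for j
    using cell_unique[OF that assms(1) _ assms(2)] assms(2) by (cases "j = i") (auto simp: indicator_def)
  then have "(\<Sum>j\<in>{1..N}. indicator (Q j) x *\<^sub>R c j) = (\<Sum>j\<in>{1..N}. if j = i then c i else 0)"
    by (rule sum.cong[OF refl])
  then show ?thesis using assms(1) by simp
qed

lemma average_cell:
  assumes "i \<in> {1..N}" "x \<in> Q i"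
  shows "P g x = (1 / measure lebesgue (Q i)) *\<^sub>R (\<integral>z. g z \<partial>lebesgue_on (Q i))"
  using sum_indicator_cell[OF assms, of "\<lambda>i. (1 / measure lebesgue (Q i)) *\<^sub>R (\<integral>z. g z \<partial>lebesgue_on (Q i))"]
  by (simp add: local_average_def)

text \<open>Values outside the domain are left free, which suits functions that are only integrated
  over \<open>\<Omega>\<close>, and makes the notion stable under pointwise operations.\<close>

definition cellwise :: "(real^2 \<Rightarrow> 'b) \<Rightarrow> bool" where
  "cellwise s \<longleftrightarrow> (\<forall>i\<in>{1..N}. \<exists>c. \<forall>x\<in>Q i. s x = c)"

lemma cellwise_average: "cellwise (P g)"
  unfolding cellwise_def using average_cell by metis

lemma cellwise_comp: "cellwise s \<Longrightarrow> cellwise (\<lambda>x. f (s x))"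
  unfolding cellwise_def by metis

lemma cellwise_comp2: "cellwise s \<Longrightarrow> cellwise t \<Longrightarrow> cellwise (\<lambda>x. f (s x) (t x))"
  unfolding cellwise_def by metis

lemma cellwise_repr:
  fixes s :: "real^2 \<Rightarrow> 'b::real_vector"
  assumes "cellwise s"
  obtains c where "\<And>x. x \<in> \<Omega> \<Longrightarrow> s x = (\<Sum>i\<in>{1..N}. indicator (Q i) x *\<^sub>R c i)"
    "\<And>i x. i \<in> {1..N} \<Longrightarrow> x \<in> Q i \<Longrightarrow> s x = c i"
proof -
  from assms obtain c where c: "\<And>i x. i \<in> {1..N} \<Longrightarrow> x \<in> Q i \<Longrightarrow> s x = c i"
    unfolding cellwise_def by metis
  have "s x = (\<Sum>i\<in>{1..N}. indicator (Q i) x *\<^sub>R c i)" if "x \<in> \<Omega>" for x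
    by (rule cell_cover[OF that]) (simp only: sum_indicator_cell c)
  then show ?thesis using c by (rule that)
qed

lemma cellwise_measurable:
  fixes s :: "real^2 \<Rightarrow> 'b::{banach,second_countable_topology}"
  assumes "cellwise s"
  shows "s \<in> borel_measurable M"
proof -
  obtain c where c: "\<And>x. x \<in> \<Omega> \<Longrightarrow> s x = (\<Sum>i\<in>{1..N}. indicator (Q i) x *\<^sub>R c i)"
    by (rule cellwise_repr[OF assms]) blast
  have "(\<lambda>x. \<Sum>i\<in>{1..N}. indicator (Q i) x *\<^sub>R c i) \<in> borel_measurable M"
    by (intro borel_measurable_sum borel_measurable_scaleR borel_measurable_indicator cell_sets_M borel_measurable_const)
  then show ?thesis by (subst measurable_cong[OF c]) auto
qed

lemma cellwise_bounded:
  fixes s :: "real^2 \<Rightarrow> 'b::real_normed_vector"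
  assumes "cellwise s"
  obtains B where "\<And>x. x \<in> \<Omega> \<Longrightarrow> norm (s x) \<le> B"
proof -
  obtain c where c: "\<And>i x. i \<in> {1..N} \<Longrightarrow> x \<in> Q i \<Longrightarrow> s x = c i"
    by (rule cellwise_repr[OF assms]) blast
  have "norm (s x) \<le> (\<Sum>i\<in>{1..N}. norm (c i))" if x: "x \<in> \<Omega>" for x
  proof -
    obtain i where i: "i \<in> {1..N}" "x \<in> Q i" by (rule cell_cover[OF x])
    show ?thesis unfolding c[OF i] by (rule member_le_sum[OF i(1)]) auto
  qed
  then show ?thesis by (rule that)
qed

lemma cellwise_L2:
  fixes s :: "real^2 \<Rightarrow> 'b::{banach,second_countable_topology}"
  assumes "cellwise s"
  shows "s \<in> L2 M"
proof -
  obtain B where "\<And>x. x \<in> \<Omega> \<Longrightarrow> norm (s x) \<le> B" by (rule cellwise_bounded[OF assms]) blast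
  then show ?thesis by (intro L2_bounded[OF cellwise_measurable[OF assms], of B]) auto
qed

lemma average_L2: "P g \<in> L2 M"
  by (rule cellwise_L2[OF cellwise_average])

lemma integral_cells:
  fixes f :: "real^2 \<Rightarrow> 'b::{banach,second_countable_topology}"
  assumes f: "integrable M f"
  shows "(\<integral>x. f x \<partial>M) = (\<Sum>i\<in>{1..N}. \<integral>x. f x \<partial>lebesgue_on (Q i))"
    and "i \<in> {1..N} \<Longrightarrow> integrable (lebesgue_on (Q i)) f"
proof -
  have L: "integrable lebesgue (\<lambda>x. indicator \<Omega> x *\<^sub>R f x)"
    using f by (subst (asm) integrable_restrict_space) auto
  have ind: "indicator (Q i) x *\<^sub>R f x = indicator (Q i) x *\<^sub>R (indicator \<Omega> x *\<^sub>R f x)" if "i \<in> {1..N}" for i x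
    using cell_subset[OF that] by (auto simp: indicator_def)
  have Qi: "integrable lebesgue (\<lambda>x. indicator (Q i) x *\<^sub>R f x)" if "i \<in> {1..N}" for i
    unfolding ind[OF that] by (rule integrable_mult_indicator[OF cell_sets[OF that] L])
  then show "integrable (lebesgue_on (Q i)) f" if "i \<in> {1..N}" for i
    using cell_sets[OF that] that by (subst integrable_restrict_space) auto
  have "(\<integral>x. f x \<partial>M) = (\<integral>x. indicator \<Omega> x *\<^sub>R f x \<partial>lebesgue)"
    by (subst integral_restrict_space) auto
  also have "\<dots> = (\<integral>x. (\<Sum>i\<in>{1..N}. indicator (Q i) x *\<^sub>R f x) \<partial>lebesgue)"
  proof (rule Bochner_Integration.integral_cong[OF refl])
    fix x
    show "indicator \<Omega> x *\<^sub>R f x = (\<Sum>i\<in>{1..N}. indicator (Q i) x *\<^sub>R f x)"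
    proof (cases "x \<in> \<Omega>")
      case True
      have "f x = (\<Sum>i\<in>{1..N}. indicator (Q i) x *\<^sub>R f x)"
        by (rule cell_cover[OF True]) (simp only: sum_indicator_cell[of _ x "\<lambda>_. f x"])
      then show ?thesis using True by (simp only: indicator_simps(1) scaleR_one)
    next
      case False
      then have "indicator (Q i) x *\<^sub>R f x = 0" if "i \<in> {1..N}" for i
        using cell_subset[OF that] by (auto simp: indicator_def)
      then have "(\<Sum>i\<in>{1..N}. indicator (Q i) x *\<^sub>R f x) = 0" by (rule sum.neutral[OF ballI])
      then show ?thesis using False by simp
    qed
  qed
  also have "\<dots> = (\<Sum>i\<in>{1..N}. \<integral>x. indicator (Q i) x *\<^sub>R f x \<partial>lebesgue)"
    by (intro Bochner_Integration.integral_sum Qi)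
  also have "\<dots> = (\<Sum>i\<in>{1..N}. \<integral>x. f x \<partial>lebesgue_on (Q i))"
    using cell_sets by (intro sum.cong refl) (subst integral_restrict_space, auto)
  finally show "(\<integral>x. f x \<partial>M) = (\<Sum>i\<in>{1..N}. \<integral>x. f x \<partial>lebesgue_on (Q i))" .
qed

text \<open>On each cell \<open>s\<close> is constant, while \<open>g - P g\<close> has mean zero
  because the cell has positive measure.\<close>

lemma average_orthogonal:
  fixes g s :: "real^2 \<Rightarrow> complex"
  assumes g: "g \<in> L2 M" and s: "cellwise s"
  shows "(\<integral>x. s x * (g x - P g x) \<partial>M) = 0"
proof -
  obtain c where c: "\<And>i x. i \<in> {1..N} \<Longrightarrow> x \<in> Q i \<Longrightarrow> s x = c i" by (rule cellwise_repr[OF s]) blast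
  have d: "(\<lambda>x. g x - P g x) \<in> L2 M" by (rule L2_diff[OF g average_L2])
  have "integrable M (\<lambda>x. (g x - P g x) * cnj (cnj (s x)))"
    by (rule L2inner_integrable[OF d cellwise_L2[OF cellwise_comp[OF s]]])
  then have "integrable M (\<lambda>x. s x * (g x - P g x))" by (simp add: mult.commute)
  from integral_cells(1)[OF this]
  have "(\<integral>x. s x * (g x - P g x) \<partial>M) = (\<Sum>i\<in>{1..N}. \<integral>x. s x * (g x - P g x) \<partial>lebesgue_on (Q i))" .
  also have "\<dots> = 0"
  proof (rule sum.neutral, rule ballI)
    fix i assume i: "i \<in> {1..N}"
    interpret Qi: finite_measure "lebesgue_on (Q i)" by (rule finite_measure_lebesgue_on[OF cell_lmeasurable[OF i]])
    let ?I = "\<integral>z. g z \<partial>lebesgue_on (Q i)" and ?m = "measure lebesgue (Q i)"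
    have gi: "integrable (lebesgue_on (Q i)) g" by (rule integral_cells(2)[OF L2_integrable[OF g] i])
    have "(\<integral>x. s x * (g x - P g x) \<partial>lebesgue_on (Q i)) = (\<integral>x. c i * (g x - (1 / ?m) *\<^sub>R ?I) \<partial>lebesgue_on (Q i))"
      by (rule Bochner_Integration.integral_cong) (simp_all add: c[OF i] average_cell[OF i])
    also have "\<dots> = c i * (?I - measure (lebesgue_on (Q i)) (Q i) *\<^sub>R ((1 / ?m) *\<^sub>R ?I))"
      using gi by simp
    also have "measure (lebesgue_on (Q i)) (Q i) = ?m"
      using cell_sets[OF i] by (simp add: measure_restrict_space)
    finally show "(\<integral>x. s x * (g x - P g x) \<partial>lebesgue_on (Q i)) = 0" using cell_pos[OF i] by simp
  qed
  finally show ?thesis .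
qed

text \<open>Orthogonality makes the squared norm of \<open>P g\<close> equal to the inner product of
  \<open>g\<close> with \<open>P g\<close>; Cauchy-Schwarz then gives the bound.\<close>

lemma L2norm_average_le:
  fixes g :: "real^2 \<Rightarrow> complex"
  assumes g: "g \<in> L2 M"
  shows "L2norm M (P g) \<le> L2norm M g"
proof -
  have d: "(\<lambda>x. g x - P g x) \<in> L2 M" by (rule L2_diff[OF g average_L2])
  have "L2inner M (\<lambda>x. g x - P g x) (P g) = 0"
    using average_orthogonal[OF g cellwise_comp[OF cellwise_average, of cnj g]] by (simp add: L2inner_def mult.commute)
  moreover have "L2inner M (\<lambda>x. g x + (- 1) * P g x) (P g) = L2inner M g (P g) + (- 1) * L2inner M (P g) (P g)"
    by (rule L2inner_add_scale_left[OF g average_L2 average_L2])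
  ultimately have "of_real ((L2norm M (P g))\<^sup>2) = L2inner M g (P g)"
    by (simp add: L2inner_self)
  then have "(L2norm M (P g))\<^sup>2 \<le> L2norm M g * L2norm M (P g)"
    using L2inner_bound[OF g average_L2[of g]] by (metis L2norm_nonneg norm_of_real abs_of_nonneg zero_le_power2)
  then have *: "L2norm M (P g) * L2norm M (P g) \<le> L2norm M g * L2norm M (P g)"
    by (simp add: power2_eq_square)
  show ?thesis
  proof (cases "L2norm M (P g) = 0")
    case False
    then have "0 < L2norm M (P g)" using L2norm_nonneg[of M "P g"] by linarith
    with * show ?thesis by (rule mult_right_le_imp_le)
  qed simp
qed

lemma AE_cell:
  assumes "AE x in M. R x" "i \<in> {1..N}"
  shows "AE x in lebesgue_on (Q i). R x"
  using assms(1) cell_subset[OF assms(2)] cell_sets[OF assms(2)]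
  by (auto simp: AE_restrict_space_iff elim!: eventually_mono)

lemma average_bounds:
  fixes w :: "real^2 \<Rightarrow> real"
  assumes w: "integrable M w" and b: "AE x in M. l \<le> w x \<and> w x \<le> u" and x: "x \<in> \<Omega>"
  shows "l \<le> P w x \<and> P w x \<le> u"
proof -
  obtain i where i: "i \<in> {1..N}" "x \<in> Q i" by (rule cell_cover[OF x])
  interpret Qi: finite_measure "lebesgue_on (Q i)" by (rule finite_measure_lebesgue_on[OF cell_lmeasurable[OF i(1)]])
  let ?I = "\<integral>z. w z \<partial>lebesgue_on (Q i)" and ?m = "measure lebesgue (Q i)"
  have m: "measure (lebesgue_on (Q i)) (Q i) = ?m" using cell_sets[OF i(1)] by (simp add: measure_restrict_space)
  have wi: "integrable (lebesgue_on (Q i)) w" by (rule integral_cells(2)[OF w i(1)])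
  have b': "AE x in lebesgue_on (Q i). l \<le> w x" "AE x in lebesgue_on (Q i). w x \<le> u"
    using AE_cell[OF b i(1)] by auto
  have "(\<integral>x. l \<partial>lebesgue_on (Q i)) \<le> ?I" by (rule integral_mono_AE[OF _ wi b'(1)]) simp
  moreover have "?I \<le> (\<integral>x. u \<partial>lebesgue_on (Q i))" by (rule integral_mono_AE[OF wi _ b'(2)]) simp
  ultimately show ?thesis
    unfolding average_cell[OF i] using cell_pos[OF i(1)] by (simp add: m field_simps)
qed

lemma norm_average_le:
  fixes g :: "real^2 \<Rightarrow> complex"
  assumes g: "integrable M g" and b: "AE x in M. norm (g x) \<le> B" and x: "x \<in> \<Omega>"
  shows "norm (P g x) \<le> B"
proof -
  obtain i where i: "i \<in> {1..N}" "x \<in> Q i" by (rule cell_cover[OF x])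
  interpret Qi: finite_measure "lebesgue_on (Q i)" by (rule finite_measure_lebesgue_on[OF cell_lmeasurable[OF i(1)]])
  let ?I = "\<integral>z. g z \<partial>lebesgue_on (Q i)" and ?m = "measure lebesgue (Q i)"
  have m: "measure (lebesgue_on (Q i)) (Q i) = ?m" using cell_sets[OF i(1)] by (simp add: measure_restrict_space)
  have gi: "integrable (lebesgue_on (Q i)) g" by (rule integral_cells(2)[OF g i(1)])
  have "norm ?I \<le> (\<integral>z. norm (g z) \<partial>lebesgue_on (Q i))" by (rule integral_norm_bound)
  also have "\<dots> \<le> (\<integral>z. B \<partial>lebesgue_on (Q i))"
    by (rule integral_mono_AE) (use gi AE_cell[OF b i(1)] in auto)
  also have "\<dots> = ?m * B" by (simp add: m)
  finally show ?thesis
    unfolding average_cell[OF i] using cell_pos[OF i(1)] by (simp add: field_simps)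
qed

lemma average_of_real: "P (\<lambda>x. complex_of_real (w x)) x = of_real (P w x)"
  by (simp add: local_average_def scaleR_conv_of_real)

text \<open>Averages inherit the bounds \<open>l\<close> and \<open>u\<close>, so the oscillation is
  at most \<open>u - l\<close> pointwise, and one of the two factors of its square may be replaced
  by \<open>u - l\<close>.\<close>

lemma L2norm_diff_average:
  fixes w :: "real^2 \<Rightarrow> real"
  assumes w: "w \<in> borel_measurable M" and b: "AE x in M. l \<le> w x \<and> w x \<le> u"
  shows "(L2norm M (\<lambda>x. w x - P w x))\<^sup>2 \<le> (u - l) * (\<integral>x. \<bar>w x - P w x\<bar> \<partial>M)"
proof -
  have wb: "AE x in M. norm (w x) \<le> max \<bar>l\<bar> \<bar>u\<bar>" using b by eventually_elim auto
  have w2: "w \<in> L2 M" by (rule L2_bounded[OF w wb])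
  have d: "(\<lambda>x. w x - P w x) \<in> L2 M" by (rule L2_diff[OF w2 average_L2])
  have "AE x in M. (norm (w x - P w x))\<^sup>2 \<le> (u - l) * \<bar>w x - P w x\<bar>"
    using b AE_space
  proof eventually_elim
    case (elim x)
    then have "l \<le> P w x \<and> P w x \<le> u" using average_bounds[OF L2_integrable[OF w2] b] by simp
    with elim have "\<bar>w x - P w x\<bar> \<le> u - l" by auto
    from mult_right_mono[OF this, of "\<bar>w x - P w x\<bar>"] show ?case by (simp add: power2_eq_square)
  qed
  then have "(L2norm M (\<lambda>x. w x - P w x))\<^sup>2 \<le> (\<integral>x. (u - l) * \<bar>w x - P w x\<bar> \<partial>M)"
    unfolding L2norm_sq using L2D(2)[OF d] L2_integrable[OF d] by (intro integral_mono_AE) auto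
  then show ?thesis by simp
qed

end

subsection \<open>Coercivity and the dual problem\<close>

lemma L2inner_scale_left: "L2inner M (\<lambda>x. c * f x) g = c * L2inner M f g"
  by (simp add: L2inner_def mult.assoc)

lemma L2inner_diff_left:
  assumes "f \<in> L2 M" "g \<in> L2 M" "h \<in> L2 M"
  shows "L2inner M (\<lambda>x. f x - g x) h = L2inner M f h - L2inner M g h"
  using L2inner_add_scale_left[OF assms, of "-1"] by simp

lemma L2_bounded_times:
  fixes f :: "'a \<Rightarrow> complex"
  assumes "f \<in> L2 M" "k \<in> borel_measurable M" "AE x in M. \<bar>k x\<bar> \<le> B"
  shows "(\<lambda>x. of_real (k x) * f x) \<in> L2 M"
proof (rule L2_dominated[OF assms(1)])
  show "(\<lambda>x. of_real (k x) * f x) \<in> borel_measurable M"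
    using assms(2) L2D(1)[OF assms(1)] by measurable
  show "AE x in M. norm (of_real (k x) * f x) \<le> B * norm (f x)"
    using assms(3) by eventually_elim (simp add: norm_mult mult_right_mono)
qed

lemma L2norm_bounded_times:
  fixes f :: "'a \<Rightarrow> complex"
  assumes "f \<in> L2 M" "0 \<le> B" "AE x in M. \<bar>k x\<bar> \<le> B"
  shows "L2norm M (\<lambda>x. of_real (k x) * f x) \<le> B * L2norm M f"
  by (rule L2norm_le[OF assms(1,2)]) (use assms(3) in eventually_elim, simp add: norm_mult mult_right_mono)

lemma integral_product_bound:
  fixes T :: "'a \<Rightarrow> complex"
  assumes F: "F \<in> L2 M" and G: "G \<in> L2 M" and T: "T \<in> borel_measurable M" and C: "0 \<le> C"
    and le: "AE x in M. norm (T x) \<le> C * (norm (F x) * norm (G x))"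
  shows "integrable M T" "norm (\<integral>x. T x \<partial>M) \<le> C * (L2norm M F * L2norm M G)"
proof -
  have i: "integrable M (\<lambda>x. C * (norm (F x) * norm (G x)))"
    using L2_integrable_product[OF F G] by simp
  show T': "integrable M T"
    by (rule Bochner_Integration.integrable_bound[OF i T]) (use le in eventually_elim, simp)
  have "norm (\<integral>x. T x \<partial>M) \<le> (\<integral>x. norm (T x) \<partial>M)" by (rule integral_norm_bound)
  also have "\<dots> \<le> (\<integral>x. C * (norm (F x) * norm (G x)) \<partial>M)"
    by (rule integral_mono_AE[OF integrable_norm[OF T'] i le])
  also have "\<dots> \<le> C * (L2norm M F * L2norm M G)"
    using L2_Cauchy_Schwarz[OF F G] C by (simp add: mult_left_mono)
  finally show "norm (\<integral>x. T x \<partial>M) \<le> C * (L2norm M F * L2norm M G)" .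
qed

text \<open>\<open>A\<close>, \<open>G\<close> and \<open>Y\<close> stand for the squared norms of
  gradient, trace and function. The chain is \<open>min 1 k * lam * (A + Y) \<le> min 1 k * (A + G)
  \<le> A + k * G\<close>; the zero-order term is absorbed by
  \<open>K * Y \<le> sqrt 2 * K * (A + Y)\<close>.\<close>

lemma coercive_real_part:
  fixes A G Y K R k lam :: real
  assumes "0 \<le> A" "0 \<le> G" "0 \<le> Y" "0 \<le> K" "0 < k"
    and R: "A - K * Y \<le> R" and lam: "lam * (A + Y) \<le> A + G"
  shows "sqrt 2 * (lam * min 1 k / sqrt 2 - K) * (A + Y) \<le> R + k * G"
proof -
  have "min 1 k * (lam * (A + Y)) \<le> min 1 k * (A + G)" using lam assms(5) by (intro mult_left_mono) auto
  also have "\<dots> \<le> 1 * A + k * G" unfolding distrib_left using assms by (intro add_mono mult_right_mono) auto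
  finally have 1: "min 1 k * lam * (A + Y) \<le> A + k * G" by simp
  have "1 * (K * Y) \<le> sqrt 2 * (K * (A + Y))" using assms by (intro mult_mono) auto
  moreover have "sqrt 2 * (lam * min 1 k / sqrt 2 - K) * (A + Y) = min 1 k * lam * (A + Y) - sqrt 2 * (K * (A + Y))"
    by (simp add: algebra_simps)
  ultimately show ?thesis using 1 R by simp
qed

text \<open>The left side is the real part of \<open>(1 + \<i>) * z\<close>, and
  \<open>1 + \<i>\<close> has modulus \<open>sqrt 2\<close>.\<close>

lemma norm_ge_rotated: "Re z - Im z \<le> sqrt 2 * norm z"
proof -
  have "(Re z - Im z)\<^sup>2 \<le> 2 * ((Re z)\<^sup>2 + (Im z)\<^sup>2)"
    using zero_le_power2[of "Re z + Im z"] by (simp add: power2_sum power2_diff)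
  then have "(Re z - Im z)\<^sup>2 \<le> (sqrt 2 * norm z)\<^sup>2" by (simp add: power_mult_distrib cmod_power2)
  then show ?thesis by (rule power2_le_imp_le) simp
qed

text \<open>The second coercivity constant does not degenerate as the first one tends to \<open>0\<close>. It comes from
  testing \<open>z\<close> against the direction \<open>(k, -(1 + K))\<close>, normal to the segment on which
  \<open>(A - K Y, - k G)\<close> lies when \<open>A + Y\<close> is fixed and \<open>A + G = lam (A + Y)\<close>.\<close>

lemma coercive_nondegenerate:
  fixes A G Y K R k lam r :: real
  assumes nn: "0 \<le> A" "0 \<le> G" "0 \<le> Y" "0 \<le> r" "0 < k"
    and R: "A - k\<^sup>2 * (1 + r) * Y \<le> R" and lam: "lam * (A + Y) \<le> A + G" and lam1: "lam \<le> 1"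
    and c: "k\<^sup>2 * (1 + r) < min k 1 / sqrt 2 * lam"
  shows "sqrt 2 * k\<^sup>2 * r * (A + Y) \<le> sqrt (R\<^sup>2 + (k * G)\<^sup>2)"
proof -
  define K where "K = k\<^sup>2 * (1 + r)"
  have K0: "0 \<le> K" using nn by (simp add: K_def)
  have kK: "k\<^sup>2 * r = K - k\<^sup>2" by (simp add: K_def algebra_simps)
  have s2: "sqrt 2 * sqrt 2 = (2::real)" "0 < sqrt (2::real)" by simp_all
  have lam0: "0 \<le> lam"
  proof (rule ccontr)
    assume "\<not> 0 \<le> lam"
    then have "min k 1 / sqrt 2 * lam \<le> 0" using nn(5) by (intro mult_nonneg_nonpos) auto
    then show False using c K0 by (simp add: K_def)
  qed
  \<comment> \<open>Here \<open>min k 1\<close> is estimated by \<open>k\<close>, which leads to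
    \<open>sqrt 2 * K \<le> k * lam\<close>; \<open>lam \<le> 1\<close> then gives
    \<open>kl2\<close>, free of \<open>lam\<close>.\<close>
  have "min k 1 / sqrt 2 * lam \<le> k / sqrt 2 * lam" using lam0 by (intro mult_right_mono divide_right_mono) auto
  then have "K < k / sqrt 2 * lam" using c by (simp add: K_def)
  then have "sqrt 2 * K \<le> sqrt 2 * (k / sqrt 2 * lam)" by (intro mult_left_mono) auto
  then have kl: "sqrt 2 * K \<le> k * lam" by simp
  have kl2: "sqrt 2 * K \<le> k" using kl mult_left_le[OF lam1, of k] nn(5) by linarith
  define D where "D = sqrt (k\<^sup>2 + (1 + K)\<^sup>2)"
  have D0: "0 < D" using K0 by (simp add: D_def add_nonneg_pos)
  \<comment> \<open>A polynomial bound for the length \<open>D\<close> of the test direction removes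
    the square root from what follows.\<close>
  have D: "D \<le> 1 + K + k\<^sup>2 / 2"
  proof -
    have "k\<^sup>2 + (1 + K)\<^sup>2 \<le> (1 + K + k\<^sup>2 / 2)\<^sup>2"
    proof -
      have "(1 + K + k\<^sup>2 / 2)\<^sup>2 = (1 + K)\<^sup>2 + k\<^sup>2 + (K * k\<^sup>2 + (k\<^sup>2 / 2)\<^sup>2)"
        by (simp add: power2_eq_square algebra_simps)
      moreover have "0 \<le> K * k\<^sup>2 + (k\<^sup>2 / 2)\<^sup>2" using K0 by simp
      ultimately show ?thesis by simp
    qed
    then have "D \<le> sqrt ((1 + K + k\<^sup>2 / 2)\<^sup>2)" unfolding D_def by (rule real_sqrt_le_mono)
    then show ?thesis using K0 by simp
  qed
  \<comment> \<open>The claimed constant times the length of the direction stays below the value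
    that the direction attains on the segment. The leading terms are compared by \<open>kl\<close>,
    the corrections by \<open>kl2\<close>.\<close>
  have main: "sqrt 2 * (K - k\<^sup>2) * D \<le> k * (lam * (1 + K) - K)"
  proof -
    have k2K: "0 \<le> K - k\<^sup>2" using kK nn(4) by (metis mult_nonneg_nonneg zero_le_power2)
    have "sqrt 2 * (K - k\<^sup>2) * D \<le> sqrt 2 * (K - k\<^sup>2) * (1 + K + k\<^sup>2 / 2)"
      using D k2K by (intro mult_left_mono) auto
    also have "\<dots> = sqrt 2 * K * (1 + K) - (sqrt 2 * k\<^sup>2 * (1 + K + k\<^sup>2 / 2) - sqrt 2 * K * k\<^sup>2 / 2)"
      by (simp add: algebra_simps)
    also have "\<dots> \<le> k * lam * (1 + K) - k * K"
    proof -
      have "sqrt 2 * K * (1 + K) \<le> k * lam * (1 + K)" using kl K0 by (intro mult_right_mono) auto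
      moreover have "k * K \<le> sqrt 2 * k\<^sup>2 * (1 + K + k\<^sup>2 / 2) - sqrt 2 * K * k\<^sup>2 / 2"
      proof -
        have "sqrt 2 * (k * K) = k * (sqrt 2 * K)" by simp
        also have "\<dots> \<le> k * k" using kl2 nn(5) by (intro mult_left_mono) auto
        finally have "sqrt 2 * (sqrt 2 * (k * K)) \<le> sqrt 2 * k\<^sup>2" by (simp add: power2_eq_square)
        then have "2 * (k * K) \<le> sqrt 2 * k\<^sup>2" by (simp only: mult.assoc[symmetric] s2)
        moreover have "0 \<le> k * K" using nn(5) K0 by simp
        moreover have "0 \<le> sqrt 2 * k\<^sup>2" "0 \<le> sqrt 2 * k\<^sup>2 * K" "0 \<le> sqrt 2 * k\<^sup>2 * k\<^sup>2" using K0 by simp_all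
        moreover have "sqrt 2 * k\<^sup>2 * (1 + K + k\<^sup>2 / 2) - sqrt 2 * K * k\<^sup>2 / 2
            = sqrt 2 * k\<^sup>2 + sqrt 2 * k\<^sup>2 * K / 2 + sqrt 2 * k\<^sup>2 * k\<^sup>2 / 2"
          by (simp add: algebra_simps)
        ultimately show ?thesis by linarith
      qed
      ultimately show ?thesis by linarith
    qed
    finally show ?thesis by (simp add: algebra_simps)
  qed
  \<comment> \<open>Cauchy-Schwarz in the plane for \<open>(R, k * G)\<close> and
    \<open>(k, 1 + K)\<close>, with the defect as an explicit square.\<close>
  have proj: "k * R + (1 + K) * (k * G) \<le> D * sqrt (R\<^sup>2 + (k * G)\<^sup>2)"
  proof -
    have "(k * R + (1 + K) * (k * G))\<^sup>2 \<le> (k\<^sup>2 + (1 + K)\<^sup>2) * (R\<^sup>2 + (k * G)\<^sup>2)"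
    proof -
      have "(k\<^sup>2 + (1 + K)\<^sup>2) * (R\<^sup>2 + (k * G)\<^sup>2) - (k * R + (1 + K) * (k * G))\<^sup>2 = (k * (k * G) - (1 + K) * R)\<^sup>2"
        by (simp add: power2_eq_square algebra_simps)
      then show ?thesis using zero_le_power2[of "k * (k * G) - (1 + K) * R"] by linarith
    qed
    then have "(k * R + (1 + K) * (k * G))\<^sup>2 \<le> (D * sqrt (R\<^sup>2 + (k * G)\<^sup>2))\<^sup>2"
      by (simp add: power_mult_distrib D_def)
    then show ?thesis by (rule power2_le_imp_le) (use D0 in simp)
  qed
  \<comment> \<open>Weighting the constraint on \<open>G\<close> by \<open>1 + K\<close> is what
    makes \<open>A\<close> and \<open>Y\<close> combine into the sum \<open>A + Y\<close>.\<close>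
  have "k * (lam * (1 + K) - K) * (A + Y) \<le> k * R + (1 + K) * (k * G)"
  proof -
    have "(lam * (A + Y) - A) * (1 + K) \<le> G * (1 + K)" using lam K0 by (intro mult_right_mono) auto
    moreover have "A - K * Y \<le> R" using R by (simp add: K_def)
    ultimately have "(lam * (1 + K) - K) * (A + Y) \<le> R + (1 + K) * G" by (simp add: algebra_simps)
    then have "k * ((lam * (1 + K) - K) * (A + Y)) \<le> k * (R + (1 + K) * G)" using nn(5) by (intro mult_left_mono) auto
    then show ?thesis by (simp add: algebra_simps)
  qed
  moreover have "sqrt 2 * (K - k\<^sup>2) * D * (A + Y) \<le> k * (lam * (1 + K) - K) * (A + Y)"
    by (rule mult_right_mono[OF main]) (use nn in simp)
  ultimately have "D * (sqrt 2 * (K - k\<^sup>2) * (A + Y)) \<le> D * sqrt (R\<^sup>2 + (k * G)\<^sup>2)"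
    using proj by (simp add: algebra_simps)
  then have "sqrt 2 * (K - k\<^sup>2) * (A + Y) \<le> sqrt (R\<^sup>2 + (k * G)\<^sup>2)" using D0 by simp
  then show ?thesis by (simp add: kK[symmetric] mult.assoc)
qed

context trace_domain
begin

lemma lam_le_1:
  assumes disj: "AE x in \<Gamma>. x \<notin> \<Omega>"
    and lam: "\<And>y. y \<in> H1 \<Omega> \<Longrightarrow> sqrt lam * H1norm \<Omega> y \<le> sqrt ((L2norm \<Gamma> (tr y))\<^sup>2 + (L2norm M (wgrad \<Omega> y))\<^sup>2)"
  shows "lam \<le> 1"
proof -
  have z0: "z0 \<in> \<Omega>" using ball_sub r0_pos by auto
  \<comment> \<open>The mollification kernel at \<open>z0\<close> serves as a compactly supported
    function; having integral one, it is not null.\<close>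
  define b where "b = ker (1 / 2) z0"
  define y where "y x = complex_of_real (b x)" for x
  have b: "b \<in> C1_compact \<Omega>" unfolding b_def by (rule ker_test_function(1)) (use z0 in auto)
  have b1: "b \<in> C1" using b by (simp add: C1_compact_def)
  have y1: "y \<in> C1"
  proof (rule C1I)
    show "(y has_derivative (\<lambda>v. of_real (frechet_derivative b (at x) v))) (at x)" for x
      unfolding y_def by (rule has_derivative_of_real[OF C1_has_derivative[OF b1]])
    show "continuous_on UNIV (\<lambda>x. complex_of_real (frechet_derivative b (at x) (axis i 1)))" for i
      using C1_partial_continuous[OF b1, of UNIV i] unfolding partial_deriv_def[abs_def] by (rule continuous_on_of_real)
  qed
  have y0: "y x = 0" if "x \<notin> \<Omega>" for x
    using b that by (auto simp: C1_compact_def y_def)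
  note yH = C1_H1(1)[OF y1]
  have "AE x in \<Gamma>. tr y x = 0" using tr_C1[OF y1] disj by eventually_elim (simp add: y0)
  then have t0: "L2norm \<Gamma> (tr y) = 0" using L2norm_eq_0_iff[OF tr_L2[OF yH]] by simp
  have "L2norm M y \<noteq> 0"
  proof
    assume "L2norm M y = 0"
    then have "AE x in M. y x = 0" using L2norm_eq_0_iff[OF H1D(1)[OF yH]] by simp
    then have "AE x in M. b x = 0" by eventually_elim (simp add: y_def)
    then have "(\<integral>x. b x \<partial>M) = 0" by (rule integral_eq_zero_AE)
    then show False using ker_integral(2)[of "1 / 2" z0] z0 by (simp add: b_def)
  qed
  then have p: "0 < H1norm \<Omega> y" using L2norm_le_H1norm(1)[of y] L2norm_nonneg[of M y] by linarith
  have "sqrt lam * H1norm \<Omega> y \<le> L2norm M (wgrad \<Omega> y)" using lam[OF yH] by (simp add: t0)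
  also have "\<dots> \<le> 1 * H1norm \<Omega> y" using L2norm_le_H1norm(2)[of y] by simp
  finally have "sqrt lam \<le> 1" using p by (rule mult_right_le_imp_le)
  then show ?thesis by simp
qed

text \<open>The constant 1 belongs to \<open>H2\<close>, so \<open>c3\<close> times a nonnegative
  norm is at least 1. The kernel with integral one shows that the domain is not null, which turns
  the almost everywhere bound into a plain inequality.\<close>

lemma c3_nonneg:
  assumes "\<And>y. y \<in> H2 \<Omega> \<Longrightarrow> AE x in M. norm (y x) \<le> c3 * H2norm \<Omega> y"
  shows "0 \<le> c3"
proof -
  have z0: "z0 \<in> \<Omega>" using ball_sub r0_pos by auto
  let ?y = "\<lambda>x::real^2. 1::complex"
  have d: "(?y has_derivative (\<lambda>v. 0)) (at x)" for x by simp
  have y1: "?y \<in> C1" by (rule C1I[OF d]) auto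
  have "cgrad ?y x = 0" for x unfolding cgrad_def by (simp add: partial_derivI[OF d] vec_eq_iff)
  then have w0: "AE x in M. wgrad \<Omega> ?y x = 0" using C1_H1(2)[OF y1] by simp
  note yH = C1_H1(1)[OF y1]
  have "(\<lambda>x. wgrad \<Omega> ?y x $ i) \<in> H1 \<Omega>" for i
  proof (rule H1I(1)[OF L2_component[OF H1D(2)[OF yH]] L2_zero])
    show "weak_gradient \<Omega> (\<lambda>x. wgrad \<Omega> ?y x $ i) (\<lambda>x. 0)"
      unfolding weak_gradient_def
    proof (intro ballI allI)
      fix \<phi> :: "real^2 \<Rightarrow> real" and j
      have "(\<integral>x. partial_deriv j \<phi> x *\<^sub>R wgrad \<Omega> ?y x $ i \<partial>M) = 0"
        by (rule integral_eq_zero_AE) (use w0 in eventually_elim, simp)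
      then show "(\<integral>x. partial_deriv j \<phi> x *\<^sub>R wgrad \<Omega> ?y x $ i \<partial>M) = - (\<integral>x. \<phi> x *\<^sub>R ((0 :: complex^2) $ j) \<partial>M)" by simp
    qed
  qed
  then have "?y \<in> H2 \<Omega>" using yH by (simp add: H2_def)
  from assms[OF this] have AE1: "AE x in M. 1 \<le> c3 * H2norm \<Omega> ?y" by simp
  have "1 \<le> c3 * H2norm \<Omega> ?y"
  proof (rule ccontr)
    assume "\<not> 1 \<le> c3 * H2norm \<Omega> ?y"
    with AE1 have "AE x in M. ker (1 / 2) z0 x = 0" by (auto elim: eventually_mono)
    then have "(\<integral>x. ker (1 / 2) z0 x \<partial>M) = 0" by (rule integral_eq_zero_AE)
    then show False using ker_integral(2)[of "1 / 2" z0] z0 by simp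
  qed
  moreover have "0 \<le> H2norm \<Omega> ?y" by (simp add: H2norm_def)
  ultimately show ?thesis by (metis linorder_not_less mult_nonpos_nonneg not_one_le_zero order_trans less_imp_le)
qed

end

section \<open>The Helmholtz form with a bounded real potential\<close>

locale helmholtz = trace_domain +
  fixes k B :: real and V :: "real^2 \<Rightarrow> real"
  assumes V_meas: "V \<in> borel_measurable M" and V_bdd: "AE x in M. \<bar>V x\<bar> \<le> B"
    and k_pos: "0 < k" and B_nonneg: "0 \<le> B"
begin

text \<open>\<open>V\<close> stands for the whole zero-order coefficient,
  \<open>k0^2 * (1 + q x * w x)\<close> in the application.\<close>

definition form :: "(real^2 \<Rightarrow> complex) \<Rightarrow> (real^2 \<Rightarrow> complex) \<Rightarrow> complex" where
  "form u v = grad_inner \<Omega> u v - L2inner M (\<lambda>x. of_real (V x) * u x) v - \<i> * of_real k * bdry_inner \<Omega> \<Gamma> u v"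

lemma V_L2: "u \<in> L2 M \<Longrightarrow> (\<lambda>x. complex_of_real (V x) * u x) \<in> L2 M"
  by (rule L2_bounded_times[OF _ V_meas V_bdd])

lemma form_add_scale_left:
  assumes "u \<in> H1 \<Omega>" "v \<in> H1 \<Omega>" "z \<in> H1 \<Omega>"
  shows "form (\<lambda>x. u x + c * v x) z = form u z + c * form v z"
proof -
  have "L2inner M (\<lambda>x. of_real (V x) * (u x + c * v x)) z
      = L2inner M (\<lambda>x. of_real (V x) * u x + c * (of_real (V x) * v x)) z" by (simp add: algebra_simps)
  also have "\<dots> = L2inner M (\<lambda>x. of_real (V x) * u x) z + c * L2inner M (\<lambda>x. of_real (V x) * v x) z"
    by (intro L2inner_add_scale_left V_L2 H1D assms)
  finally show ?thesis
    unfolding form_def grad_inner_add_scale_left[OF assms] bdry_inner_add_scale_left[OF assms] by (simp add: algebra_simps)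
qed

lemma V_inner_commute: "L2inner M (\<lambda>x. of_real (V x) * v x) u = cnj (L2inner M (\<lambda>x. of_real (V x) * u x) v)"
  unfolding L2inner_def by (subst Bochner_Integration.integral_cnj[symmetric]) (simp add: ac_simps)

text \<open>As \<open>V\<close> is real, exchanging the arguments and conjugating flips only the
  sign of the boundary term. So the dual problem is again a Robin problem, and antilinearity in the
  second argument reduces to linearity in the first.\<close>

lemma cnj_form: "cnj (form v u) = grad_inner \<Omega> u v - L2inner M (\<lambda>x. of_real (V x) * u x) v + \<i> * of_real k * bdry_inner \<Omega> \<Gamma> u v"
  unfolding form_def grad_inner_commute[of v u] V_inner_commute[of v u] bdry_inner_commute[of v u] by simp

lemma form_add_scale_right:
  assumes "u \<in> H1 \<Omega>" "v \<in> H1 \<Omega>" "z \<in> H1 \<Omega>"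
  shows "form z (\<lambda>x. u x + c * v x) = form z u + cnj c * form z v"
proof -
  have "L2inner M (\<lambda>x. of_real (V x) * (u x + c * v x)) z
      = L2inner M (\<lambda>x. of_real (V x) * u x + c * (of_real (V x) * v x)) z" by (simp add: algebra_simps)
  also have "\<dots> = L2inner M (\<lambda>x. of_real (V x) * u x) z + c * L2inner M (\<lambda>x. of_real (V x) * v x) z"
    by (intro L2inner_add_scale_left V_L2 H1D assms)
  finally have "cnj (form z (\<lambda>x. u x + c * v x)) = cnj (form z u + cnj c * form z v)"
    unfolding cnj_form complex_cnj_add complex_cnj_mult grad_inner_add_scale_left[OF assms] bdry_inner_add_scale_left[OF assms]
    by (simp add: algebra_simps)
  then show ?thesis by (simp only: complex_cnj_cancel_iff)
qed

lemma form_bound: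
  assumes u: "u \<in> H1 \<Omega>" and v: "v \<in> H1 \<Omega>"
  shows "norm (form u v) \<le> (1 + B + k * Ct\<^sup>2) * (H1norm \<Omega> u * H1norm \<Omega> v)"
proof -
  have "norm (form u v) \<le> norm (grad_inner \<Omega> u v) + norm (L2inner M (\<lambda>x. of_real (V x) * u x) v) + norm (\<i> * of_real k * bdry_inner \<Omega> \<Gamma> u v)"
    unfolding form_def by (intro order_trans[OF norm_triangle_ineq4] add_right_mono norm_triangle_ineq4)
  also have "\<dots> \<le> H1norm \<Omega> u * H1norm \<Omega> v + B * (H1norm \<Omega> u * H1norm \<Omega> v) + k * (Ct\<^sup>2 * (H1norm \<Omega> u * H1norm \<Omega> v))"
  proof (intro add_mono)
    show "norm (grad_inner \<Omega> u v) \<le> H1norm \<Omega> u * H1norm \<Omega> v"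
      by (rule order_trans[OF grad_inner_bound[OF u v]]) (intro mult_mono L2norm_le_H1norm; simp)
    have "norm (L2inner M (\<lambda>x. of_real (V x) * u x) v) \<le> (B * L2norm M u) * L2norm M v"
      using L2norm_bounded_times[OF H1D(1)[OF u] B_nonneg V_bdd]
      by (intro order_trans[OF L2inner_bound[OF V_L2[OF H1D(1)[OF u]] H1D(1)[OF v]]] mult_right_mono) auto
    also have "\<dots> \<le> (B * H1norm \<Omega> u) * H1norm \<Omega> v"
      using B_nonneg by (intro mult_mono mult_left_mono L2norm_le_H1norm) auto
    finally show "norm (L2inner M (\<lambda>x. of_real (V x) * u x) v) \<le> B * (H1norm \<Omega> u * H1norm \<Omega> v)" by simp
    have "norm (bdry_inner \<Omega> \<Gamma> u v) \<le> (Ct * H1norm \<Omega> u) * (Ct * H1norm \<Omega> v)"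
      using Ct_nonneg by (intro order_trans[OF bdry_inner_bound[OF u v]] mult_mono tr_bound u v) auto
    then show "norm (\<i> * of_real k * bdry_inner \<Omega> \<Gamma> u v) \<le> k * (Ct\<^sup>2 * (H1norm \<Omega> u * H1norm \<Omega> v))"
      using k_pos by (simp add: norm_mult power2_eq_square ac_simps)
  qed
  also have "\<dots> = (1 + B + k * Ct\<^sup>2) * (H1norm \<Omega> u * H1norm \<Omega> v)" by (simp add: algebra_simps)
  finally show ?thesis .
qed

lemma form_self:
  "Re (form y y) = (L2norm M (wgrad \<Omega> y))\<^sup>2 - Re (L2inner M (\<lambda>x. of_real (V x) * y x) y)"
  "Im (form y y) = - k * (L2norm \<Gamma> (tr y))\<^sup>2"
proof -
  have "Im (L2inner M (\<lambda>x. of_real (V x) * y x) y) = 0"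
    using V_inner_commute[of y y] by (metis cnj.simps(2) equal_neg_zero)
  then show "Re (form y y) = (L2norm M (wgrad \<Omega> y))\<^sup>2 - Re (L2inner M (\<lambda>x. of_real (V x) * y x) y)"
    "Im (form y y) = - k * (L2norm \<Gamma> (tr y))\<^sup>2"
    by (simp_all add: form_def grad_inner_self bdry_inner_self)
qed

text \<open>Stated for a general \<open>W\<close>, since it is applied to \<open>V\<close> and to
  \<open>q * P w\<close>. The two-sided bound \<open>C\<close> gives integrability, the one-sided
  bound \<open>K\<close> the estimate.\<close>

lemma Re_L2inner_self_le:
  assumes y: "y \<in> L2 M" and W: "W \<in> borel_measurable M" "AE x in M. \<bar>W x\<bar> \<le> C" "AE x in M. W x \<le> K"
  shows "Re (L2inner M (\<lambda>x. of_real (W x) * y x) y) \<le> K * (L2norm M y)\<^sup>2"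
proof -
  have "(\<lambda>x. of_real (W x) * y x * cnj (y x)) = (\<lambda>x. complex_of_real (W x * (norm (y x))\<^sup>2))"
    by (simp add: mult.assoc complex_norm_square del: of_real_power)
  then have "L2inner M (\<lambda>x. of_real (W x) * y x) y = complex_of_real (\<integral>x. W x * (norm (y x))\<^sup>2 \<partial>M)"
    unfolding L2inner_def by (simp only: integral_complex_of_real)
  then have "Re (L2inner M (\<lambda>x. of_real (W x) * y x) y) = (\<integral>x. W x * (norm (y x))\<^sup>2 \<partial>M)" by simp
  also have "\<dots> \<le> (\<integral>x. K * (norm (y x))\<^sup>2 \<partial>M)"
  proof (rule integral_mono_AE)
    show "integrable M (\<lambda>x. W x * (norm (y x))\<^sup>2)"
    proof (rule Bochner_Integration.integrable_bound[of _ "\<lambda>x. C * (norm (y x))\<^sup>2"])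
      show "AE x in M. norm (W x * (norm (y x))\<^sup>2) \<le> norm (C * (norm (y x))\<^sup>2)"
        using W(2) by eventually_elim (auto simp: abs_mult intro!: mult_right_mono)
    qed (use L2D[OF y] W(1) in auto)
    show "AE x in M. W x * (norm (y x))\<^sup>2 \<le> K * (norm (y x))\<^sup>2"
      using W(3) by eventually_elim (simp add: mult_right_mono)
  qed (use L2D[OF y] in auto)
  also have "\<dots> = K * (L2norm M y)\<^sup>2" by (simp add: L2norm_sq)
  finally show ?thesis .
qed

text \<open>Only the real part is taken, because the Lax-Milgram lemma is formulated over the reals;
  \<open>dual_solution\<close> recovers the complex equation.\<close>

definition H1ip :: "(real^2 \<Rightarrow> complex) \<Rightarrow> (real^2 \<Rightarrow> complex) \<Rightarrow> real" where
  "H1ip u v = Re (L2inner M u v + grad_inner \<Omega> u v)"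

lemma H1ip_self: "H1ip u u = (H1norm \<Omega> u)\<^sup>2"
  by (simp add: H1ip_def L2inner_self grad_inner_self H1norm_sq)

sublocale H: semi_hilbert "H1 \<Omega>" "\<lambda>t u v x. u x + complex_of_real t * v x" H1ip
proof
  show "H1 \<Omega> \<noteq> {}"
    using C1_H1(1)[of "\<lambda>x. 0"] by (auto simp: C1_def partial_deriv_def)
  show "(\<lambda>x. u x + complex_of_real t * v x) \<in> H1 \<Omega>" if "u \<in> H1 \<Omega>" "v \<in> H1 \<Omega>" for u v t
    by (rule H1_add_scale[OF that])
  show "H1ip u v = H1ip v u" for u v
    unfolding H1ip_def L2inner_commute[of M v u] grad_inner_commute[of v u] by simp
  show "H1ip (\<lambda>x. u x + complex_of_real t * v x) z = H1ip u z + t * H1ip v z"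
    if "u \<in> H1 \<Omega>" "v \<in> H1 \<Omega>" "z \<in> H1 \<Omega>" for u v z t
    unfolding H1ip_def grad_inner_add_scale_left[OF that]
      L2inner_add_scale_left[OF H1D(1)[OF that(1)] H1D(1)[OF that(2)] H1D(1)[OF that(3)]]
    by (simp add: algebra_simps)
  show "0 \<le> H1ip u u" for u by (simp add: H1ip_self)
  fix X :: "nat \<Rightarrow> real^2 \<Rightarrow> complex" assume X: "\<And>n. X n \<in> H1 \<Omega>"
    and cau: "\<And>\<epsilon>. 0 < \<epsilon> \<Longrightarrow> \<exists>N. \<forall>m\<ge>N. \<forall>n\<ge>N. H1ip (\<lambda>x. X m x + complex_of_real (-1) * X n x) (\<lambda>x. X m x + complex_of_real (-1) * X n x) < \<epsilon>"
  obtain y where "y \<in> H1 \<Omega>" "(\<lambda>n. H1norm \<Omega> (\<lambda>x. X n x - y x)) \<longlonglongrightarrow> 0"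
  proof (rule H1_complete[OF X])
    fix \<epsilon> :: real assume "0 < \<epsilon>"
    then obtain N where N: "\<forall>m\<ge>N. \<forall>n\<ge>N. (H1norm \<Omega> (\<lambda>x. X m x - X n x))\<^sup>2 < \<epsilon>\<^sup>2"
      using cau[of "\<epsilon>\<^sup>2"] unfolding H1ip_self by auto
    then show "\<exists>N. \<forall>m\<ge>N. \<forall>n\<ge>N. H1norm \<Omega> (\<lambda>x. X m x - X n x) < \<epsilon>"
      using \<open>0 < \<epsilon>\<close> by (meson less_imp_le power2_less_imp_less)
  qed
  then show "\<exists>x\<in>H1 \<Omega>. (\<lambda>n. H1ip (\<lambda>xa. X n xa + complex_of_real (-1) * x xa) (\<lambda>xa. X n xa + complex_of_real (-1) * x xa)) \<longlonglongrightarrow> 0"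
    unfolding H1ip_self by (intro bexI[of _ y]) (auto intro!: tendsto_eq_intros)
qed

text \<open>On the diagonal the real part of \<open>(1 + \<i>) * form\<close> is
  \<open>Re - Im\<close>, coercive by assumption. Its Lax-Milgram solution satisfies one real
  equation per test function; testing with \<open>\<i> * v\<close> too supplies the full complex
  equation.\<close>

lemma dual_solution:
  assumes coercive: "\<And>y. y \<in> H1 \<Omega> \<Longrightarrow> \<kappa> * (H1norm \<Omega> y)\<^sup>2 \<le> Re (form y y) - Im (form y y)" and \<kappa>: "0 < \<kappa>"
    and f: "f \<in> L2 M"
  obtains p where "p \<in> H1 \<Omega>" "\<And>v. v \<in> H1 \<Omega> \<Longrightarrow> form v p = L2inner M v f"
proof -
  let ?b = "\<lambda>u v. Re ((1 + \<i>) * form u v)" and ?F = "\<lambda>v. Re ((1 + \<i>) * L2inner M v f)"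
  have n1: "norm (1 + \<i>) \<le> 2" using norm_triangle_ineq[of 1 "\<i>"] by simp
  have Re_le: "\<bar>Re ((1 + \<i>) * z)\<bar> \<le> 2 * norm z" for z
    using abs_Re_le_cmod[of "(1 + \<i>) * z"] mult_right_mono[OF n1 norm_ge_zero[of z]] by (simp only: norm_mult)
  have sq: "sqrt (H1ip y y) = H1norm \<Omega> y" for y by (simp add: H1ip_self)
  obtain p where p: "p \<in> H1 \<Omega>" "\<And>v. v \<in> H1 \<Omega> \<Longrightarrow> ?b v p = ?F v"
  proof (rule H.Lax_Milgram[where b="?b" and K="2 * (1 + B + k * Ct\<^sup>2)" and \<kappa>=\<kappa> and F="?F" and C="2 * L2norm M f"])
    fix u v x :: "real^2 \<Rightarrow> complex" and t :: real
    assume uv: "u \<in> H1 \<Omega>" "v \<in> H1 \<Omega>"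
    show "\<bar>?b u v\<bar> \<le> 2 * (1 + B + k * Ct\<^sup>2) * sqrt (H1ip u u) * sqrt (H1ip v v)"
      using order_trans[OF Re_le mult_left_mono[OF form_bound[OF uv]]] unfolding sq by (simp add: mult.assoc del: distrib_left_numeral)
    show "?F (\<lambda>x. u x + complex_of_real t * v x) = ?F u + t * ?F v"
      unfolding L2inner_add_scale_left[OF H1D(1)[OF uv(1)] H1D(1)[OF uv(2)] f] by (simp add: algebra_simps)
    assume x: "x \<in> H1 \<Omega>"
    show "?b (\<lambda>xa. u xa + complex_of_real t * v xa) x = ?b u x + t * ?b v x"
      unfolding form_add_scale_left[OF uv x] by (simp add: algebra_simps)
    show "?b x (\<lambda>xa. u xa + complex_of_real t * v xa) = ?b x u + t * ?b x v"
      unfolding form_add_scale_right[OF uv x] by (simp add: algebra_simps)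
  next
    fix u assume u: "u \<in> H1 \<Omega>"
    show "\<kappa> * H1ip u u \<le> ?b u u" using coercive[OF u] by (simp add: H1ip_self)
    have "\<bar>?F u\<bar> \<le> 2 * (L2norm M u * L2norm M f)"
      by (intro order_trans[OF Re_le] mult_left_mono L2inner_bound H1D(1)[OF u] f) simp
    also have "\<dots> \<le> 2 * (H1norm \<Omega> u * L2norm M f)"
      by (intro mult_left_mono mult_right_mono L2norm_le_H1norm) auto
    finally show "\<bar>?F u\<bar> \<le> 2 * L2norm M f * sqrt (H1ip u u)" by (simp add: H1ip_self ac_simps)
  qed (use \<kappa> in auto)
  have "form v p = L2inner M v f" if v: "v \<in> H1 \<Omega>" for v
  proof -
    \<comment> \<open>This is \<open>\<i> * v\<close>, in the shape \<open>v + c v\<close> that the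
      linearity lemmas cover.\<close>
    let ?iv = "\<lambda>x. v x + (\<i> - 1) * v x"
    have iv: "?iv \<in> H1 \<Omega>" by (rule H1_add_scale[OF v v])
    define z where "z = form v p - L2inner M v f"
    have "Re ((1 + \<i>) * z) = 0" using p(2)[OF v] by (simp add: z_def algebra_simps)
    moreover have "form ?iv p - L2inner M ?iv f = \<i> * z"
      unfolding form_add_scale_left[OF v v p(1)] L2inner_add_scale_left[OF H1D(1)[OF v] H1D(1)[OF v] f] z_def
      by (simp add: algebra_simps)
    then have "Re ((1 + \<i>) * (\<i> * z)) = 0" using p(2)[OF iv] by (simp add: algebra_simps)
    ultimately have "Re z = 0" "Im z = 0" by auto
    then show ?thesis by (simp add: z_def complex_eq_iff)
  qed
  with p(1) show ?thesis by (rule that)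
qed

end


subsection \<open>The error estimate\<close>

context partitioned_domain
begin

text \<open>With \<open>e\<^sub>w = w - P w\<close> and likewise for \<open>y\<close> and \<open>p\<close>, the integrand is
  \<open>q e\<^sub>w e\<^sub>y p\<^sup>* + q e\<^sub>w (P y) e\<^sub>p\<^sup>* + q (P w) e\<^sub>y e\<^sub>p\<^sup>*\<close> plus two products of \<open>e\<^sub>w\<close> and \<open>e\<^sub>y\<close> with
  cellwise constant functions, which integrate to zero.\<close>

lemma error_split:
  fixes w q :: "real^2 \<Rightarrow> real" and y p :: "real^2 \<Rightarrow> complex"
  assumes w: "w \<in> borel_measurable M" "AE x in M. l \<le> w x \<and> w x \<le> u" and W: "- W \<le> l" "u \<le> W"
    and q: "cellwise q" "\<And>x. \<bar>q x\<bar> \<le> c" and y: "y \<in> L2 M" "AE x in M. norm (y x) \<le> By"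
    and p: "p \<in> L2 M" "AE x in M. norm (p x) \<le> Bp" and nn: "0 \<le> c" "0 \<le> By" "0 \<le> Bp" "0 \<le> W"
  shows "norm (L2inner M (\<lambda>x. of_real (q x) * (of_real (w x) * y x - of_real (P w x) * P y x)) p)
    \<le> c * (L2norm M (\<lambda>x. w x - P w x) * (L2norm M (\<lambda>x. y x - P y x) * Bp + By * L2norm M (\<lambda>x. p x - P p x))
        + W * (L2norm M (\<lambda>x. y x - P y x) * L2norm M (\<lambda>x. p x - P p x)))"
proof -
  define ew where "ew x = complex_of_real (w x - P w x)" for x
  define ey where "ey x = y x - P y x" for x
  define ep where "ep x = p x - P p x" for x
  have wb: "AE x in M. norm (w x) \<le> W" using w(2) by eventually_elim (use W in auto)
  have w2: "w \<in> L2 M" by (rule L2_bounded[OF w(1) wb])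
  have wc2: "(\<lambda>x. complex_of_real (w x)) \<in> L2 M"
    by (rule L2_dominated[OF w2, where C=1]) (use w(1) in auto)
  \<comment> \<open>The real oscillation is rewritten as that of a complex function, to which
    \<open>average_orthogonal\<close> applies.\<close>
  have ew_eq: "ew = (\<lambda>x. complex_of_real (w x) - P (\<lambda>x. complex_of_real (w x)) x)"
    by (simp add: ew_def average_of_real fun_eq_iff)
  have e2: "ew \<in> L2 M" "ey \<in> L2 M" "ep \<in> L2 M"
    unfolding ew_eq ey_def[abs_def] ep_def[abs_def] by (intro L2_diff average_L2 wc2 y(1) p(1))+
  note [measurable] = e2[THEN L2D(1)] L2D(1)[OF p(1)] cellwise_measurable[OF q(1)]
    cellwise_measurable[OF cellwise_average, of y] cellwise_measurable[OF cellwise_average, of w]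
  have ewn: "L2norm M ew = L2norm M (\<lambda>x. w x - P w x)" unfolding L2norm_def ew_def norm_of_real real_norm_def ..
  define T1 where "T1 x = of_real (q x) * ew x * ey x * cnj (p x)" for x
  define T2 where "T2 x = of_real (q x) * ew x * P y x * cnj (ep x)" for x
  define T3 where "T3 x = of_real (q x) * of_real (P w x) * ey x * cnj (ep x)" for x
  define s1 where "s1 x = of_real (q x) * P y x * cnj (P p x)" for x
  define s2 where "s2 x = of_real (q x) * of_real (P w x) * cnj (P p x)" for x
  have Pwb: "\<bar>P w x\<bar> \<le> W" if "x \<in> \<Omega>" for x
    using average_bounds[OF L2_integrable[OF w2] w(2) that] W by auto
  have Pyb: "norm (P y x) \<le> By" if "x \<in> \<Omega>" for x
    by (rule norm_average_le[OF L2_integrable[OF y(1)] y(2) that])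
  have T1: "integrable M T1" "norm (\<integral>x. T1 x \<partial>M) \<le> (c * Bp) * (L2norm M ew * L2norm M ey)"
  proof -
    have "AE x in M. norm (T1 x) \<le> (c * Bp) * (norm (ew x) * norm (ey x))"
      using p(2)
    proof eventually_elim
      case (elim x)
      then have "\<bar>q x\<bar> * norm (p x) \<le> c * Bp" by (intro mult_mono q(2)) (use nn in auto)
      from mult_right_mono[OF this, of "norm (ew x) * norm (ey x)"] show ?case
        by (simp add: T1_def norm_mult ac_simps)
    qed
    with nn integral_product_bound[OF e2(1,2), of T1 "c * Bp"] show "integrable M T1"
      "norm (\<integral>x. T1 x \<partial>M) \<le> (c * Bp) * (L2norm M ew * L2norm M ey)"
      by (auto simp: T1_def[abs_def])
  qed
  have T2: "integrable M T2" "norm (\<integral>x. T2 x \<partial>M) \<le> (c * By) * (L2norm M ew * L2norm M ep)"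
  proof -
    have "AE x in M. norm (T2 x) \<le> (c * By) * (norm (ew x) * norm (ep x))"
    proof (rule AE_I2)
      fix x assume "x \<in> space M"
      then have "\<bar>q x\<bar> * norm (P y x) \<le> c * By" by (intro mult_mono q(2) Pyb) (use nn in auto)
      from mult_right_mono[OF this, of "norm (ew x) * norm (ep x)"] show "norm (T2 x) \<le> (c * By) * (norm (ew x) * norm (ep x))"
        by (simp add: T2_def norm_mult ac_simps)
    qed
    with nn integral_product_bound[OF e2(1,3), of T2 "c * By"] show "integrable M T2"
      "norm (\<integral>x. T2 x \<partial>M) \<le> (c * By) * (L2norm M ew * L2norm M ep)"
      by (auto simp: T2_def[abs_def])
  qed
  have T3: "integrable M T3" "norm (\<integral>x. T3 x \<partial>M) \<le> (c * W) * (L2norm M ey * L2norm M ep)"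
  proof -
    have "AE x in M. norm (T3 x) \<le> (c * W) * (norm (ey x) * norm (ep x))"
    proof (rule AE_I2)
      fix x assume "x \<in> space M"
      then have "\<bar>q x\<bar> * \<bar>P w x\<bar> \<le> c * W" by (intro mult_mono q(2) Pwb) (use nn in auto)
      from mult_right_mono[OF this, of "norm (ey x) * norm (ep x)"] show "norm (T3 x) \<le> (c * W) * (norm (ey x) * norm (ep x))"
        by (simp add: T3_def norm_mult ac_simps)
    qed
    with nn integral_product_bound[OF e2(2,3), of T3 "c * W"] show "integrable M T3"
      "norm (\<integral>x. T3 x \<partial>M) \<le> (c * W) * (L2norm M ey * L2norm M ep)"
      by (auto simp: T3_def[abs_def])
  qed
  have s: "cellwise s1" "cellwise s2"
    unfolding s1_def[abs_def] s2_def[abs_def]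
    by (intro cellwise_comp2[where f="(*)"] cellwise_comp[where f=cnj] cellwise_comp[where f=complex_of_real] q(1) cellwise_average)+
  have sm [measurable]: "s1 \<in> borel_measurable M" "s2 \<in> borel_measurable M"
    by (intro cellwise_measurable s)+
  have m: "(\<lambda>x. s1 x * ew x) \<in> borel_measurable M" "(\<lambda>x. s2 x * ey x) \<in> borel_measurable M"
    by measurable
  have Z1: "integrable M (\<lambda>x. s1 x * ew x)"
    by (rule integral_product_bound(1)[OF cellwise_L2[OF s(1)] e2(1) m(1), of 1]) (simp_all add: norm_mult)
  have Z2: "integrable M (\<lambda>x. s2 x * ey x)"
    by (rule integral_product_bound(1)[OF cellwise_L2[OF s(2)] e2(2) m(2), of 1]) (simp_all add: norm_mult)
  have Z: "(\<integral>x. s1 x * ew x \<partial>M) = 0" "(\<integral>x. s2 x * ey x \<partial>M) = 0"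
    using average_orthogonal[OF wc2 s(1)] average_orthogonal[OF y(1) s(2)] by (simp_all only: ew_eq ey_def)
  have "L2inner M (\<lambda>x. of_real (q x) * (of_real (w x) * y x - of_real (P w x) * P y x)) p
      = (\<integral>x. T1 x + T2 x + T3 x + s1 x * ew x + s2 x * ey x \<partial>M)"
    unfolding L2inner_def
    by (intro Bochner_Integration.integral_cong)
       (simp_all add: T1_def T2_def T3_def s1_def s2_def ew_def ey_def ep_def algebra_simps)
  also have "\<dots> = (\<integral>x. T1 x \<partial>M) + (\<integral>x. T2 x \<partial>M) + (\<integral>x. T3 x \<partial>M)"
    using T1(1) T2(1) T3(1) Z1 Z2 Z by simp
  also have "norm \<dots> \<le> norm (\<integral>x. T1 x \<partial>M) + norm (\<integral>x. T2 x \<partial>M) + norm (\<integral>x. T3 x \<partial>M)"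
    by (rule order_trans[OF norm_triangle_ineq add_right_mono[OF norm_triangle_ineq]])
  also have "\<dots> \<le> (c * Bp) * (L2norm M ew * L2norm M ey) + (c * By) * (L2norm M ew * L2norm M ep)
      + (c * W) * (L2norm M ey * L2norm M ep)"
    by (rule add_mono[OF add_mono[OF T1(2) T2(2)] T3(2)])
  also have "\<dots> = c * (L2norm M ew * (L2norm M ey * Bp + By * L2norm M ep) + W * (L2norm M ey * L2norm M ep))"
    by (simp add: algebra_simps)
  finally show ?thesis unfolding ewn ey_def[abs_def] ep_def[abs_def] .
qed

end

theorem proposition4p15:
  fixes a e d :: "real^2" and L :: real
    and \<Omega> \<Omega>t :: "(real^2) set" and \<Gamma> :: "(real^2) measure"
    and wl wu qt k0 lam \<alpha> C\<Omega> c1 c2 c2p c c3 :: real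
    and q :: "real^2 \<Rightarrow> real" and u0 :: "real^2 \<Rightarrow> complex"
    and H :: "real set" and N :: "real \<Rightarrow> nat" and Q :: "real \<Rightarrow> nat \<Rightarrow> (real^2) set"
    and dh :: "real \<Rightarrow> real" and h :: real
    and w :: "real^2 \<Rightarrow> real" and u uh :: "real^2 \<Rightarrow> complex"
  assumes square: "norm e = 1" "0 < L" "\<Omega> = open_square a e L" "\<Gamma> = square_boundary a e L"
    and w_bounds: "wl < wu"
    and qt_pos: "0 < qt" and k0_pos: "0 < k0"
    and \<Omega>t_subset: "\<Omega>t \<subseteq> \<Omega>"
    and q_def: "q = (\<lambda>x. qt * indicator \<Omega>t x)"
    and u0_def: "u0 = (\<lambda>x. exp (\<i> * of_real (k0 * (d \<bullet> x))))"
    and mesh_pos: "\<And>h. h \<in> H \<Longrightarrow> 0 < h"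
    and partitions: "\<And>h. h \<in> H \<Longrightarrow> cell_partition \<Omega> (N h) (Q h)"
    and eccentricity: "\<exists>C>0. \<forall>h\<in>H. eccentricity_bound C (N h) (Q h)"
    and compatible: "\<And>h. h \<in> H \<Longrightarrow> \<exists>I\<subseteq>{1..N h}. \<Omega>t = (\<Union>i\<in>I. Q h i)"
    and dh_def: "\<And>h. h \<in> H \<Longrightarrow> dh h = max_diameter (N h) (Q h)"
    and \<alpha>_pos: "0 < \<alpha>"
    and \<alpha>_H1: "\<And>h g. h \<in> H \<Longrightarrow> g \<in> H1 \<Omega> \<Longrightarrow>
          L2norm (lebesgue_on \<Omega>) (\<lambda>x. g x - local_average (N h) (Q h) g x)
            \<le> \<alpha> * dh h * L2norm (lebesgue_on \<Omega>) (wgrad \<Omega> g)"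
    and \<alpha>_TV: "\<And>h f. h \<in> H \<Longrightarrow> integrable (lebesgue_on \<Omega>) (f :: real^2 \<Rightarrow> real) \<Longrightarrow>
          ennreal (\<integral>x. \<bar>f x - local_average (N h) (Q h) f x\<bar> \<partial>lebesgue_on \<Omega>)
            \<le> ennreal (\<alpha> * dh h) * TV \<Omega> f"
    and lam_pos: "0 < lam"
    and lam_bound: "\<And>y. y \<in> H1 \<Omega> \<Longrightarrow>
          sqrt lam * H1norm \<Omega> y
            \<le> sqrt ((L2norm \<Gamma> (bdry_trace \<Omega> \<Gamma> y))\<^sup>2 + (L2norm (lebesgue_on \<Omega>) (wgrad \<Omega> y))\<^sup>2)"
    and C\<Omega>_pos: "0 < C\<Omega>"
    and C\<Omega>_regularity: "\<And>k \<kappa> g y. 0 < k \<Longrightarrow> \<kappa> \<in> {k, - k} \<Longrightarrow> g \<in> L2 (lebesgue_on \<Omega>) \<Longrightarrow>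
          robin_solution \<Omega> \<Gamma> k \<kappa> g y \<Longrightarrow>
          y \<in> H2 \<Omega> \<and> H2seminorm \<Omega> y \<le> C\<Omega> * (1 + \<bar>k\<bar>) * L2norm (lebesgue_on \<Omega>) g"
    and c3_embedding: "\<And>y. y \<in> H2 \<Omega> \<Longrightarrow> AE x in lebesgue_on \<Omega>. norm (y x) \<le> c3 * H2norm \<Omega> y"
    and c_def: "c = lam * min 1 k0 / sqrt 2 - k0\<^sup>2 * (1 + qt * max 0 wu)"
    and c1_def: "c1 = C\<Omega> * (1 + \<bar>k0\<bar>) * k0\<^sup>2 * qt * max (- wl) wu"
    and c2p_def: "c2p = inverse c"
    and c2_def: "c2 = inverse c * k0\<^sup>2 * qt * max (- wl) wu"
    and coercivity: "min k0 1 / sqrt 2 * lam > k0\<^sup>2 * (1 + qt * max (- wl) wu)"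
    and h_in: "h \<in> H"
    and w_adm: "w \<in> borel_measurable (lebesgue_on \<Omega>)"
          "AE x in lebesgue_on \<Omega>. wl \<le> w x \<and> w x \<le> wu"
    and u_H1: "u \<in> H1 \<Omega>"
    and u_solves: "\<And>v. v \<in> H1 \<Omega> \<Longrightarrow>
          grad_inner \<Omega> u v
            - of_real (k0\<^sup>2) * L2inner (lebesgue_on \<Omega>) (\<lambda>x. of_real (1 + q x * w x) * u x) v
            - \<i> * of_real k0 * bdry_inner \<Omega> \<Gamma> u v
          = of_real (k0\<^sup>2) * L2inner (lebesgue_on \<Omega>) (\<lambda>x. of_real (q x * w x) * u0 x) v"
    and uh_H1: "uh \<in> H1 \<Omega>"
    and uh_solves: "\<And>v. v \<in> H1 \<Omega> \<Longrightarrow>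
          grad_inner \<Omega> uh v
            - of_real (k0\<^sup>2) * L2inner (lebesgue_on \<Omega>) uh v
            - of_real (k0\<^sup>2) * L2inner (lebesgue_on \<Omega>)
                (\<lambda>x. of_real (q x * local_average (N h) (Q h) w x) * local_average (N h) (Q h) uh x) v
            - \<i> * of_real k0 * bdry_inner \<Omega> \<Gamma> uh v
          = of_real (k0\<^sup>2) * L2inner (lebesgue_on \<Omega>) (\<lambda>x. of_real (q x * w x) * u0 x) v"
  shows "ennreal (L2norm (lebesgue_on \<Omega>) (\<lambda>x. u x - uh x))
    \<le> ennreal (k0\<^sup>2 * \<alpha> powr (3/2) * qt * L2norm (lebesgue_on \<Omega>) u0 * \<bar>wu - wl\<bar> powr (1/2))
        * ennreal_sqrt (TV \<Omega> w)
        * ennreal (c2p + sqrt 2 * c3 * (C\<Omega> * (1 + \<bar>k0\<bar>) + c1 * c2p + c2p))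
        * ennreal (dh h powr (3/2))
      + ennreal (\<alpha>\<^sup>2 * c2 * c2p * (1 + qt * max (- wl) wu) * L2norm (lebesgue_on \<Omega>) u0 * (dh h)\<^sup>2)"
proof -
  let ?M = "lebesgue_on \<Omega>"
  \<comment> \<open>\<open>m\<close> bounds \<open>w\<close> and \<open>P w\<close> in absolute
    value, and \<open>r\<close> bounds their products with \<open>q\<close>; both are positive
    because \<open>wl < wu\<close>.\<close>
  define m where "m = max (- wl) wu"
  define r where "r = qt * m"
  define U where "U = L2norm ?M u0"
  have m_pos: "0 < m" using w_bounds by (auto simp: m_def max_def)
  have r_pos: "0 < r" using m_pos qt_pos by (simp add: r_def)
  have m0: "max 0 wu \<le> m" using m_pos by (auto simp: m_def)
  have U0: "0 \<le> U" by (simp add: U_def)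

  interpret sq: square a e L using square(1,2) by unfold_locales
  interpret T: trace_domain \<Omega> "sq.pt (L / 2) (L / 2)" "L / 4" \<Gamma> "sqrt (4 * (1 / L + 1))"
    unfolding square(3,4) by (rule sq.trace_domain_axioms)
  have ind: "AE x in \<Gamma>. x \<notin> \<Omega>" unfolding square(3,4) by (rule sq.boundary_disjoint)
  interpret A: partitioned_domain \<Omega> "sq.pt (L / 2) (L / 2)" "L / 4" "N h" "Q h"
  proof
    show "cell_partition \<Omega> (N h) (Q h)" by (rule partitions[OF h_in])
    fix i assume i: "i \<in> {1..N h}"
    from eccentricity h_in obtain C where "0 < C" "eccentricity_bound C (N h) (Q h)" by blast
    from bspec[OF this(2)[unfolded eccentricity_bound_def] i]
    obtain z R where "0 < R" "Q h i \<subseteq> cball z R" "measure lebesgue (cball z R) \<le> C * measure lebesgue (Q h i)"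
      by (elim exE conjE)
    moreover have "0 < measure lebesgue (cball z R)" using content_cball_pos[OF \<open>0 < R\<close>] by simp
    ultimately have "0 < C * measure lebesgue (Q h i)" by linarith
    then show "0 < measure lebesgue (Q h i)" using \<open>0 < C\<close> by (simp add: zero_less_mult_iff)
  qed
  have dh0: "0 \<le> dh h"
  proof -
    have "sq.pt (L / 2) (L / 2) \<in> \<Omega>" using T.ball_sub T.r0_pos by auto
    then obtain i where i: "i \<in> {1..N h}" by (rule A.cell_cover)
    have "0 \<le> diameter (Q h i)"
      by (rule diameter_ge_0[OF bounded_subset[OF T.bounded_dom A.cell_subset[OF i]]])
    also have "\<dots> \<le> max_diameter (N h) (Q h)" unfolding max_diameter_def by (rule Max_ge) (use i in auto)
    finally show ?thesis by (simp add: dh_def[OF h_in])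
  qed

  have q_cell: "A.cellwise q"
  proof -
    obtain I where I: "I \<subseteq> {1..N h}" "\<Omega>t = (\<Union>i\<in>I. Q h i)" using compatible[OF h_in] by auto
    have "q x = (if i \<in> I then qt else 0)" if "i \<in> {1..N h}" "x \<in> Q h i" for i x
    proof -
      have "x \<in> \<Omega>t \<longleftrightarrow> i \<in> I" using A.cell_unique[OF that(1) _ that(2)] I that by blast
      then show ?thesis by (simp add: q_def)
    qed
    then show ?thesis unfolding A.cellwise_def by blast
  qed
  have q_range: "0 \<le> q x" "q x \<le> qt" "\<bar>q x\<bar> \<le> qt" for x using qt_pos by (auto simp: q_def indicator_def)
  have [measurable]: "q \<in> borel_measurable ?M" by (rule A.cellwise_measurable[OF q_cell])
  note [measurable] = w_adm(1)
  have w_abs: "AE x in ?M. \<bar>w x\<bar> \<le> m"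
    using w_adm(2) by eventually_elim (auto simp: m_def)
  have wi: "integrable ?M w" by (rule T.integrable_const_bound[of _ m]) (use w_abs in auto)
  have Pw: "wl \<le> A.P w x" "A.P w x \<le> wu" if "x \<in> \<Omega>" for x
    using A.average_bounds[OF wi w_adm(2) that] by auto
  have Pw_abs: "\<bar>A.P w x\<bar> \<le> m" if "x \<in> \<Omega>" for x using Pw[OF that] by (auto simp: m_def)
  have [measurable]: "A.P w \<in> borel_measurable ?M" by (rule A.cellwise_measurable[OF A.cellwise_average])
  have qw: "AE x in ?M. \<bar>q x * w x\<bar> \<le> r"
    using w_abs by eventually_elim (use q_range qt_pos in \<open>auto simp: r_def abs_mult intro!: mult_mono\<close>)
  have qPw: "AE x in ?M. \<bar>q x * A.P w x\<bar> \<le> r"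
    using Pw_abs q_range qt_pos by (intro AE_I2) (auto simp: r_def abs_mult intro!: mult_mono)
  \<comment> \<open>An upper bound that also covers negative \<open>t\<close>, for which the product
    with \<open>q\<close> is at most 0; this is the origin of \<open>max 0 wu\<close> in
    \<open>c\<close>.\<close>
  have up: "q x * t \<le> qt * max 0 wu" if "t \<le> wu" for x t
  proof -
    have "q x * t \<le> q x * max 0 wu" using that q_range by (intro mult_left_mono) auto
    also have "\<dots> \<le> qt * max 0 wu" using q_range by (intro mult_right_mono) auto
    finally show ?thesis .
  qed

  have u02: "u0 \<in> L2 ?M" unfolding u0_def by (intro T.continuous_L2 continuous_intros)

  have lam1: "lam \<le> 1" by (rule T.lam_le_1[OF ind lam_bound])
  have k2r: "k0\<^sup>2 * (1 + r) < min k0 1 / sqrt 2 * lam" using coercivity by (simp add: r_def m_def mult.assoc)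
  \<comment> \<open>\<open>c\<close> is built on this one-sided bound of the zero-order coefficient,
    the second coercivity constant on the larger \<open>k0^2 * (1 + r)\<close>.\<close>
  define K where "K = k0\<^sup>2 * (1 + qt * max 0 wu)"
  have K0: "0 \<le> K" using qt_pos by (simp add: K_def)
  have KK: "K \<le> k0\<^sup>2 * (1 + r)" unfolding K_def r_def using m0 qt_pos by (intro mult_left_mono add_left_mono) auto
  have c_eq: "c = lam * min 1 k0 / sqrt 2 - K" by (simp add: c_def K_def)
  have c_pos: "0 < c" using k2r KK by (simp add: c_eq min.commute mult.commute)
  \<comment> \<open>As \<open>lam \<le> 1\<close>, the smallness condition makes even
    \<open>k0^2 * (1 + r)\<close> less than 1. The inequality recorded here turns a factor
    \<open>k0^2 * r\<close> into the \<open>1 + r\<close> of the claim.\<close>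
  have k2_le1: "k0\<^sup>2 * r \<le> 1 + r"
  proof -
    have "min k0 1 / sqrt 2 * lam \<le> 1 * 1"
      using k0_pos lam_pos lam1 by (intro mult_mono) (auto simp: divide_le_eq_1 min_le_iff_disj intro: order_trans[of _ 1])
    moreover have "k0\<^sup>2 * r \<le> k0\<^sup>2 * (1 + r)" by (intro mult_left_mono) auto
    ultimately show ?thesis using k2r r_pos by linarith
  qed

  \<comment> \<open>Stated for a bare complex number \<open>z\<close>, because it serves both
    \<open>Hh.form\<close> and the equation for \<open>uh\<close>, whose zero-order term contains
    averages.\<close>
  have coercive: "c * (H1norm \<Omega> y)\<^sup>2 \<le> norm z" "sqrt 2 * (k0\<^sup>2 * r) * (H1norm \<Omega> y)\<^sup>2 \<le> norm z"
    "sqrt 2 * c * (H1norm \<Omega> y)\<^sup>2 \<le> Re z - Im z"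
    if y: "y \<in> H1 \<Omega>" and S: "S \<le> K * (L2norm ?M y)\<^sup>2"
      and z: "Re z = (L2norm ?M (wgrad \<Omega> y))\<^sup>2 - S" "Im z = - k0 * (L2norm \<Gamma> (bdry_trace \<Omega> \<Gamma> y))\<^sup>2" for y S z
  proof -
    define A Y G where "A = (L2norm ?M (wgrad \<Omega> y))\<^sup>2" and "Y = (L2norm ?M y)\<^sup>2" and "G = (L2norm \<Gamma> (bdry_trace \<Omega> \<Gamma> y))\<^sup>2"
    have nn: "0 \<le> A" "0 \<le> Y" "0 \<le> G" by (auto simp: A_def Y_def G_def)
    have H: "(H1norm \<Omega> y)\<^sup>2 = A + Y" by (simp add: T.H1norm_sq A_def Y_def)
    have "(sqrt lam * H1norm \<Omega> y)\<^sup>2 \<le> (sqrt (G + A))\<^sup>2"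
      using lam_bound[OF y] lam_pos by (intro power_mono) (auto simp: A_def G_def)
    then have l: "lam * (A + Y) \<le> A + G" using lam_pos nn by (simp add: power_mult_distrib H)
    have R: "A - K * Y \<le> Re z" using S by (simp add: z A_def Y_def)
    have Im: "Re z + k0 * G = Re z - Im z" by (simp add: z G_def)
    show 3: "sqrt 2 * c * (H1norm \<Omega> y)\<^sup>2 \<le> Re z - Im z"
      using coercive_real_part[OF nn(1,3,2) K0 k0_pos R l] unfolding H Im c_eq .
    from order_trans[OF 3 norm_ge_rotated]
    show "c * (H1norm \<Omega> y)\<^sup>2 \<le> norm z" by (simp add: mult.assoc)
    have "K * Y \<le> k0\<^sup>2 * (1 + r) * Y" by (rule mult_right_mono[OF KK nn(2)])
    with R have "A - k0\<^sup>2 * (1 + r) * Y \<le> Re z" by linarith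
    from coercive_nondegenerate[OF nn(1,3,2) less_imp_le[OF r_pos] k0_pos this l lam1 k2r]
    show "sqrt 2 * (k0\<^sup>2 * r) * (H1norm \<Omega> y)\<^sup>2 \<le> norm z"
      unfolding H cmod_def z(2) G_def[symmetric] by (simp add: mult.assoc)
  qed

  have solve: "x \<le> t / s" if "s * x\<^sup>2 \<le> t * x" "0 < s" "0 \<le> t" "0 \<le> x" for s t x :: real
  proof (cases "x = 0")
    case False
    then have "s * x \<le> t" using that by (simp add: power2_eq_square)
    then show ?thesis using that by (simp add: pos_le_divide_eq mult.commute)
  qed (use that in simp)

  define V where "V x = k0\<^sup>2 * (1 + q x * w x)" for x
  have V_bdd: "AE x in ?M. \<bar>V x\<bar> \<le> k0\<^sup>2 * (1 + r)"
    using qw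
  proof eventually_elim
    case (elim x)
    then have "\<bar>1 + q x * w x\<bar> \<le> 1 + r" by linarith
    then show ?case unfolding V_def abs_mult by (simp add: mult_left_mono)
  qed
  have V_meas [measurable]: "V \<in> borel_measurable ?M" unfolding V_def by measurable
  interpret Hh: helmholtz \<Omega> "sq.pt (L / 2) (L / 2)" "L / 4" \<Gamma> "sqrt (4 * (1 / L + 1))" k0 "k0\<^sup>2 * (1 + r)" V
    by unfold_locales (use V_bdd V_meas k0_pos r_pos in auto)
  have form_coercive: "c * (H1norm \<Omega> y)\<^sup>2 \<le> norm (Hh.form y y)"
    "sqrt 2 * (k0\<^sup>2 * r) * (H1norm \<Omega> y)\<^sup>2 \<le> norm (Hh.form y y)"
    "sqrt 2 * c * (H1norm \<Omega> y)\<^sup>2 \<le> Re (Hh.form y y) - Im (Hh.form y y)" if y: "y \<in> H1 \<Omega>" for y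
  proof -
    have VK: "AE x in ?M. V x \<le> K"
      using w_adm(2) by eventually_elim (auto simp: V_def K_def intro!: mult_left_mono up)
    note * = coercive[OF y Hh.Re_L2inner_self_le[OF T.H1D(1)[OF y] V_meas V_bdd VK] Hh.form_self]
    show "c * (H1norm \<Omega> y)\<^sup>2 \<le> norm (Hh.form y y)"
      "sqrt 2 * (k0\<^sup>2 * r) * (H1norm \<Omega> y)\<^sup>2 \<le> norm (Hh.form y y)"
      "sqrt 2 * c * (H1norm \<Omega> y)\<^sup>2 \<le> Re (Hh.form y y) - Im (Hh.form y y)" by (rule *)+
  qed

  note uhD = T.H1D[OF uh_H1] and uD = T.H1D[OF u_H1]
  define Puh where "Puh = A.P uh"
  have Puh2: "Puh \<in> L2 ?M" unfolding Puh_def by (rule A.average_L2)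
  define F where "F x = of_real (q x * w x) * u0 x" for x
  define J where "J x = of_real (q x * A.P w x) * Puh x" for x
  have F2: "F \<in> L2 ?M" unfolding F_def[abs_def] by (rule L2_bounded_times[OF u02 _ qw]) measurable
  have J2: "J \<in> L2 ?M" unfolding J_def[abs_def] by (rule L2_bounded_times[OF Puh2 _ qPw]) measurable
  have FU: "L2norm ?M F \<le> r * U"
    unfolding F_def[abs_def] U_def by (rule L2norm_bounded_times[OF u02 _ qw]) (use r_pos in simp)
  have JU: "L2norm ?M J \<le> r * L2norm ?M uh"
  proof -
    have "L2norm ?M J \<le> r * L2norm ?M Puh"
      unfolding J_def[abs_def] by (rule L2norm_bounded_times[OF Puh2 _ qPw]) (use r_pos in simp)
    also have "\<dots> \<le> r * L2norm ?M uh"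
      unfolding Puh_def by (intro mult_left_mono A.L2norm_average_le uhD) (use r_pos in simp)
    finally show ?thesis .
  qed
  note uh_eq = uh_solves[unfolded J_def[symmetric] F_def[symmetric] Puh_def[symmetric]]

  text \<open>Since \<open>q P w\<close> is cellwise constant, \<open>(q (P w) (P uh), uh) = (q (P w) (P uh), P uh)\<close>.\<close>
  have Juh: "L2inner ?M J uh = L2inner ?M J Puh"
  proof -
    have "A.cellwise J" unfolding J_def[abs_def] Puh_def
      by (intro A.cellwise_comp2[where f="\<lambda>s t. complex_of_real s * t"] A.cellwise_comp2[where f="(*)"]
          q_cell A.cellwise_average)
    then have "A.cellwise (\<lambda>x. cnj (J x))" by (rule A.cellwise_comp)
    from A.average_orthogonal[OF uhD(1) this]
    have "L2inner ?M (\<lambda>x. uh x - Puh x) J = 0" by (simp add: L2inner_def Puh_def mult.commute)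
    then have "L2inner ?M uh J = L2inner ?M Puh J"
      by (simp add: L2inner_diff_left[OF uhD(1) Puh2 J2])
    then show ?thesis by (simp add: L2inner_commute[of ?M J uh, symmetric] L2inner_commute[of ?M uh J] L2inner_commute[of ?M Puh J])
  qed
  define Huh where "Huh = H1norm \<Omega> uh"
  have Huh0: "0 \<le> Huh" by (simp add: Huh_def)
  have uh_bounds: "Huh \<le> c2 * U" "sqrt 2 * Huh \<le> U"
  proof -
    define S where "S = k0\<^sup>2 * (L2norm ?M uh)\<^sup>2 + k0\<^sup>2 * Re (L2inner ?M J Puh)"
    define z where "z = grad_inner \<Omega> uh uh - of_real (k0\<^sup>2) * L2inner ?M uh uh - of_real (k0\<^sup>2) * L2inner ?M J uh
      - \<i> * of_real k0 * bdry_inner \<Omega> \<Gamma> uh uh"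
    have PJ: "Re (L2inner ?M J Puh) \<le> qt * max 0 wu * (L2norm ?M Puh)\<^sup>2"
      unfolding J_def[abs_def]
      by (rule Hh.Re_L2inner_self_le[OF Puh2 _ qPw]) (use Pw up in \<open>auto intro!: AE_I2\<close>)
    have "(L2norm ?M Puh)\<^sup>2 \<le> (L2norm ?M uh)\<^sup>2"
      unfolding Puh_def by (intro power_mono A.L2norm_average_le uhD) simp
    then have "qt * max 0 wu * (L2norm ?M Puh)\<^sup>2 \<le> qt * max 0 wu * (L2norm ?M uh)\<^sup>2"
      using qt_pos by (intro mult_left_mono) auto
    with PJ have "k0\<^sup>2 * Re (L2inner ?M J Puh) \<le> k0\<^sup>2 * (qt * max 0 wu * (L2norm ?M uh)\<^sup>2)"
      by (intro mult_left_mono) auto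
    then have S: "S \<le> K * (L2norm ?M uh)\<^sup>2" by (simp add: S_def K_def algebra_simps)
    \<comment> \<open>The averaged term is real, so the imaginary part of \<open>z\<close> is the
      boundary term alone.\<close>
    have ImJ: "Im (L2inner ?M J Puh) = 0"
    proof -
      have "(\<lambda>x. J x * cnj (Puh x)) = (\<lambda>x. complex_of_real (q x * A.P w x * (norm (Puh x))\<^sup>2))"
        by (simp add: J_def mult.assoc complex_norm_square del: of_real_power)
      then show ?thesis unfolding L2inner_def by (simp only: integral_complex_of_real) simp
    qed
    have z: "Re z = (L2norm ?M (wgrad \<Omega> uh))\<^sup>2 - S" "Im z = - k0 * (L2norm \<Gamma> (bdry_trace \<Omega> \<Gamma> uh))\<^sup>2"
      by (simp_all add: z_def S_def Juh ImJ T.grad_inner_self L2inner_self T.bdry_inner_self)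
    have "z = of_real (k0\<^sup>2) * L2inner ?M F uh" unfolding z_def by (rule uh_eq[OF uh_H1])
    then have "norm z = k0\<^sup>2 * norm (L2inner ?M F uh)" by (simp add: norm_mult norm_power)
    also have "\<dots> \<le> k0\<^sup>2 * (r * U * Huh)"
      using r_pos U0 by (intro mult_left_mono order_trans[OF L2inner_bound[OF F2 uhD(1)]] mult_mono FU)
        (auto simp: Huh_def T.L2norm_le_H1norm)
    finally have nz: "norm z \<le> k0\<^sup>2 * r * U * Huh" by (simp add: mult.assoc)
    have "Huh \<le> (k0\<^sup>2 * r * U) / c"
      using order_trans[OF coercive(1)[OF uh_H1 S z] nz] c_pos r_pos U0 Huh0
      by (intro solve) (auto simp: Huh_def)
    then show "Huh \<le> c2 * U" by (simp add: c2_def r_def m_def divide_inverse ac_simps)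
    \<comment> \<open>The source carries the factor \<open>k0^2 * r\<close> too, and it cancels
      against the second coercivity constant.\<close>
    have "Huh \<le> (k0\<^sup>2 * r * U) / (sqrt 2 * (k0\<^sup>2 * r))"
      using order_trans[OF coercive(2)[OF uh_H1 S z] nz] k0_pos r_pos U0 Huh0
      by (intro solve) (auto simp: Huh_def)
    then have "Huh \<le> U / sqrt 2" using k0_pos r_pos by simp
    then show "sqrt 2 * Huh \<le> U" by (simp add: pos_le_divide_eq mult.commute)
  qed

  define er where "er x = u x - uh x" for x
  have erH: "er \<in> H1 \<Omega>" unfolding er_def[abs_def] by (rule T.H1_diff(1)[OF u_H1 uh_H1])
  note er2 = T.H1D(1)[OF erH]
  define E where "E = L2norm ?M er"
  have E0: "0 \<le> E" by (simp add: E_def)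
  have "sqrt 2 * c > 0" using c_pos by simp
  from Hh.dual_solution[OF form_coercive(3) this er2]
  obtain p where pH: "p \<in> H1 \<Omega>" and p_eq: "\<And>v. v \<in> H1 \<Omega> \<Longrightarrow> Hh.form v p = L2inner ?M v er" by blast
  note pD = T.H1D[OF pH]
  define Hp where "Hp = H1norm \<Omega> p"
  have Hp0: "0 \<le> Hp" by (simp add: Hp_def)
  have p_bounds: "Hp \<le> c2p * E" "sqrt 2 * (k0\<^sup>2 * r * Hp) \<le> E"
  proof -
    have nz: "norm (Hh.form p p) \<le> E * Hp"
    proof -
      have "norm (Hh.form p p) \<le> L2norm ?M p * E"
        unfolding p_eq[OF pH] E_def by (rule L2inner_bound[OF pD(1) er2])
      also have "\<dots> \<le> Hp * E" unfolding Hp_def by (rule mult_right_mono[OF T.L2norm_le_H1norm(1) E0])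
      finally show ?thesis by (simp add: mult.commute)
    qed
    have "Hp \<le> E / c"
      using order_trans[OF form_coercive(1)[OF pH] nz] c_pos E0 Hp0 by (intro solve) (auto simp: Hp_def)
    then show "Hp \<le> c2p * E" by (simp add: c2p_def divide_inverse mult.commute)
    have "Hp \<le> E / (sqrt 2 * (k0\<^sup>2 * r))"
      using order_trans[OF form_coercive(2)[OF pH] nz] k0_pos r_pos E0 Hp0 by (intro solve) (auto simp: Hp_def)
    then show "sqrt 2 * (k0\<^sup>2 * r * Hp) \<le> E"
      using k0_pos r_pos by (simp add: pos_le_divide_eq ac_simps)
  qed

  \<comment> \<open>The factor in both \<open>H2\<close> bounds: the first summand is regularity
    applied to the source, the second regularity applied to the term with \<open>q\<close> moved to
    the right, the third the \<open>H1\<close> norm.\<close>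
  define B where "B = C\<Omega> * (1 + \<bar>k0\<bar>) + c1 * c2p + c2p"
  have c2p_pos: "0 < c2p" using c_pos by (simp add: c2p_def)
  have c1_eq: "c1 = C\<Omega> * (1 + \<bar>k0\<bar>) * (k0\<^sup>2 * r)" by (simp add: c1_def r_def m_def)
  have c2_eq: "c2 = k0\<^sup>2 * r * c2p" by (simp add: c2_def c2p_def r_def m_def)
  have kr: "0 < k0\<^sup>2 * r" using k0_pos r_pos by simp
  have CO: "0 < C\<Omega> * (1 + \<bar>k0\<bar>)" using C\<Omega>_pos by (simp add: add_pos_nonneg)
  have B_pos: "0 < B" using c2p_pos CO kr by (simp add: B_def c1_eq add_pos_nonneg)
  have c3_0: "0 \<le> c3" by (rule T.c3_nonneg[OF c3_embedding])
  have H2_le: "H2norm \<Omega> y \<le> H1norm \<Omega> y + H2seminorm \<Omega> y" for y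
    unfolding H2norm_def by (rule sqrt_sum_squares_le_sum) (auto simp: H2seminorm_def intro!: sum_nonneg)

  have p_sup: "AE x in ?M. norm (p x) \<le> c3 * (B * E)"
  proof -
    \<comment> \<open>The conjugated dual equation is a Robin problem with boundary coefficient
      \<open>- k0\<close>; the potential term \<open>k0^2 * q * w * p\<close> joins the right-hand
      side.\<close>
    define g where "g x = er x + of_real (k0\<^sup>2) * (of_real (q x * w x) * p x)" for x
    have qwp2: "(\<lambda>x. of_real (q x * w x) * p x) \<in> L2 ?M"
      by (rule L2_bounded_times[OF pD(1) _ qw]) measurable
    have g2: "g \<in> L2 ?M" unfolding g_def[abs_def] by (intro L2_add L2_scaleC er2 qwp2)
    have gn: "L2norm ?M g \<le> E + k0\<^sup>2 * (r * Hp)"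
    proof -
      have "L2norm ?M g \<le> E + L2norm ?M (\<lambda>x. of_real (k0\<^sup>2) * (of_real (q x * w x) * p x))"
        unfolding g_def[abs_def] E_def by (rule L2norm_triangle[OF er2 L2_scaleC[OF qwp2]])
      also have "L2norm ?M (\<lambda>x. of_real (k0\<^sup>2) * (of_real (q x * w x) * p x)) = k0\<^sup>2 * L2norm ?M (\<lambda>x. of_real (q x * w x) * p x)"
        unfolding L2norm_scaleC norm_of_real by simp
      also have "L2norm ?M (\<lambda>x. of_real (q x * w x) * p x) \<le> r * L2norm ?M p"
        by (rule L2norm_bounded_times[OF pD(1) _ qw]) (use r_pos in simp)
      also have "L2norm ?M p \<le> Hp" unfolding Hp_def by (rule T.L2norm_le_H1norm)
      finally show ?thesis using r_pos by (simp add: mult_left_mono)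
    qed
    have "robin_solution \<Omega> \<Gamma> k0 (- k0) g p"
      unfolding robin_solution_def
    proof (intro conjI ballI pH)
      fix v assume v: "v \<in> H1 \<Omega>"
      have "cnj (Hh.form v p) = L2inner ?M er v" unfolding p_eq[OF v] by (rule L2inner_commute[symmetric])
      then have "grad_inner \<Omega> p v - L2inner ?M (\<lambda>x. of_real (V x) * p x) v + \<i> * of_real k0 * bdry_inner \<Omega> \<Gamma> p v = L2inner ?M er v"
        unfolding Hh.cnj_form .
      moreover have "L2inner ?M (\<lambda>x. of_real (V x) * p x) v
          = of_real (k0\<^sup>2) * L2inner ?M p v + of_real (k0\<^sup>2) * L2inner ?M (\<lambda>x. of_real (q x * w x) * p x) v"
      proof -
        have "(\<lambda>x. of_real (V x) * p x) = (\<lambda>x. of_real (k0\<^sup>2) * (p x + 1 * (of_real (q x * w x) * p x)))"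
          by (simp add: V_def algebra_simps)
        then show ?thesis
          using L2inner_add_scale_left[OF pD(1) qwp2 T.H1D(1)[OF v], of 1]
          by (simp only: L2inner_scale_left) (simp add: algebra_simps)
      qed
      moreover have "L2inner ?M g v = L2inner ?M er v + of_real (k0\<^sup>2) * L2inner ?M (\<lambda>x. of_real (q x * w x) * p x) v"
        unfolding g_def[abs_def] by (rule L2inner_add_scale_left[OF er2 qwp2 T.H1D(1)[OF v]])
      ultimately show "grad_inner \<Omega> p v - complex_of_real (k0\<^sup>2) * L2inner ?M p v - \<i> * complex_of_real (- k0) * bdry_inner \<Omega> \<Gamma> p v = L2inner ?M g v"
        by (simp add: algebra_simps)
    qed
    from C\<Omega>_regularity[OF k0_pos _ g2 this]
    have p2: "p \<in> H2 \<Omega>" "H2seminorm \<Omega> p \<le> C\<Omega> * (1 + \<bar>k0\<bar>) * L2norm ?M g" by auto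
    have "H2seminorm \<Omega> p \<le> C\<Omega> * (1 + \<bar>k0\<bar>) * (E + k0\<^sup>2 * (r * (c2p * E)))"
      using p2(2) CO gn p_bounds(1) r_pos
      by (elim order_trans) (intro mult_left_mono order_trans[OF gn] add_left_mono, auto)
    also have "\<dots> = (C\<Omega> * (1 + \<bar>k0\<bar>) + c1 * c2p) * E" by (simp add: c1_eq algebra_simps)
    finally have "H2norm \<Omega> p \<le> B * E"
      using H2_le[of p] p_bounds(1) by (simp add: Hp_def B_def algebra_simps)
    then have le: "c3 * H2norm \<Omega> p \<le> c3 * (B * E)" using c3_0 by (rule mult_left_mono)
    show ?thesis using c3_embedding[OF p2(1)] by eventually_elim (use le in simp)
  qed

  have uh_sup: "AE x in ?M. norm (uh x) \<le> c3 * (k0\<^sup>2 * r * (B * U))"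
  proof -
    \<comment> \<open>Likewise the averaged term \<open>J\<close> becomes part of the source. Every
      source carries \<open>k0^2 * r\<close>, and \<open>c2 = k0^2 * r * c2p\<close>, so the bound
      is that for \<open>p\<close> with \<open>E\<close> replaced by
      \<open>k0^2 * r * U\<close>.\<close>
    define g where "g x = of_real (k0\<^sup>2) * (J x + 1 * F x)" for x
    have g2: "g \<in> L2 ?M" unfolding g_def[abs_def] by (intro L2_scaleC L2_add J2 F2)
    have gn: "L2norm ?M g \<le> k0\<^sup>2 * (r * Huh + r * U)"
    proof -
      have "L2norm ?M g = k0\<^sup>2 * L2norm ?M (\<lambda>x. J x + F x)"
        unfolding g_def[abs_def] L2norm_scaleC norm_of_real by simp
      also have "\<dots> \<le> k0\<^sup>2 * (L2norm ?M J + L2norm ?M F)"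
        by (intro mult_left_mono L2norm_triangle J2 F2) simp
      also have "L2norm ?M J \<le> r * Huh"
        by (rule order_trans[OF JU]) (use r_pos in \<open>simp add: Huh_def mult_left_mono T.L2norm_le_H1norm\<close>)
      also note FU
      finally show ?thesis by (simp add: mult_left_mono add_mono)
    qed
    have "robin_solution \<Omega> \<Gamma> k0 k0 g uh"
      unfolding robin_solution_def
    proof (intro conjI ballI uh_H1)
      fix v assume v: "v \<in> H1 \<Omega>"
      have "L2inner ?M g v = of_real (k0\<^sup>2) * (L2inner ?M J v + 1 * L2inner ?M F v)"
        unfolding g_def[abs_def] L2inner_scale_left L2inner_add_scale_left[OF J2 F2 T.H1D(1)[OF v]] ..
      then show "grad_inner \<Omega> uh v - complex_of_real (k0\<^sup>2) * L2inner ?M uh v - \<i> * complex_of_real k0 * bdry_inner \<Omega> \<Gamma> uh v = L2inner ?M g v"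
        using uh_eq[OF v] by (simp add: algebra_simps)
    qed
    from C\<Omega>_regularity[OF k0_pos _ g2 this]
    have uh2: "uh \<in> H2 \<Omega>" "H2seminorm \<Omega> uh \<le> C\<Omega> * (1 + \<bar>k0\<bar>) * L2norm ?M g" by auto
    have "H2seminorm \<Omega> uh \<le> C\<Omega> * (1 + \<bar>k0\<bar>) * (k0\<^sup>2 * (r * (c2 * U) + r * U))"
      using uh2(2) CO uh_bounds(1) r_pos
      by (elim order_trans) (intro mult_left_mono order_trans[OF gn] add_right_mono, auto)
    also have "\<dots> = k0\<^sup>2 * r * ((C\<Omega> * (1 + \<bar>k0\<bar>) + c1 * c2p) * U)" by (simp add: c1_eq c2_eq algebra_simps)
    finally have "H2norm \<Omega> uh \<le> k0\<^sup>2 * r * (B * U)"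
      using H2_le[of uh] uh_bounds(1) by (simp add: Huh_def B_def c2_eq algebra_simps)
    then have le: "c3 * H2norm \<Omega> uh \<le> c3 * (k0\<^sup>2 * r * (B * U))" using c3_0 by (rule mult_left_mono)
    show ?thesis using c3_embedding[OF uh2(1)] by eventually_elim (use le in simp)
  qed

  define Wn where "Wn = L2norm ?M (\<lambda>x. w x - A.P w x)"
  have Wn0: "0 \<le> Wn" by (simp add: Wn_def)
  \<comment> \<open>The dual equation is tested with \<open>er\<close>. Subtracting the two weak
    equations tested with \<open>p\<close> cancels the common source \<open>F\<close> and leaves the
    consistency error.\<close>
  have err: "of_real (E\<^sup>2) = of_real (k0\<^sup>2) *
      L2inner ?M (\<lambda>x. of_real (q x) * (of_real (w x) * uh x - of_real (A.P w x) * A.P uh x)) p"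
  proof -
    define X where "X x = of_real (q x * w x) * uh x" for x
    have X2: "X \<in> L2 ?M" unfolding X_def[abs_def] by (rule L2_bounded_times[OF uhD(1) _ qw]) measurable
    have Vuh: "L2inner ?M (\<lambda>x. of_real (V x) * uh x) p = of_real (k0\<^sup>2) * (L2inner ?M uh p + 1 * L2inner ?M X p)"
    proof -
      have "(\<lambda>x. of_real (V x) * uh x) = (\<lambda>x. of_real (k0\<^sup>2) * (uh x + 1 * X x))"
        by (simp add: V_def X_def algebra_simps)
      then show ?thesis by (simp only: L2inner_scale_left L2inner_add_scale_left[OF uhD(1) X2 pD(1)])
    qed
    have Vu: "L2inner ?M (\<lambda>x. of_real (V x) * u x) p = of_real (k0\<^sup>2) * L2inner ?M (\<lambda>x. of_real (1 + q x * w x) * u x) p"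
      unfolding L2inner_scale_left[symmetric] by (simp add: V_def mult.assoc)
    have "Hh.form er p = Hh.form u p + (- 1) * Hh.form uh p"
      using Hh.form_add_scale_left[OF u_H1 uh_H1 pH, of "-1"] by (simp add: er_def[abs_def])
    also have "\<dots> = of_real (k0\<^sup>2) * (L2inner ?M X p - L2inner ?M J p)"
      using u_solves[OF pH] uh_eq[OF pH] unfolding Hh.form_def Vuh Vu F_def[symmetric] by (simp add: algebra_simps)
    also have "L2inner ?M X p - L2inner ?M J p = L2inner ?M (\<lambda>x. X x - J x) p"
      by (rule L2inner_diff_left[OF X2 J2 pD(1), symmetric])
    finally have "L2inner ?M er er = of_real (k0\<^sup>2) * L2inner ?M (\<lambda>x. X x - J x) p"
      unfolding p_eq[OF erH] .
    moreover have "(\<lambda>x. X x - J x) = (\<lambda>x. of_real (q x) * (of_real (w x) * uh x - of_real (A.P w x) * A.P uh x))"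
      by (simp add: X_def J_def Puh_def algebra_simps)
    ultimately show ?thesis by (simp add: L2inner_self E_def)
  qed
  have ey: "L2norm ?M (\<lambda>x. uh x - A.P uh x) \<le> \<alpha> * dh h * Huh"
    unfolding Huh_def
    by (rule order_trans[OF \<alpha>_H1[OF h_in uh_H1]]) (intro mult_left_mono T.L2norm_le_H1norm, use \<alpha>_pos dh0 in simp)
  have ep: "L2norm ?M (\<lambda>x. p x - A.P p x) \<le> \<alpha> * dh h * Hp"
    unfolding Hp_def
    by (rule order_trans[OF \<alpha>_H1[OF h_in pH]]) (intro mult_left_mono T.L2norm_le_H1norm, use \<alpha>_pos dh0 in simp)
  define D where "D = \<alpha> * dh h"
  have D0: "0 \<le> D" using \<alpha>_pos dh0 by (simp add: D_def)
  have E2: "E\<^sup>2 \<le> k0\<^sup>2 * (qt * (Wn * (D * Huh * (c3 * (B * E)) + c3 * (k0\<^sup>2 * r * (B * U)) * (D * Hp)) + m * (D * Huh * (D * Hp))))"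
  proof -
    have "E\<^sup>2 = norm (complex_of_real (E\<^sup>2))" unfolding norm_of_real by simp
    also have "\<dots> = k0\<^sup>2 * norm (L2inner ?M (\<lambda>x. of_real (q x) * (of_real (w x) * uh x - of_real (A.P w x) * A.P uh x)) p)"
      unfolding err norm_mult norm_of_real by simp
    also have "\<dots> \<le> k0\<^sup>2 * (qt * (Wn * (L2norm ?M (\<lambda>x. uh x - A.P uh x) * (c3 * (B * E))
        + c3 * (k0\<^sup>2 * r * (B * U)) * L2norm ?M (\<lambda>x. p x - A.P p x))
        + m * (L2norm ?M (\<lambda>x. uh x - A.P uh x) * L2norm ?M (\<lambda>x. p x - A.P p x))))"
      unfolding Wn_def
      by (intro mult_left_mono A.error_split[OF w_adm _ _ q_cell q_range(3) uhD(1) uh_sup pD(1) p_sup])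
         (use qt_pos c3_0 B_pos E0 U0 m_pos kr in \<open>auto simp: m_def\<close>)
    also have "\<dots> \<le> k0\<^sup>2 * (qt * (Wn * (D * Huh * (c3 * (B * E)) + c3 * (k0\<^sup>2 * r * (B * U)) * (D * Hp)) + m * (D * Huh * (D * Hp))))"
      unfolding D_def
      by (intro mult_left_mono add_mono mult_right_mono mult_mono ey ep)
         (use qt_pos c3_0 B_pos E0 U0 m_pos kr Wn0 \<alpha>_pos dh0 Huh0 Hp0 in auto)
    finally show ?thesis .
  qed
  \<comment> \<open>\<open>Z\<close> is the coefficient of the oscillation \<open>Wn\<close> of
    \<open>w\<close>, whereas \<open>Z2\<close> is already the second term of the claim.\<close>
  define Z where "Z = k0\<^sup>2 * qt * D * (sqrt 2 * c3 * B) * U"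
  define Z2 where "Z2 = \<alpha>\<^sup>2 * c2 * c2p * (1 + r) * U * (dh h)\<^sup>2"
  have Z0: "0 \<le> Z" using qt_pos D0 c3_0 B_pos U0 by (simp add: Z_def)
  have Z20: "0 \<le> Z2" using c2p_pos kr r_pos U0 by (simp add: Z2_def c2_eq)
  have EZ: "E \<le> Z * Wn + Z2"
  proof -
    have "D * Huh * (c3 * (B * E)) + c3 * (k0\<^sup>2 * r * (B * U)) * (D * Hp)
        = D * c3 * B * (Huh * E + k0\<^sup>2 * r * Hp * U)" by (simp add: algebra_simps)
    \<comment> \<open>The bounds from the second coercivity constant make each of the two summands
      at most \<open>U * E / sqrt 2\<close>.\<close>
    also have "\<dots> \<le> D * c3 * B * (sqrt 2 * U * E)"
    proof (rule mult_left_mono)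
      have "sqrt 2 * (Huh * E + k0\<^sup>2 * r * Hp * U) = (sqrt 2 * Huh) * E + sqrt 2 * (k0\<^sup>2 * r * Hp) * U"
        by (simp add: algebra_simps)
      also have "\<dots> \<le> U * E + E * U" using uh_bounds(2) p_bounds(2) E0 U0 by (intro add_mono mult_right_mono) auto
      also have "\<dots> = sqrt 2 * (sqrt 2 * U * E)" by simp
      finally show "Huh * E + k0\<^sup>2 * r * Hp * U \<le> sqrt 2 * U * E" by simp
    qed (use D0 c3_0 B_pos in simp)
    finally have 1: "D * Huh * (c3 * (B * E)) + c3 * (k0\<^sup>2 * r * (B * U)) * (D * Hp) \<le> D * c3 * B * (sqrt 2 * U * E)" .
    \<comment> \<open>Here the bounds from the first coercivity constant are used; they produce
      \<open>c2 * c2p\<close>.\<close>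
    have "Huh * Hp \<le> (c2 * U) * (c2p * E)"
      using uh_bounds(1) p_bounds(1) Huh0 Hp0 by (intro mult_mono) auto
    then have "D\<^sup>2 * (Huh * Hp) \<le> D\<^sup>2 * ((c2 * U) * (c2p * E))" by (rule mult_left_mono) simp
    then have 2: "D * Huh * (D * Hp) \<le> D\<^sup>2 * (c2 * U * (c2p * E))" by (simp add: power2_eq_square ac_simps)
    have "E\<^sup>2 \<le> k0\<^sup>2 * (qt * (Wn * (D * c3 * B * (sqrt 2 * U * E)) + m * (D\<^sup>2 * (c2 * U * (c2p * E)))))"
      by (rule order_trans[OF E2]) (intro mult_left_mono add_mono 1 2; use qt_pos Wn0 m_pos in simp)
    also have "\<dots> = Z * Wn * E + (k0\<^sup>2 * r) * (D\<^sup>2 * c2 * c2p * U) * E"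
      by (simp add: Z_def r_def algebra_simps)
    also have "(k0\<^sup>2 * r) * (D\<^sup>2 * c2 * c2p * U) * E \<le> (1 + r) * (D\<^sup>2 * c2 * c2p * U) * E"
      using k2_le1 c2p_pos kr U0 E0 by (intro mult_right_mono) (auto simp: c2_eq)
    also have "Z * Wn * E + (1 + r) * (D\<^sup>2 * c2 * c2p * U) * E = (Z * Wn + Z2) * E"
      by (simp add: Z2_def D_def power_mult_distrib algebra_simps)
    finally have *: "E * E \<le> (Z * Wn + Z2) * E" by (simp add: power2_eq_square)
    show ?thesis
    proof (cases "E = 0")
      case True
      then show ?thesis using Z0 Z20 Wn0 by simp
    next
      case False
      then have "0 < E" using E0 by simp
      with * show ?thesis by (rule mult_right_le_imp_le)
    qed
  qed

  define X where "X = (\<integral>x. \<bar>w x - A.P w x\<bar> \<partial>?M)"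
  have X0: "0 \<le> X" by (simp add: X_def)
  have XTV: "ennreal X \<le> ennreal D * TV \<Omega> w" unfolding X_def D_def by (rule \<alpha>_TV[OF h_in wi])
  have WX: "Wn \<le> sqrt (wu - wl) * sqrt X"
  proof -
    have "Wn\<^sup>2 \<le> (wu - wl) * X" unfolding Wn_def X_def by (rule A.L2norm_diff_average[OF w_adm])
    then have "sqrt (Wn\<^sup>2) \<le> sqrt ((wu - wl) * X)" by (rule real_sqrt_le_mono)
    then show ?thesis using Wn0 by (simp add: real_sqrt_mult)
  qed
  \<comment> \<open>In \<open>ennreal\<close> zero times infinity is zero. For infinite variation
    and \<open>D = 0\<close> the right side is therefore 0, and \<open>X = 0\<close> follows from
    \<open>XTV\<close> by the same convention.\<close>
  have sX: "ennreal (sqrt X) \<le> ennreal (sqrt D) * ennreal_sqrt (TV \<Omega> w)"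
  proof (cases "TV \<Omega> w = \<infinity>")
    case True
    show ?thesis
    proof (cases "D = 0")
      case True
      then have "X = 0" using XTV X0 by simp
      then show ?thesis by simp
    next
      case False
      then have "ennreal (sqrt D) \<noteq> 0" using D0 by (simp add: ennreal_eq_0_iff)
      then show ?thesis using True by (simp add: ennreal_sqrt_def ennreal_mult_top)
    qed
  next
    case False
    then obtain t where t: "TV \<Omega> w = ennreal t" "0 \<le> t" by (cases "TV \<Omega> w") auto
    then have "X \<le> D * t" using XTV D0 by (simp add: ennreal_mult[symmetric])
    then have "sqrt X \<le> sqrt D * sqrt t" by (simp add: real_sqrt_mult[symmetric])
    then show ?thesis using t D0 by (simp add: ennreal_sqrt_def ennreal_mult[symmetric] ennreal_leI)
  qed

  have "ennreal E \<le> ennreal (Z * Wn) + ennreal Z2"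
  proof -
    have "ennreal E \<le> ennreal (Z * Wn + Z2)" by (rule ennreal_leI[OF EZ])
    also have "\<dots> = ennreal (Z * Wn) + ennreal Z2" by (rule ennreal_plus[OF mult_nonneg_nonneg[OF Z0 Wn0] Z20])
    finally show ?thesis .
  qed
  also have "ennreal (Z * Wn) \<le> ennreal (Z * (sqrt (wu - wl) * sqrt X))"
    by (intro ennreal_leI mult_left_mono WX Z0)
  also have "\<dots> = ennreal (Z * sqrt (wu - wl)) * ennreal (sqrt X)"
    using Z0 w_bounds X0 by (simp add: ennreal_mult[symmetric] mult.assoc)
  also have "\<dots> \<le> ennreal (Z * sqrt (wu - wl)) * (ennreal (sqrt D) * ennreal_sqrt (TV \<Omega> w))"
    by (intro mult_left_mono sX) simp
  also have "\<dots> = ennreal (Z * sqrt (wu - wl) * sqrt D) * ennreal_sqrt (TV \<Omega> w)"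
    using Z0 w_bounds D0 by (simp add: ennreal_mult mult.assoc)
  \<comment> \<open>\<open>D * sqrt D\<close> supplies the powers \<open>3/2\<close> of both
    \<open>\<alpha>\<close> and \<open>dh h\<close>.\<close>
  also have "Z * sqrt (wu - wl) * sqrt D
      = (k0\<^sup>2 * \<alpha> powr (3/2) * qt * U * \<bar>wu - wl\<bar> powr (1/2)) * (sqrt 2 * c3 * B) * dh h powr (3/2)"
  proof -
    have p32: "x powr (3/2) = x * sqrt x" if "0 \<le> x" for x :: real
    proof -
      have "x powr (3/2) = x powr (1 + 1/2)" by simp
      also have "\<dots> = x powr 1 * x powr (1/2)" by (rule powr_add)
      finally show ?thesis using that by (simp add: powr_half_sqrt)
    qed
    have "\<bar>wu - wl\<bar> powr (1/2) = sqrt (wu - wl)" using w_bounds by (simp add: powr_half_sqrt)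
    then show ?thesis
      using \<alpha>_pos dh0 by (simp add: p32 Z_def D_def real_sqrt_mult ac_simps)
  qed
  \<comment> \<open>Enlarging \<open>sqrt 2 * c3 * B\<close> by the positive \<open>c2p\<close>
    gives the bracket of the claim; all factors are nonnegative, so \<open>ennreal\<close>
    distributes over the product.\<close>
  also have "ennreal \<dots> \<le> ennreal (k0\<^sup>2 * \<alpha> powr (3/2) * qt * U * \<bar>wu - wl\<bar> powr (1/2)) * ennreal (c2p + sqrt 2 * c3 * B) * ennreal (dh h powr (3/2))"
  proof -
    have n: "0 \<le> k0\<^sup>2 * \<alpha> powr (3/2) * qt * U * \<bar>wu - wl\<bar> powr (1/2)" using qt_pos U0 by simp
    have b: "0 \<le> sqrt 2 * c3 * B" using c3_0 B_pos by simp
    have "(k0\<^sup>2 * \<alpha> powr (3/2) * qt * U * \<bar>wu - wl\<bar> powr (1/2)) * (sqrt 2 * c3 * B) * dh h powr (3/2)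
      \<le> (k0\<^sup>2 * \<alpha> powr (3/2) * qt * U * \<bar>wu - wl\<bar> powr (1/2)) * (c2p + sqrt 2 * c3 * B) * dh h powr (3/2)"
      using n c2p_pos by (intro mult_right_mono mult_left_mono) auto
    then have "ennreal ((k0\<^sup>2 * \<alpha> powr (3/2) * qt * U * \<bar>wu - wl\<bar> powr (1/2)) * (sqrt 2 * c3 * B) * dh h powr (3/2))
      \<le> ennreal ((k0\<^sup>2 * \<alpha> powr (3/2) * qt * U * \<bar>wu - wl\<bar> powr (1/2)) * (c2p + sqrt 2 * c3 * B) * dh h powr (3/2))"
      by (rule ennreal_leI)
    also have "\<dots> = ennreal (k0\<^sup>2 * \<alpha> powr (3/2) * qt * U * \<bar>wu - wl\<bar> powr (1/2)) * ennreal (c2p + sqrt 2 * c3 * B) * ennreal (dh h powr (3/2))"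
    proof -
      have "ennreal (x * y * z) = ennreal x * ennreal y * ennreal z" if "0 \<le> x" "0 \<le> y" "0 \<le> z" for x y z
        using that by (simp add: ennreal_mult)
      from this[OF n add_nonneg_nonneg[OF less_imp_le[OF c2p_pos] b] powr_ge_zero] show ?thesis .
    qed
    finally show ?thesis .
  qed
  finally show ?thesis
    unfolding E_def U_def Z2_def B_def r_def m_def er_def[abs_def]
    by (simp add: mult.assoc mult.commute mult.left_commute mult_right_mono add_mono)
qed

end
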